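(* Let $n\geqslant 1$ and let $T=(T_1,\dots,T_l)$ be a finite collection of linear differential operators with constant (complex) coefficients on the torus $\mathbb{T}^n$. Suppose there exist positive real numbers $a_1,\dots,a_n$ such that $\sum_{k=1}^n \alpha_k/a_k\leqslant 1$ for every multiindex $\alpha=(\alpha_1,\dots,\alpha_n)$ for which the monomial $D^\alpha$ occurs with nonzero coefficient in at least one $T_j$, and such that among the corresponding senior parts $\tau_1,\dots,\tau_l$ (where $\tau_j$ is the sum of those terms $c_\alpha D^\alpha$ of $T_j$ with $\sum_{k}\alpha_k/a_k=1$) there are at least two linearly independent operators. Then the bidual of $C^T(\mathbb{T}^n)$ is not isomorphic to a complemented subspace of $C(K)$ for any compact Hausdorff space $K$.
   Context: The torus $\mathbb{T}$ is parametrised by $t\mapsto e^{2\pi i t}$, $t\in[0,1)$, and $\partial_j f$ denotes the derivative of $f(e^{2\pi i t_1},\dots,e^{2\pi i t_n})$ with respect to $t_j$. For a multiindex $\alpha$ of nonnegative integers, $D^\alpha=\partial_1^{\alpha_1}\cdots\partial_n^{\alpha_n}$; a differential operator with constant coefficients is a finite linear combination of such monomials. Given $T=(T_1,\dots,T_l)$, define on trigonometric polynomials in $n$ variables the seminorm $\|f\|_T=\max_{1\leqslant j\leqslant l}\|T_jf\|_{C(\mathbb{T}^n)}$; the Banach space $C^T(\mathbb{T}^n)$ is obtained from this seminormed space by factoring over the null space and completing. *)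

theory Defs
  imports "HOL-Analysis.Analysis"
begin

text \<open>Points of the torus are parametrised by t :: nat => real, only coordinates
 0..n-1 being relevant; the torus itself is the unit cube [0,1)^n.\<close>

definition torus_pts :: "nat \<Rightarrow> (nat \<Rightarrow> real) set" where
  "torus_pts n = {t. \<forall>i<n. 0 \<le> t i \<and> t i < 1}"

definition trig_poly :: "nat \<Rightarrow> ((nat \<Rightarrow> real) \<Rightarrow> complex) \<Rightarrow> bool" where
  "trig_poly n f \<longleftrightarrow> (\<exists>F c. finite F \<and> (\<forall>k\<in>F. \<forall>i\<ge>n. k i = (0::int)) \<and>
     f = (\<lambda>t. \<Sum>k\<in>F. c k * exp (2 * of_real pi * \<i> * of_real (\<Sum>i<n. of_int (k i) * t i))))"

definition partial :: "nat \<Rightarrow> ((nat \<Rightarrow> real) \<Rightarrow> complex) \<Rightarrow> ((nat \<Rightarrow> real) \<Rightarrow> complex)" where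
  "partial j f = (\<lambda>t. vector_derivative (\<lambda>s. f (t(j := s))) (at (t j)))"

definition Dmono :: "nat \<Rightarrow> (nat \<Rightarrow> nat) \<Rightarrow> ((nat \<Rightarrow> real) \<Rightarrow> complex) \<Rightarrow> ((nat \<Rightarrow> real) \<Rightarrow> complex)" where
  "Dmono n \<alpha> f = fold (\<lambda>j g. (partial j ^^ \<alpha> j) g) [0..<n] f"

text \<open>A differential operator with constant complex coefficients in n variables is given by
 its finitely supported coefficient function p : multiindex => complex.\<close>
definition diff_op :: "nat \<Rightarrow> ((nat \<Rightarrow> nat) \<Rightarrow> complex) \<Rightarrow> bool" where
  "diff_op n p \<longleftrightarrow> finite {\<alpha>. p \<alpha> \<noteq> 0} \<and> (\<forall>\<alpha>. p \<alpha> \<noteq> 0 \<longrightarrow> (\<forall>i\<ge>n. \<alpha> i = 0))"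

definition apply_op :: "nat \<Rightarrow> ((nat \<Rightarrow> nat) \<Rightarrow> complex) \<Rightarrow> ((nat \<Rightarrow> real) \<Rightarrow> complex) \<Rightarrow> ((nat \<Rightarrow> real) \<Rightarrow> complex)" where
  "apply_op n p f = (\<lambda>t. \<Sum>\<alpha>\<in>{\<alpha>. p \<alpha> \<noteq> 0}. p \<alpha> * Dmono n \<alpha> f t)"

definition seminorm_T :: "nat \<Rightarrow> ((nat \<Rightarrow> nat) \<Rightarrow> complex) list \<Rightarrow> ((nat \<Rightarrow> real) \<Rightarrow> complex) \<Rightarrow> real" where
  "seminorm_T n T f = Max ((\<lambda>p. Sup ((\<lambda>t. cmod (apply_op n p f t)) ` torus_pts n)) ` set T)"

definition senior :: "nat \<Rightarrow> (nat \<Rightarrow> real) \<Rightarrow> ((nat \<Rightarrow> nat) \<Rightarrow> complex) \<Rightarrow> ((nat \<Rightarrow> nat) \<Rightarrow> complex)" where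
  "senior n a p = (\<lambda>\<alpha>. if (\<Sum>k<n. real (\<alpha> k) / a k) = 1 then p \<alpha> else 0)"

definition lin_indep2 :: "('x \<Rightarrow> complex) \<Rightarrow> ('x \<Rightarrow> complex) \<Rightarrow> bool" where
  "lin_indep2 u v \<longleftrightarrow> (\<forall>x y. (\<forall>\<alpha>. x * u \<alpha> + y * v \<alpha> = 0) \<longrightarrow> x = 0 \<and> y = 0)"

definition lin_op :: "('b \<Rightarrow> complex) set \<Rightarrow> ('c \<Rightarrow> complex) set \<Rightarrow> (('b \<Rightarrow> complex) \<Rightarrow> ('c \<Rightarrow> complex)) \<Rightarrow> bool" where
  "lin_op S R h \<longleftrightarrow> (\<forall>u\<in>S. h u \<in> R) \<and>
     (\<forall>u\<in>S. \<forall>v\<in>S. h (\<lambda>x. u x + v x) = (\<lambda>y. h u y + h v y)) \<and>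
     (\<forall>c. \<forall>u\<in>S. h (\<lambda>x. c * u x) = (\<lambda>y. c * h u y))"

definition bdd_op :: "('b \<Rightarrow> complex) set \<Rightarrow> (('b \<Rightarrow> complex) \<Rightarrow> real) \<Rightarrow> (('c \<Rightarrow> complex) \<Rightarrow> real) \<Rightarrow> (('b \<Rightarrow> complex) \<Rightarrow> ('c \<Rightarrow> complex)) \<Rightarrow> bool" where
  "bdd_op S NS NR h \<longleftrightarrow> (\<exists>C. \<forall>u\<in>S. NR (h u) \<le> C * NS u)"

definition lin_functional :: "('b \<Rightarrow> complex) set \<Rightarrow> (('b \<Rightarrow> complex) \<Rightarrow> complex) \<Rightarrow> bool" where
  "lin_functional S \<phi> \<longleftrightarrow>
     (\<forall>u\<in>S. \<forall>v\<in>S. \<phi> (\<lambda>x. u x + v x) = \<phi> u + \<phi> v) \<and>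
     (\<forall>c. \<forall>u\<in>S. \<phi> (\<lambda>x. c * u x) = c * \<phi> u) \<and>
     (\<forall>u. u \<notin> S \<longrightarrow> \<phi> u = 0)"

definition dual_space :: "('b \<Rightarrow> complex) set \<Rightarrow> (('b \<Rightarrow> complex) \<Rightarrow> real) \<Rightarrow> (('b \<Rightarrow> complex) \<Rightarrow> complex) set" where
  "dual_space S N = {\<phi>. lin_functional S \<phi> \<and> (\<exists>C. \<forall>u\<in>S. cmod (\<phi> u) \<le> C * N u)}"

definition dual_norm :: "('b \<Rightarrow> complex) set \<Rightarrow> (('b \<Rightarrow> complex) \<Rightarrow> real) \<Rightarrow> (('b \<Rightarrow> complex) \<Rightarrow> complex) \<Rightarrow> real" where
  "dual_norm S N \<phi> = Sup {cmod (\<phi> u) | u. u \<in> S \<and> N u \<le> 1}"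

text \<open>Trigonometric polynomials with the seminorm ||.||_T, and the bidual of C^T(T^n)
 (the dual of C^T(T^n) is canonically isometric to the dual of this dense seminormed space).\<close>
definition trig_polys :: "nat \<Rightarrow> ((nat \<Rightarrow> real) \<Rightarrow> complex) set" where
  "trig_polys n = {f. trig_poly n f}"

definition CT_dual :: "nat \<Rightarrow> ((nat \<Rightarrow> nat) \<Rightarrow> complex) list \<Rightarrow> (((nat \<Rightarrow> real) \<Rightarrow> complex) \<Rightarrow> complex) set" where
  "CT_dual n T = dual_space (trig_polys n) (seminorm_T n T)"

definition CT_dual_norm :: "nat \<Rightarrow> ((nat \<Rightarrow> nat) \<Rightarrow> complex) list \<Rightarrow> (((nat \<Rightarrow> real) \<Rightarrow> complex) \<Rightarrow> complex) \<Rightarrow> real" where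
  "CT_dual_norm n T = dual_norm (trig_polys n) (seminorm_T n T)"

definition CT_bidual :: "nat \<Rightarrow> ((nat \<Rightarrow> nat) \<Rightarrow> complex) list \<Rightarrow> ((((nat \<Rightarrow> real) \<Rightarrow> complex) \<Rightarrow> complex) \<Rightarrow> complex) set" where
  "CT_bidual n T = dual_space (CT_dual n T) (CT_dual_norm n T)"

definition CT_bidual_norm :: "nat \<Rightarrow> ((nat \<Rightarrow> nat) \<Rightarrow> complex) list \<Rightarrow> ((((nat \<Rightarrow> real) \<Rightarrow> complex) \<Rightarrow> complex) \<Rightarrow> complex) \<Rightarrow> real" where
  "CT_bidual_norm n T = dual_norm (CT_dual n T) (CT_dual_norm n T)"

definition cont_fun :: "'a topology \<Rightarrow> ('a \<Rightarrow> complex) set" where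
  "cont_fun K = {g. continuous_map K euclidean g \<and> (\<forall>x. x \<notin> topspace K \<longrightarrow> g x = 0)}"

definition sup_norm :: "'a topology \<Rightarrow> ('a \<Rightarrow> complex) \<Rightarrow> real" where
  "sup_norm K g = Sup {cmod (g x) | x. x \<in> topspace K}"

definition iso_complemented_CK :: "('b \<Rightarrow> complex) set \<Rightarrow> (('b \<Rightarrow> complex) \<Rightarrow> real) \<Rightarrow> 'a topology \<Rightarrow> bool" where
  "iso_complemented_CK X NX K \<longleftrightarrow> (\<exists>Y Pr J.
     lin_op (cont_fun K) (cont_fun K) Pr \<and> bdd_op (cont_fun K) (sup_norm K) (sup_norm K) Pr \<and>
     (\<forall>g\<in>cont_fun K. Pr (Pr g) = Pr g) \<and> Pr ` cont_fun K = Y \<and>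
     lin_op X Y J \<and> bij_betw J X Y \<and> bdd_op X NX (sup_norm K) J \<and>
     bdd_op Y (sup_norm K) NX (the_inv_into X J))"

end

theory Submission
  imports Defs "HOL-Computational_Algebra.Polynomial"
begin

text \<open>
  If the bidual of \<open>C\<^sup>T\<close> is complemented in some \<open>C(K)\<close>, then the embedding of \<open>C\<^sup>T\<close> into its bidual
  extends, up to small errors and with uniform bounds on finite-dimensional subspaces, from the
  tuples \<open>(T\<^sub>1 f, ..., T\<^sub>l f)\<close> to all tuples of continuous functions. Averaging over translations
  yields matrices \<open>P(k)\<close> of Fourier multipliers bounded on the uniform norm such that \<open>P(k)\<close> is
  approximately a projection onto the line spanned by the vector of symbols
  \<open>(T\<^sub>1(k), ..., T\<^sub>l(k))\<close>. After making the weights integral, anisotropic dilations \<open>\<delta>\<^sub>N\<close> of a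
  frequency act on this vector asymptotically through the senior parts: for fixed \<open>m\<close> and large
  \<open>N\<close> its direction at \<open>m + \<delta>\<^sub>N k\<close> is that of \<open>\<tau>(k)\<close>. Choose \<open>k\<close> and \<open>k'\<close> with \<open>\<tau>(k)\<close> and \<open>\<tau>(k')\<close>
  not proportional and interleave rapidly growing scales \<open>M\<^sub>0, N\<^sub>0, M\<^sub>1, N\<^sub>1, ...\<close>; then a fixed
  linear functional of \<open>P(\<delta>\<^bsub>Na\<^esub> k + \<delta>\<^bsub>Mb\<^esub> k')\<close> is close to a nonzero constant for \<open>b \<le> a\<close> and close
  to zero for \<open>a < b\<close>. Such a triangular pattern is impossible for bounded multipliers, as one sees
  by testing it against a Hilbert matrix.
\<close>

section \<open>Finite-dimensional extension and partitions of unity\<close>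

text \<open>Elements of the bidual are seen only through their values on coefficient and Fejer
  functionals, which lie in the dual and involve finitely many characters. Hence neither a
  completion nor a weak limit occurs, and finite averages over sample points can replace Haar
  measure. The obstacle is that the operator from \<open>C(K)\<close> back to the bidual need not
  commute with translations: the image of a function attached to frequency \<open>k\<close> may
  carry all frequencies. Fejer functionals have norm at most one in the dual, so they control all
  these frequencies together, and averaging then isolates the diagonal with no loss in the constant.
  The functional behind the triangular pattern is the row \<open>(\<tau>2(k'), -\<tau>1(k'))\<close>
  acting on two rows of \<open>P\<close>, paired with the column \<open>\<tau>(k)\<close>. Where
  \<open>k\<close> dominates, \<open>P\<close> nearly fixes \<open>\<tau>(k)\<close> and the value
  is close to a 2 by 2 minor; where \<open>k'\<close> dominates, the columns of \<open>P\<close> are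
  nearly multiples of \<open>\<tau>(k')\<close>, which the row annihilates. The contradiction is
  only logarithmic: a bilinear form of size \<open>L\<close> meets a triangle on which it has size
  \<open>L log L\<close>.\<close>

lemma sublinear_extension_step:
  fixes p :: "('j \<Rightarrow> real) \<Rightarrow> real"
  assumes sub: "\<And>s t. p (\<lambda>i. s i + t i) \<le> p s + p t"
    and hom: "\<And>c s. c > 0 \<Longrightarrow> p (\<lambda>i. c * s i) = c * p s"
    and "finite J" "j \<notin> J"
    and dom: "\<And>s. (\<And>i. i \<notin> J \<Longrightarrow> s i = 0) \<Longrightarrow> (\<Sum>i\<in>J. s i * r i) \<le> p s"
  shows "\<exists>z. \<forall>s. (\<forall>i. i \<notin> insert j J \<longrightarrow> s i = 0) \<longrightarrow> (\<Sum>i\<in>J. s i * r i) + s j * z \<le> p s"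
proof -
  define \<phi> where "\<phi> s = (\<Sum>i\<in>J. s i * r i)" for s
  define \<delta> where "\<delta> = (\<lambda>i. if i = j then 1 else (0::real))"
  define V where "V = {s :: 'j \<Rightarrow> real. \<forall>i. i \<notin> J \<longrightarrow> s i = 0}"
  define l where "l s = \<phi> s - p (\<lambda>i. s i - \<delta> i)" for s
  \<comment> \<open>For \<open>s j = 1\<close> the requirement bounds \<open>z\<close> from above,
    for \<open>s j = -1\<close> from below; homogeneity reduces all other nonzero \<open>s j\<close>
    to these two. Subadditivity puts every lower bound \<open>l s\<close> below every upper
    bound.\<close>
  have lu: "l s \<le> p (\<lambda>i. t i + \<delta> i) - \<phi> t" if "s \<in> V" "t \<in> V" for s t
  proof -
    have "\<phi> s + \<phi> t = (\<Sum>i\<in>J. (s i + t i) * r i)"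
      by (simp add: \<phi>_def distrib_right sum.distrib)
    also have "\<dots> \<le> p (\<lambda>i. s i + t i)" using that by (intro dom) (auto simp: V_def)
    also have "(\<lambda>i. s i + t i) = (\<lambda>i. (s i - \<delta> i) + (t i + \<delta> i))" by simp
    also have "p \<dots> \<le> p (\<lambda>i. s i - \<delta> i) + p (\<lambda>i. t i + \<delta> i)" by (rule sub)
    finally show ?thesis by (simp add: l_def)
  qed
  have V0: "(\<lambda>_. 0) \<in> V" by (simp add: V_def)
  define z where "z = Sup (l ` V)"
  have bdd: "bdd_above (l ` V)" by (rule bdd_aboveI2[OF lu[OF _ V0]])
  have lz: "l s \<le> z" if "s \<in> V" for s
    unfolding z_def by (rule cSup_upper) (use that bdd in auto)
  have zu: "z \<le> p (\<lambda>i. t i + \<delta> i) - \<phi> t" if "t \<in> V" for t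
    unfolding z_def by (rule cSup_least) (use lu that V0 in auto)
  show ?thesis
  proof (intro exI[of _ z] allI impI)
    fix s :: "'j \<Rightarrow> real" assume s: "\<forall>i. i \<notin> insert j J \<longrightarrow> s i = 0"
    define s0 where "s0 = s(j := 0)"
    have \<phi>s0: "\<phi> s0 = \<phi> s" unfolding \<phi>_def s0_def using \<open>j \<notin> J\<close> by (intro sum.cong) auto
    have scale: "\<phi> (\<lambda>i. c * s0 i) = c * \<phi> s" for c
      unfolding \<phi>s0[symmetric] by (simp add: \<phi>_def sum_distrib_left mult.assoc)
    have inV: "(\<lambda>i. c * s0 i) \<in> V" for c using s by (simp add: V_def s0_def)
    consider "s j = 0" | "s j > 0" | "s j < 0" by linarith
    then have "\<phi> s + s j * z \<le> p s"
    proof cases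
      case 1
      then have "\<And>i. i \<notin> J \<Longrightarrow> s i = 0" using s by (metis insertE)
      from dom[OF this] 1 show ?thesis by (simp add: \<phi>_def)
    next
      case 2
      let ?t = "\<lambda>i. (1 / s j) * s0 i"
      have "s j * (\<phi> ?t + z) \<le> s j * p (\<lambda>i. ?t i + \<delta> i)"
        using zu[OF inV, of "1 / s j"] 2 by (intro mult_left_mono) auto
      also have "\<dots> = p (\<lambda>i. s j * (?t i + \<delta> i))" using hom[OF 2] by simp
      also have "(\<lambda>i. s j * (?t i + \<delta> i)) = s" using 2 by (auto simp: \<delta>_def s0_def field_simps)
      finally show ?thesis using 2 unfolding scale by (simp add: distrib_left)
    next
      case 3
      then have pos: "- s j > 0" by simp
      let ?t = "\<lambda>i. (1 / (- s j)) * s0 i"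
      have "- s j * (\<phi> ?t - z) \<le> - s j * p (\<lambda>i. ?t i - \<delta> i)"
        using lz[OF inV, of "1 / (- s j)"] pos by (intro mult_left_mono) (auto simp: l_def)
      also have "\<dots> = p (\<lambda>i. - s j * (?t i - \<delta> i))" using hom[OF pos] by simp
      also have "(\<lambda>i. - s j * (?t i - \<delta> i)) = s" using 3 by (auto simp: \<delta>_def s0_def field_simps)
      finally show ?thesis using 3 unfolding scale by (simp add: right_diff_distrib)
    qed
    then show "(\<Sum>i\<in>J. s i * r i) + s j * z \<le> p s" by (simp add: \<phi>_def)
  qed
qed

lemma sublinear_extension:
  fixes p :: "('j \<Rightarrow> real) \<Rightarrow> real"
  assumes sub: "\<And>s t. p (\<lambda>i. s i + t i) \<le> p s + p t"
    and hom: "\<And>c s. c > 0 \<Longrightarrow> p (\<lambda>i. c * s i) = c * p s"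
    and "finite J"
    and dom: "\<And>s. (\<And>i. i \<notin> J \<Longrightarrow> s i = 0) \<Longrightarrow> (\<Sum>i\<in>J. s i * r i) \<le> p s"
    and "finite G" "G \<inter> J = {}"
  shows "\<exists>r'. (\<forall>i\<in>J. r' i = r i) \<and>
    (\<forall>s. (\<forall>i. i \<notin> J \<union> G \<longrightarrow> s i = 0) \<longrightarrow> (\<Sum>i\<in>J \<union> G. s i * r' i) \<le> p s)"
  using \<open>finite G\<close> \<open>G \<inter> J = {}\<close>
proof (induction G)
  case empty
  then show ?case using dom by auto
next
  case (insert j G)
  then obtain r' where r': "\<forall>i\<in>J. r' i = r i"
    and dom': "\<And>s. (\<And>i. i \<notin> J \<union> G \<Longrightarrow> s i = 0) \<Longrightarrow> (\<Sum>i\<in>J \<union> G. s i * r' i) \<le> p s"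
    by auto
  have j: "j \<notin> J \<union> G" using insert by auto
  have fin: "finite (J \<union> G)" using insert \<open>finite J\<close> by auto
  obtain z where z: "\<And>s. (\<forall>i. i \<notin> insert j (J \<union> G) \<longrightarrow> s i = 0) \<Longrightarrow>
      (\<Sum>i\<in>J \<union> G. s i * r' i) + s j * z \<le> p s"
    using sublinear_extension_step[of p "J \<union> G" j r', OF sub hom fin j dom'] by blast
  show ?case
  proof (intro exI[of _ "r'(j := z)"] conjI allI impI ballI)
    fix i assume "i \<in> J"
    then show "(r'(j := z)) i = r i" using r' j by auto
  next
    fix s :: "'j \<Rightarrow> real" assume s: "\<forall>i. i \<notin> J \<union> insert j G \<longrightarrow> s i = 0"
    have "(\<Sum>i\<in>J \<union> G. s i * (r'(j := z)) i) = (\<Sum>i\<in>J \<union> G. s i * r' i)"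
      using j by (intro sum.cong) auto
    then show "(\<Sum>i\<in>J \<union> insert j G. s i * (r'(j := z)) i) \<le> p s"
      using z[of s] s fin j by (simp add: add.commute)
  qed
qed

text \<open>A Hahn-Banach theorem: the functional sending \<open>u j\<close> to \<open>\<phi> j\<close> extends to all vectors
  supported on \<open>I\<close>.\<close>
lemma seminorm_extension:
  fixes q :: "('i \<Rightarrow> complex) \<Rightarrow> real" and u :: "'j \<Rightarrow> 'i \<Rightarrow> complex"
  assumes sub: "\<And>x y. q (\<lambda>i. x i + y i) \<le> q x + q y"
    and hom: "\<And>c x. q (\<lambda>i. c * x i) = cmod c * q x"
    and "finite I" "finite J"
    and supp: "\<And>i j. i \<notin> I \<Longrightarrow> u j i = 0"
    and dom: "\<And>a. cmod (\<Sum>j\<in>J. a j * \<phi> j) \<le> q (\<lambda>i. \<Sum>j\<in>J. a j * u j i)"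
  shows "\<exists>\<beta>. (\<forall>j\<in>J. (\<Sum>i\<in>I. \<beta> i * u j i) = \<phi> j) \<and>
    (\<forall>x. (\<forall>i. i \<notin> I \<longrightarrow> x i = 0) \<longrightarrow> cmod (\<Sum>i\<in>I. \<beta> i * x i) \<le> q x)"
proof -
  \<comment> \<open>\<open>Inl\<close> holds the real and imaginary parts of the coefficients
    \<open>a j\<close>, \<open>Inr\<close> those of a free vector \<open>x\<close>. Since both are
    formal coordinates, the \<open>u j\<close> may be linearly dependent; that the two descriptions
    of \<open>u j\<close> agree comes out at the end.\<close>
  define J0 :: "('j \<times> bool + 'i \<times> bool) set" where "J0 = Inl ` (J \<times> UNIV)"
  define G0 :: "('j \<times> bool + 'i \<times> bool) set" where "G0 = Inr ` (I \<times> UNIV)"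
  define a :: "('j \<times> bool + 'i \<times> bool \<Rightarrow> real) \<Rightarrow> 'j \<Rightarrow> complex"
    where "a s j = Complex (s (Inl (j, False))) (s (Inl (j, True)))" for s j
  define x :: "('j \<times> bool + 'i \<times> bool \<Rightarrow> real) \<Rightarrow> 'i \<Rightarrow> complex"
    where "x s i = (if i \<in> I then Complex (s (Inr (i, False))) (s (Inr (i, True))) else 0)" for s i
  define p where "p s = q (\<lambda>i. (\<Sum>j\<in>J. a s j * u j i) + x s i)" for s
  define r :: "'j \<times> bool + 'i \<times> bool \<Rightarrow> real"
    where "r = case_sum (\<lambda>(j, b). if b then - Im (\<phi> j) else Re (\<phi> j)) (\<lambda>_. 0)"
  have q0: "q (\<lambda>_. 0) = 0" using hom[of 0 "\<lambda>_. 0"] by simp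
  have a_add: "a (\<lambda>i. s i + t i) j = a s j + a t j" for s t j by (simp add: a_def complex_eq_iff)
  have x_add: "x (\<lambda>i. s i + t i) j = x s j + x t j" for s t j by (simp add: x_def complex_eq_iff)
  have a_scale: "a (\<lambda>i. c * s i) j = of_real c * a s j" for c s j
    by (simp add: a_def complex_eq_iff)
  have x_scale: "x (\<lambda>i. c * s i) j = of_real c * x s j" for c s j
    by (simp add: x_def complex_eq_iff)
  have p_sub: "p (\<lambda>i. s i + t i) \<le> p s + p t" for s t
    unfolding p_def a_add x_add
    using sub[of "\<lambda>i. (\<Sum>j\<in>J. a s j * u j i) + x s i" "\<lambda>i. (\<Sum>j\<in>J. a t j * u j i) + x t i"]
    by (simp add: distrib_right sum.distrib add_ac)
  have p_hom: "p (\<lambda>i. c * s i) = c * p s" if "c > 0" for c s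
    unfolding p_def a_scale x_scale
    using hom[of "of_real c" "\<lambda>i. (\<Sum>j\<in>J. a s j * u j i) + x s i"] that
    by (simp add: distrib_left sum_distrib_left mult.assoc)
  have sum_J0: "(\<Sum>i\<in>J0. s i * r i) = Re (\<Sum>j\<in>J. a s j * \<phi> j)" for s
    by (simp add: J0_def sum.reindex sum.cartesian_product' UNIV_bool r_def a_def)
  have p_dom: "(\<Sum>i\<in>J0. s i * r i) \<le> p s" if "\<And>i. i \<notin> J0 \<Longrightarrow> s i = 0" for s
  proof -
    have "s (Inr v) = 0" for v using that[of "Inr v"] by (auto simp: J0_def)
    then have "x s = (\<lambda>_. 0)" by (auto simp: x_def complex_eq_iff)
    then have "p s = q (\<lambda>i. \<Sum>j\<in>J. a s j * u j i)" by (simp add: p_def)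
    moreover have "Re (\<Sum>j\<in>J. a s j * \<phi> j) \<le> cmod (\<Sum>j\<in>J. a s j * \<phi> j)"
      by (rule complex_Re_le_cmod)
    ultimately show ?thesis using dom[of "a s"] by (simp add: sum_J0)
  qed
  have fin: "finite J0" "finite G0" "G0 \<inter> J0 = {}"
    using \<open>finite J\<close> \<open>finite I\<close> by (auto simp: J0_def G0_def)
  obtain r' where r': "\<And>i. i \<in> J0 \<Longrightarrow> r' i = r i"
    and dom': "\<And>s. (\<And>i. i \<notin> J0 \<union> G0 \<Longrightarrow> s i = 0) \<Longrightarrow> (\<Sum>i\<in>J0 \<union> G0. s i * r' i) \<le> p s"
    using sublinear_extension[of p J0 r G0, OF p_sub p_hom fin(1) p_dom fin(2,3)] by blast
  \<comment> \<open>With this sign \<open>Re (\<beta> i * y i)\<close> is the real pairing of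
    \<open>r'\<close> with the two parts of \<open>y i\<close>: a complex functional is recovered
    from its real part.\<close>
  define \<beta> where "\<beta> i = Complex (r' (Inr (i, False))) (- r' (Inr (i, True)))" for i
  have key: "Re (\<Sum>j\<in>J. b j * \<phi> j) + Re (\<Sum>i\<in>I. \<beta> i * y i) \<le> q (\<lambda>i. (\<Sum>j\<in>J. b j * u j i) + y i)"
    if y: "\<And>i. i \<notin> I \<Longrightarrow> y i = 0" for b y
  proof -
    define s where "s = case_sum (\<lambda>(j, c). if j \<in> J then (if c then Im (b j) else Re (b j)) else 0)
      (\<lambda>(i, c). if i \<in> I then (if c then Im (y i) else Re (y i)) else 0)"
    have as: "a s j = b j" if "j \<in> J" for j using that by (simp add: a_def s_def)
    have xs: "x s = y" using y by (auto simp: x_def s_def)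
    have "(\<Sum>i\<in>J0 \<union> G0. s i * r' i) = (\<Sum>i\<in>J0. s i * r' i) + (\<Sum>i\<in>G0. s i * r' i)"
      using fin by (intro sum.union_disjoint) auto
    also have "(\<Sum>i\<in>J0. s i * r' i) = (\<Sum>i\<in>J0. s i * r i)" using r' by (intro sum.cong) auto
    also have "\<dots> = Re (\<Sum>j\<in>J. b j * \<phi> j)" using as by (simp add: sum_J0)
    also have "(\<Sum>i\<in>G0. s i * r' i) = Re (\<Sum>i\<in>I. \<beta> i * y i)"
      by (simp add: G0_def sum.reindex sum.cartesian_product' UNIV_bool s_def \<beta>_def mult.commute)
    finally have "Re (\<Sum>j\<in>J. b j * \<phi> j) + Re (\<Sum>i\<in>I. \<beta> i * y i) = (\<Sum>i\<in>J0 \<union> G0. s i * r' i)" by simp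
    also have "\<dots> \<le> p s"
      by (rule dom') (auto simp: s_def J0_def G0_def split: sum.split)
    also have "p s = q (\<lambda>i. (\<Sum>j\<in>J. b j * u j i) + y i)"
      using as by (simp add: p_def xs)
    finally show ?thesis .
  qed
  show ?thesis
  proof (intro exI[of _ \<beta>] conjI ballI allI impI)
    fix j assume j: "j \<in> J"
    \<comment> \<open>Entering \<open>cnj d * u j\<close> once through the coefficients and once,
      negated, as a free vector produces the zero vector, while the left side of \<open>key\<close>
      becomes the squared modulus of \<open>d\<close>. Hence \<open>d = 0\<close>.\<close>
    define d where "d = \<phi> j - (\<Sum>i\<in>I. \<beta> i * u j i)"
    have one: "(\<Sum>l\<in>J. (if l = j then cnj d else 0) * f l) = cnj d * f j" for f
      using j \<open>finite J\<close> by (simp add: if_distrib[of "\<lambda>z. z * _"] cong: if_cong)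
    have "Re (cnj d * \<phi> j) + Re (\<Sum>i\<in>I. \<beta> i * (- cnj d * u j i)) \<le> q (\<lambda>i. cnj d * u j i + - cnj d * u j i)"
      using key[of "\<lambda>i. - cnj d * u j i" "\<lambda>l. if l = j then cnj d else 0"] supp by (simp add: one)
    also have "(\<Sum>i\<in>I. \<beta> i * (- cnj d * u j i)) = - cnj d * (\<Sum>i\<in>I. \<beta> i * u j i)"
      by (simp add: sum_distrib_left mult_ac sum_negf)
    also have "Re (cnj d * \<phi> j) + Re (- cnj d * (\<Sum>i\<in>I. \<beta> i * u j i)) = Re (cnj d * d)"
    proof -
      have "cnj d * \<phi> j + - cnj d * (\<Sum>i\<in>I. \<beta> i * u j i) = cnj d * (\<phi> j - (\<Sum>i\<in>I. \<beta> i * u j i))"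
        by (simp only: right_diff_distrib) simp
      then show ?thesis by (metis d_def plus_complex.sel(1))
    qed
    also have "\<dots> = (cmod d)\<^sup>2" unfolding cmod_power2 by (simp add: power2_eq_square)
    finally have "(cmod d)\<^sup>2 \<le> 0" by (simp add: q0)
    then show "(\<Sum>i\<in>I. \<beta> i * u j i) = \<phi> j" by (simp add: d_def)
  next
    fix y :: "'i \<Rightarrow> complex" assume y: "\<forall>i. i \<notin> I \<longrightarrow> y i = 0"
    define w where "w = (\<Sum>i\<in>I. \<beta> i * y i)"
    have Re_le: "Re (c * w) \<le> cmod c * q y" for c
      using key[of "\<lambda>i. c * y i" "\<lambda>_. 0"] y
      by (simp add: hom w_def sum_distrib_left mult_ac)
    show "cmod (\<Sum>i\<in>I. \<beta> i * y i) \<le> q y"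
    proof (cases "w = 0")
      case True
      have "0 \<le> q y" using sub[of y "\<lambda>i. -1 * y i"] hom[of "-1" y] q0 by simp
      then show ?thesis using True by (simp add: w_def)
    next
      case False
      have "(cmod w)\<^sup>2 = Re (cnj w * w)" unfolding cmod_power2 by (simp add: power2_eq_square)
      also have "\<dots> \<le> cmod w * q y" using Re_le[of "cnj w"] by simp
      finally show ?thesis using False by (simp add: power2_eq_square w_def)
    qed
  qed
qed

text \<open>The bumps are made from the family \<open>b\<close> itself:
  \<open>max 0 (\<epsilon> - d y x)\<close>, where \<open>d y x\<close> sums the distances between
  the values at \<open>x\<close> and \<open>y\<close>. Compactness yields finitely many centres
  whose bumps never vanish simultaneously, and dividing by their sum normalises them.\<close>

lemma finite_partition_of_unity:
  fixes b :: "'k \<Rightarrow> 'a \<Rightarrow> complex"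
  assumes K: "compact_space K" and "finite F" and cont: "\<forall>k\<in>F. continuous_map K euclidean (b k)"
    and "\<epsilon> > 0"
  shows "\<exists>Y \<phi>. finite Y \<and> Y \<subseteq> topspace K \<and> (\<forall>y\<in>Y. continuous_map K euclideanreal (\<phi> y)) \<and>
    (\<forall>x\<in>topspace K. (\<Sum>y\<in>Y. \<phi> y x) = 1 \<and>
       (\<forall>y\<in>Y. 0 \<le> \<phi> y x \<and> (\<phi> y x \<noteq> 0 \<longrightarrow> (\<forall>k\<in>F. cmod (b k x - b k y) \<le> \<epsilon>))))"
proof -
  define d where "d y x = (\<Sum>k\<in>F. cmod (b k x - b k y))" for x y
  have contd: "continuous_map K euclideanreal (d y)" for y
    unfolding continuous_map_atin
  proof
    fix x assume x: "x \<in> topspace K"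
    have "((\<lambda>x. b k x) \<longlongrightarrow> b k x) (atin K x)" if "k \<in> F" for k
      using bspec[OF cont that] x by (auto simp: continuous_map_atin)
    then show "limitin euclideanreal (d y) (d y x) (atin K x)"
      unfolding d_def by (auto intro!: tendsto_intros)
  qed
  define U where "U y = {x \<in> topspace K. d y x \<in> {..<\<epsilon>}}" for y
  have "openin K (U y)" for y
    unfolding U_def by (rule openin_continuous_map_preimage[OF contd]) auto
  moreover have "topspace K \<subseteq> \<Union> (U ` topspace K)"
    using \<open>\<epsilon> > 0\<close> by (auto simp: U_def d_def)
  ultimately obtain \<F> where "finite \<F>" "\<F> \<subseteq> U ` topspace K" "topspace K \<subseteq> \<Union>\<F>"
    using K unfolding compact_space_alt by (metis (no_types, lifting) imageE)
  then obtain Y where Y: "finite Y" "Y \<subseteq> topspace K" "topspace K \<subseteq> \<Union> (U ` Y)"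
    by (metis finite_subset_image)
  define \<rho> where "\<rho> y x = max 0 (\<epsilon> - d y x)" for y x
  define \<phi> where "\<phi> y x = \<rho> y x / (\<Sum>y\<in>Y. \<rho> y x)" for y x
  have pos: "(\<Sum>y\<in>Y. \<rho> y x) > 0" if x: "x \<in> topspace K" for x
  proof -
    obtain y where "y \<in> Y" "x \<in> U y" using Y(3) x by blast
    then have "0 < \<rho> y x" by (auto simp: \<rho>_def U_def)
    then show ?thesis using \<open>y \<in> Y\<close> Y(1) by (intro sum_pos2[of _ y]) (auto simp: \<rho>_def)
  qed
  have cont\<rho>: "(\<rho> y \<longlongrightarrow> \<rho> y x) (atin K x)" if "x \<in> topspace K" for y x
    using contd[of y] that unfolding \<rho>_def by (auto simp: continuous_map_atin intro!: tendsto_intros)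
  show ?thesis
  proof (intro exI[of _ Y] exI[of _ \<phi>] conjI ballI impI)
    fix y assume "y \<in> Y"
    show "continuous_map K euclideanreal (\<phi> y)"
      unfolding continuous_map_atin
    proof
      fix x assume x: "x \<in> topspace K"
      have "(\<phi> y \<longlongrightarrow> \<phi> y x) (atin K x)"
        unfolding \<phi>_def using cont\<rho>[OF x] pos[OF x] by (intro tendsto_intros) auto
      then show "limitin euclideanreal (\<phi> y) (\<phi> y x) (atin K x)" by simp
    qed
  next
    fix x assume "x \<in> topspace K"
    then show "(\<Sum>y\<in>Y. \<phi> y x) = 1"
      using pos[of x] by (simp add: \<phi>_def flip: sum_divide_distrib)
  next
    fix x y assume "x \<in> topspace K" "y \<in> Y"
    show "0 \<le> \<phi> y x" by (auto simp: \<phi>_def \<rho>_def intro!: divide_nonneg_nonneg sum_nonneg)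
  next
    fix x y k assume "\<phi> y x \<noteq> 0" and k: "k \<in> F"
    then have "d y x < \<epsilon>" by (auto simp: \<phi>_def \<rho>_def max_def split: if_splits)
    moreover have "cmod (b k x - b k y) \<le> d y x"
      unfolding d_def using k \<open>finite F\<close> by (intro member_le_sum) auto
    ultimately show "cmod (b k x - b k y) \<le> \<epsilon>" by simp
  qed (use Y in auto)
qed

section \<open>Unboundedness of triangular truncation\<close>

lemma sum_roots_of_unity:
  fixes \<kappa> :: int
  assumes "M > 0"
  shows "(\<Sum>r<M. cis (2 * pi * of_int \<kappa> / real M) ^ r) = (if int M dvd \<kappa> then of_nat M else 0)"
    and "cis (2 * pi * of_int \<kappa> / real M) ^ M = 1"
    and "cis (2 * pi * of_int \<kappa> / real M) = 1 \<longleftrightarrow> int M dvd \<kappa>"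
proof -
  let ?z = "cis (2 * pi * of_int \<kappa> / real M)"
  show one: "?z = 1 \<longleftrightarrow> int M dvd \<kappa>"
  proof
    assume "?z = 1"
    then have "cos (2 * pi * of_int \<kappa> / real M) = 1"
      by (metis cis.sel(1) one_complex.sel(1))
    then obtain x :: int where "2 * pi * of_int \<kappa> / real M = of_int x * (2 * pi)"
      using cos_one_2pi_int by auto
    then have "of_int \<kappa> = (of_int (x * int M) :: real)"
      using assms by (simp add: field_simps)
    then have "\<kappa> = x * int M" by (simp only: of_int_eq_iff)
    then show "int M dvd \<kappa>" by simp
  next
    assume "int M dvd \<kappa>"
    then obtain x where "\<kappa> = int M * x" by blast
    then have "2 * pi * of_int \<kappa> / real M = 2 * pi * of_int x" using assms by simp
    then show "?z = 1" using cis_multiple_2pi[of "of_int x"] by simp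
  qed
  have "?z ^ M = cis (2 * pi * of_int \<kappa>)" unfolding Complex.DeMoivre using assms by simp
  also have "\<dots> = 1" by (rule cis_multiple_2pi) (rule Ints_of_int)
  finally show pow: "?z ^ M = 1" .
  show "(\<Sum>r<M. ?z ^ r) = (if int M dvd \<kappa> then of_nat M else 0)"
  proof (cases "int M dvd \<kappa>")
    case True
    then have "?z = 1" using one by blast
    then have "(\<Sum>r<M. ?z ^ r) = (\<Sum>r<M. 1)" by (simp only: power_one)
    then show ?thesis using True by simp
  next
    case False
    then show ?thesis using one pow by (simp add: sum_gp_strict)
  qed
qed

lemma sum_rotate3: "(\<Sum>r\<in>A. \<Sum>a\<in>B. \<Sum>b\<in>C. f r a b) = (\<Sum>a\<in>B. \<Sum>b\<in>C. \<Sum>r\<in>A. f r a b)"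
proof -
  have "(\<Sum>r\<in>A. \<Sum>a\<in>B. \<Sum>b\<in>C. f r a b) = (\<Sum>a\<in>B. \<Sum>r\<in>A. \<Sum>b\<in>C. f r a b)"
    by (rule sum.swap)
  also have "\<dots> = (\<Sum>a\<in>B. \<Sum>b\<in>C. \<Sum>r\<in>A. f r a b)"
    by (intro sum.cong refl) (rule sum.swap)
  finally show ?thesis .
qed

text \<open>Because \<open>L \<le> M\<close>, the difference of two indices below \<open>L\<close>
  is a multiple of \<open>M\<close> only if it is zero, so the exponentials are orthogonal on the
  sample.\<close>

lemma discrete_parseval:
  assumes "0 < L" "L \<le> M"
  shows "(\<Sum>r<M. (cmod (\<Sum>a<L. s a * cis (2 * pi * of_int (int a) / real M) ^ r))\<^sup>2) = real M * (\<Sum>a<L. (cmod (s a))\<^sup>2)"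
proof -
  define z where "z a = cis (2 * pi * of_int a / real M)" for a :: int
  have zz: "z (int a) ^ r * cnj (z (int b) ^ r) = z (int a - int b) ^ r" for a b r
    by (simp add: z_def cis_cnj cis_mult right_diff_distrib diff_divide_distrib
      flip: power_mult_distrib)
  have "complex_of_real (\<Sum>r<M. (cmod (\<Sum>a<L. s a * z (int a) ^ r))\<^sup>2)
      = (\<Sum>r<M. (\<Sum>a<L. s a * z (int a) ^ r) * cnj (\<Sum>b<L. s b * z (int b) ^ r))"
    by (simp only: of_real_sum complex_norm_square)
  also have "\<dots> = (\<Sum>r<M. \<Sum>a<L. \<Sum>b<L. s a * cnj (s b) * z (int a - int b) ^ r)"
    by (simp add: sum_product zz[symmetric] mult_ac)
  also have "\<dots> = (\<Sum>a<L. \<Sum>b<L. s a * cnj (s b) * (\<Sum>r<M. z (int a - int b) ^ r))"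
    unfolding sum_distrib_left by (rule sum_rotate3)
  also have "\<dots> = (\<Sum>a<L. \<Sum>b<L. if b = a then s a * cnj (s b) * of_nat M else 0)"
  proof (intro sum.cong refl)
    fix a b assume ab: "a \<in> {..<L}" "b \<in> {..<L}"
    have "int M dvd int a - int b \<longleftrightarrow> b = a"
    proof
      assume d: "int M dvd int a - int b"
      show "b = a"
      proof (rule ccontr)
        assume "b \<noteq> a"
        then have "int M \<le> \<bar>int a - int b\<bar>" using d zdvd_imp_le[of "int M" "\<bar>int a - int b\<bar>"] by simp
        then show False using ab assms by auto
      qed
    qed simp
    then show "s a * cnj (s b) * (\<Sum>r<M. z (int a - int b) ^ r) = (if b = a then s a * cnj (s b) * of_nat M else 0)"
      using sum_roots_of_unity(1)[of M "int a - int b"] assms by (simp add: z_def)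
  qed
  also have "\<dots> = (\<Sum>a<L. s a * cnj (s a) * of_nat M)" by simp
  also have "\<dots> = complex_of_real (real M * (\<Sum>a<L. (cmod (s a))\<^sup>2))"
    by (simp add: sum_distrib_left complex_norm_square[symmetric] mult_ac)
  finally show ?thesis unfolding z_def of_real_eq_iff .
qed

text \<open>The discrete Hilbert matrix: the Toeplitz matrix whose symbol is the saw-tooth function.\<close>
definition discrete_hilbert :: "nat \<Rightarrow> int \<Rightarrow> complex" where
  "discrete_hilbert M d = (\<Sum>r<M. \<i> * of_real (1 - 2 * real r / real M) * cis (2 * pi * of_int d / real M) ^ r) / of_nat M"

lemma norm_saw_tooth: "r < M \<Longrightarrow> cmod (\<i> * of_real (1 - 2 * real r / real M)) \<le> 1"
proof -
  assume "r < M"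
  then have "\<bar>1 - 2 * real r / real M\<bar> \<le> 1" by (simp add: abs_le_iff field_simps)
  then show ?thesis by (simp add: norm_mult del: of_real_diff of_real_divide of_real_mult)
qed

lemma norm_discrete_hilbert_le: "cmod (discrete_hilbert M d) \<le> 1"
proof -
  have "cmod (\<Sum>r<M. \<i> * of_real (1 - 2 * real r / real M) * cis (2 * pi * of_int d / real M) ^ r) \<le> (\<Sum>r<M. 1)"
    using norm_saw_tooth[of _ M]
    by (intro sum_norm_le) (auto simp: norm_mult norm_power simp del: of_real_diff of_real_divide of_real_mult)
  then show ?thesis by (cases "M = 0") (simp_all add: discrete_hilbert_def norm_divide)
qed

text \<open>A Toeplitz form is the average over the roots of unity of its symbol times two
  exponential sums. The saw-tooth is bounded by one, so Parseval and the inequality between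
  geometric and arithmetic means give \<open>L\<close> without a logarithm.\<close>

lemma discrete_hilbert_bilinear_bound:
  assumes "0 < L" "L \<le> M" "\<And>a. cmod (s a) \<le> 1" "\<And>b. cmod (t b) \<le> 1"
  shows "cmod (\<Sum>a<L. \<Sum>b<L. discrete_hilbert M (int a - int b) * (s a * t b)) \<le> real L"
proof -
  define z where "z a = cis (2 * pi * of_int a / real M)" for a :: int
  define m where "m r = \<i> * complex_of_real (1 - 2 * real r / real M)" for r
  define S where "S r = (\<Sum>a<L. s a * z (int a) ^ r)" for r
  define R where "R r = (\<Sum>a<L. cnj (t a) * z (int a) ^ r)" for r
  have M: "M > 0" using assms by simp
  have zz: "z (int a) ^ r * cnj (z (int b) ^ r) = z (int a - int b) ^ r" for a b r
    by (simp add: z_def cis_cnj cis_mult right_diff_distrib diff_divide_distrib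
      flip: power_mult_distrib)
  have "(\<Sum>a<L. \<Sum>b<L. discrete_hilbert M (int a - int b) * (s a * t b))
     = (\<Sum>a<L. \<Sum>b<L. \<Sum>r<M. m r * z (int a - int b) ^ r * (s a * t b)) / of_nat M"
    by (simp only: discrete_hilbert_def m_def z_def sum_divide_distrib times_divide_eq_left sum_distrib_right)
  also have "(\<Sum>a<L. \<Sum>b<L. \<Sum>r<M. m r * z (int a - int b) ^ r * (s a * t b))
     = (\<Sum>r<M. \<Sum>a<L. \<Sum>b<L. m r * z (int a - int b) ^ r * (s a * t b))"
    by (rule sum_rotate3[symmetric])
  also have "\<dots> = (\<Sum>r<M. m r * (S r * cnj (R r)))"
  proof (rule sum.cong [OF refl])
    fix r
    have Rc: "cnj (R r) = (\<Sum>b<L. t b * cnj (z (int b) ^ r))" by (simp add: R_def)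
    have "m r * (S r * cnj (R r)) = (\<Sum>a<L. \<Sum>b<L. m r * ((s a * z (int a) ^ r) * (t b * cnj (z (int b) ^ r))))"
      unfolding S_def Rc by (subst sum_product) (simp only: sum_distrib_left)
    also have "\<dots> = (\<Sum>a<L. \<Sum>b<L. m r * z (int a - int b) ^ r * (s a * t b))"
      by (intro sum.cong refl) (simp only: zz[symmetric] mult_ac)
    finally show "(\<Sum>a<L. \<Sum>b<L. m r * z (int a - int b) ^ r * (s a * t b)) = m r * (S r * cnj (R r))" by simp
  qed
  finally have eq: "(\<Sum>a<L. \<Sum>b<L. discrete_hilbert M (int a - int b) * (s a * t b)) = (\<Sum>r<M. m r * (S r * cnj (R r))) / of_nat M" .
  have "cmod (\<Sum>r<M. m r * (S r * cnj (R r))) \<le> (\<Sum>r<M. ((cmod (S r))\<^sup>2 + (cmod (R r))\<^sup>2) / 2)"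
  proof (rule sum_norm_le)
    fix r assume "r \<in> {..<M}"
    then have "cmod (m r) \<le> 1" using norm_saw_tooth[of r M] by (simp only: m_def lessThan_iff)
    then have "cmod (m r * (S r * cnj (R r))) \<le> 1 * (cmod (S r) * cmod (R r))"
      unfolding norm_mult complex_mod_cnj by (intro mult_right_mono) auto
    also have "\<dots> \<le> ((cmod (S r))\<^sup>2 + (cmod (R r))\<^sup>2) / 2"
      using sum_squares_bound[of "cmod (S r)" "cmod (R r)"] by simp
    finally show "cmod (m r * (S r * cnj (R r))) \<le> ((cmod (S r))\<^sup>2 + (cmod (R r))\<^sup>2) / 2" .
  qed
  also have "\<dots> = (real M * (\<Sum>a<L. (cmod (s a))\<^sup>2) + real M * (\<Sum>a<L. (cmod (cnj (t a)))\<^sup>2)) / 2"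
    unfolding sum_divide_distrib[symmetric] sum.distrib S_def R_def z_def
    using discrete_parseval[OF assms(1,2), of s] discrete_parseval[OF assms(1,2), of "\<lambda>a. cnj (t a)"] by simp
  also have "\<dots> \<le> (real M * real L + real M * real L) / 2"
  proof -
    have "(cmod (s a))\<^sup>2 \<le> 1" "(cmod (cnj (t a)))\<^sup>2 \<le> 1" for a
      using assms(3,4)[of a] by (simp_all add: power_le_one)
    then have "(\<Sum>a<L. (cmod (s a))\<^sup>2) \<le> real L" "(\<Sum>a<L. (cmod (cnj (t a)))\<^sup>2) \<le> real L"
      using sum_mono[of "{..<L}" "\<lambda>a. (cmod (s a))\<^sup>2" "\<lambda>_. 1"]
        sum_mono[of "{..<L}" "\<lambda>a. (cmod (cnj (t a)))\<^sup>2" "\<lambda>_. 1"] by auto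
    then show ?thesis by (intro divide_right_mono add_mono mult_left_mono) auto
  qed
  finally show ?thesis unfolding eq using M by (simp add: norm_divide field_simps)
qed

section \<open>Size and sign of the entries of the discrete Hilbert matrix\<close>

lemma sum_weighted_gp: "(z - 1) * (\<Sum>r<M. of_nat r * z ^ r) = of_nat M * z ^ M - z * (\<Sum>r<M. z ^ r)" for z :: complex
  by (induction M) (simp_all add: algebra_simps)

text \<open>The weighted geometric sum gives the entry as \<open>- 2 * \<i> / (z - 1) / M\<close>
  with \<open>z = cis \<theta>\<close>; its real part is \<open>- cot (\<theta> / 2) / M\<close>,
  written here through sine and cosine of the full angle.\<close>

lemma Re_discrete_hilbert:
  assumes "M > 0" "\<not> int M dvd d"
  shows "Re (discrete_hilbert M d) = - (sin (2 * pi * of_int d / real M) / (1 - cos (2 * pi * of_int d / real M))) / real M"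
proof -
  define \<theta> where "\<theta> = 2 * pi * of_int d / real M"
  let ?z = "cis \<theta>"
  have z1: "?z \<noteq> 1" and zM: "?z ^ M = 1" and S: "(\<Sum>r<M. ?z ^ r) = 0"
    using sum_roots_of_unity[OF assms(1), of d] assms(2) by (auto simp: \<theta>_def)
  have W: "(\<Sum>r<M. of_nat r * ?z ^ r) = of_nat M / (?z - 1)"
    using sum_weighted_gp[of ?z M] z1 S zM by (simp add: field_simps)
  have "(\<Sum>r<M. \<i> * of_real (1 - 2 * real r / real M) * ?z ^ r)
      = \<i> * (\<Sum>r<M. ?z ^ r) - 2 * \<i> / of_nat M * (\<Sum>r<M. of_nat r * ?z ^ r)"
    by (simp add: sum_distrib_left sum_subtractf[symmetric] algebra_simps)
  also have "\<dots> = - 2 * \<i> / (?z - 1)" using assms(1) S W by simp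
  finally have h: "discrete_hilbert M d = - 2 * \<i> / (?z - 1) / of_nat M" by (simp only: discrete_hilbert_def \<theta>_def)
  have c: "cos \<theta> \<noteq> 1"
  proof
    assume "cos \<theta> = 1"
    moreover then have "sin \<theta> = 0" using sin_cos_squared_add[of \<theta>] by simp
    ultimately show False using z1 by (simp add: complex_eq_iff)
  qed
  have sq: "(sin \<theta>)\<^sup>2 = 1 - (cos \<theta>)\<^sup>2" by (simp add: sin_squared_eq)
  have "Re (- 2 * \<i> / (?z - 1)) = - (2 * sin \<theta>) / ((cos \<theta> - 1)\<^sup>2 + (sin \<theta>)\<^sup>2)"
    by (simp add: Re_divide)
  also have "(cos \<theta> - 1)\<^sup>2 + (sin \<theta>)\<^sup>2 = 2 * (1 - cos \<theta>)"
    unfolding sq by (simp add: power2_eq_square algebra_simps)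
  also have "- (2 * sin \<theta>) / (2 * (1 - cos \<theta>)) = - (sin \<theta> / (1 - cos \<theta>))"
    using c by (simp add: field_simps)
  finally show ?thesis unfolding h \<theta>_def[symmetric]
    by (metis Re_divide_of_nat)
qed

text \<open>The factor 8 keeps the angle below \<open>pi / 4\<close> and hence below 1, where
  \<open>sin \<theta> \<ge> \<theta> / 2\<close> and
  \<open>1 - cos \<theta> \<le> \<theta>^2 / 2\<close> already bound the cotangent below by
  \<open>1 / \<theta>\<close>.\<close>

lemma Re_discrete_hilbert_le:
  assumes "0 < d" "8 * d \<le> int M"
  shows "Re (discrete_hilbert M d) \<le> - 1 / (2 * pi * of_int d)"
proof -
  define \<theta> where "\<theta> = 2 * pi * of_int d / real M"
  have M: "M > 0" using assms by simp
  have "\<not> int M dvd d" using assms zdvd_imp_le[of "int M" d] by auto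
  note Re = Re_discrete_hilbert[OF M this, folded \<theta>_def]
  have pos: "\<theta> > 0" using assms M by (simp add: \<theta>_def)
  have "8 * of_int d \<le> real M" using assms(2) by linarith
  then have "\<theta> \<le> pi / 4" using M by (simp add: \<theta>_def field_simps)
  then have le1: "\<theta> \<le> 1" using pi_less_4 by simp
  have s: "sin \<theta> \<ge> \<theta> / 2"
  proof -
    have "\<bar>sin \<theta> - \<theta>\<bar> \<le> \<theta> ^ 3 / 6"
      using Maclaurin_sin_bound[of \<theta> 3] pos
      by (simp add: numeral_3_eq_3 sin_coeff_def fact_numeral field_simps)
    moreover have "\<theta> ^ 3 \<le> \<theta>"
      using pos le1 power_decreasing[of 1 3 \<theta>] by simp
    ultimately show ?thesis using pos by linarith
  qed
  have c: "1 - cos \<theta> \<le> \<theta>\<^sup>2 / 2" 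
  proof -
    have "cos \<theta> = 1 - 2 * (sin (\<theta> / 2))\<^sup>2" using cos_double_sin[of "\<theta> / 2"] by simp
    moreover have "(sin (\<theta> / 2))\<^sup>2 \<le> (\<theta> / 2)\<^sup>2"
      using abs_sin_x_le_abs_x[of "\<theta> / 2"] by (simp only: abs_le_square_iff)
    ultimately show ?thesis by (simp add: power2_eq_square)
  qed
  have "cos \<theta> < 1" using pos le1 pi_gt3 cos_monotone_0_pi[of 0 \<theta>] by simp
  then have c0: "1 - cos \<theta> > 0" by simp
  have "1 / \<theta> = (\<theta> / 2) / (\<theta>\<^sup>2 / 2)" using pos by (simp add: power2_eq_square)
  also have "\<dots> \<le> sin \<theta> / (1 - cos \<theta>)" by (rule frac_le) (use s c c0 pos in auto)
  finally have "1 / \<theta> / real M \<le> sin \<theta> / (1 - cos \<theta>) / real M" by (rule divide_right_mono) simp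
  moreover have "1 / \<theta> / real M = 1 / (2 * pi * of_int d)" using M by (simp add: \<theta>_def)
  ultimately show ?thesis unfolding Re by simp
qed

text \<open>Below the diagonal the real parts of the Hilbert entries have one sign, so nothing
  cancels and each row adds up to a harmonic number. The result is stated by duality, through a test
  matrix \<open>x\<close>, because products \<open>s a * t b\<close> are what characters at sums of
  two frequencies produce. Entries of \<open>x\<close> are at most one in modulus, so an error
  \<open>1 / L\<close> per entry costs at most \<open>L\<close> in total.\<close>

lemma triangular_truncation:
  fixes D :: complex and C :: real
  assumes "D \<noteq> 0"
  shows "\<exists>L>0. \<exists>x :: nat \<Rightarrow> nat \<Rightarrow> complex.
    (\<forall>s t. (\<forall>a. cmod (s a) \<le> 1) \<longrightarrow> (\<forall>b. cmod (t b) \<le> 1) \<longrightarrow>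
        cmod (\<Sum>a<L. \<Sum>b<L. x a b * (s a * t b)) \<le> real L) \<and>
    (\<forall>A. (\<forall>a<L. \<forall>b<L. cmod (A a b - (if b \<le> a then D else 0)) \<le> 1 / real L) \<longrightarrow>
        cmod (\<Sum>a<L. \<Sum>b<L. x a b * A a b) > C * real L)"
proof -
  \<comment> \<open>Chosen so that \<open>cmod D * N * harm N / (2 * pi)\<close> exceeds
    \<open>L * (\<bar>C\<bar> + 1)\<close> for \<open>L = 2 * N\<close>; the summand 1 pays for the
    error term of size \<open>L\<close>.\<close>
  define c where "c = 4 * pi * (\<bar>C\<bar> + 1) / cmod D"
  define N where "N = Suc (nat \<lceil>exp c\<rceil>)"
  have "exp c < real N + 1" unfolding N_def by linarith
  then have "c < ln (real N + 1)" by (subst ln_exp[of c, symmetric], subst ln_less_cancel_iff) auto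
  then have N: "N > 0" "harm N > 4 * pi * (\<bar>C\<bar> + 1) / cmod D"
    using ln_le_harm[of N] by (auto simp: N_def c_def)
  define L where "L = 2 * N"
  have L: "L > 0" using N by (simp add: L_def)
  \<comment> \<open>The order \<open>8 * L\<close> puts every difference \<open>a - b\<close> in the
    range where the cotangent estimate holds.\<close>
  define x where "x a b = discrete_hilbert (8 * L) (int a - int b)" for a b
  have form: "cmod (\<Sum>a<L. \<Sum>b<L. x a b * (s a * t b)) \<le> real L"
    if "\<forall>a. cmod (s a) \<le> 1" "\<forall>b. cmod (t b) \<le> 1" for s t
    unfolding x_def by (rule discrete_hilbert_bilinear_bound) (use that L in auto)
  have low: "cmod (\<Sum>a<L. \<Sum>b<L. x a b * (if b \<le> a then 1 else 0)) \<ge> real N * harm N / (2 * pi)"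
  proof -
    \<comment> \<open>The diagonal belongs to the triangle but is purely imaginary, so it does not
      disturb the real parts.\<close>
    have h0: "Re (discrete_hilbert M 0) = 0" for M
      by (simp add: discrete_hilbert_def Re_divide_of_nat del: of_real_diff of_real_divide of_real_mult)
    have row: "- Re (\<Sum>b<L. x a b * (if b \<le> a then 1 else 0)) \<ge> harm a / (2 * pi)" if a: "a < L" for a
    proof -
      have "(\<Sum>b<L. x a b * (if b \<le> a then 1 else 0)) = (\<Sum>b<Suc a. x a b)"
        by (rule sum.mono_neutral_cong_right) (use a in auto)
      also have "Re \<dots> = (\<Sum>b<a. Re (x a b))" by (simp add: x_def h0)
      also have "\<dots> \<le> (\<Sum>b<a. - (1 / (2 * pi * real (a - b))))"
      proof (rule sum_mono)
        fix b assume "b \<in> {..<a}"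
        then have b: "b < a" by simp
        have "Re (discrete_hilbert (8 * L) (int a - int b)) \<le> - 1 / (2 * pi * of_int (int a - int b))"
          by (rule Re_discrete_hilbert_le) (use a b in auto)
        moreover have "real_of_int (int a - int b) = real (a - b)" using b by simp
        ultimately show "Re (x a b) \<le> - (1 / (2 * pi * real (a - b)))"
          unfolding x_def by (simp only: minus_divide_left)
      qed
      also have "\<dots> = - (\<Sum>b<a. 1 / (real (a - b))) / (2 * pi)"
        by (simp add: sum_negf sum_divide_distrib divide_divide_eq_left mult_ac)
      also have "(\<Sum>b<a. 1 / (real (a - b))) = harm a"
      proof -
        have "(\<Sum>b<a. 1 / (real (a - b))) = (\<Sum>b<a. 1 / real (Suc b))"
          by (subst sum.nat_diff_reindex[symmetric]) (auto intro!: sum.cong simp: Suc_diff_Suc)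
        also have "\<dots> = harm a"
          unfolding harm_def by (simp add: sum.atLeast1_atMost_eq inverse_eq_divide)
        finally show ?thesis .
      qed
      finally show ?thesis by simp
    qed
    \<comment> \<open>The upper half of the rows suffices: there are \<open>N\<close> of them and
      each contributes at least \<open>harm N\<close>.\<close>
    have "real N * harm N \<le> (\<Sum>a\<in>{N..<L}. harm a)"
    proof -
      have "(\<Sum>a\<in>{N..<L}. harm N) \<le> (\<Sum>a\<in>{N..<L}. harm a :: real)"
        by (intro sum_mono harm_mono) auto
      then show ?thesis by (simp add: L_def)
    qed
    also have "\<dots> \<le> (\<Sum>a<L. harm a)"
      by (rule sum_mono2) (auto simp: harm_nonneg)
    finally have "real N * harm N / (2 * pi) \<le> (\<Sum>a<L. harm a / (2 * pi))"
      unfolding sum_divide_distrib[symmetric] by (rule divide_right_mono) simp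
    also have "\<dots> \<le> (\<Sum>a<L. - Re (\<Sum>b<L. x a b * (if b \<le> a then 1 else 0)))"
      by (intro sum_mono row) simp
    also have "\<dots> = - Re (\<Sum>a<L. \<Sum>b<L. x a b * (if b \<le> a then 1 else 0))"
      by (simp only: Re_sum sum_negf)
    also have "\<dots> \<le> cmod (\<Sum>a<L. \<Sum>b<L. x a b * (if b \<le> a then 1 else 0))"
      using abs_Re_le_cmod[of "\<Sum>a<L. \<Sum>b<L. x a b * (if b \<le> a then 1 else 0)"] by linarith
    finally show ?thesis .
  qed
  have big: "cmod (\<Sum>a<L. \<Sum>b<L. x a b * A a b) > C * real L"
    if A: "\<forall>a<L. \<forall>b<L. cmod (A a b - (if b \<le> a then D else 0)) \<le> 1 / real L" for A
  proof -
    define E where "E a b = A a b - (if b \<le> a then D else 0)" for a b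
    have "cmod (\<Sum>a<L. \<Sum>b<L. x a b * E a b) \<le> (\<Sum>a<L. \<Sum>b<L. 1 / real L)"
    proof (intro sum_norm_le)
      fix a b assume "a \<in> {..<L}" "b \<in> {..<L}"
      then have "cmod (x a b) * cmod (E a b) \<le> 1 * (1 / real L)"
        using A norm_discrete_hilbert_le by (intro mult_mono) (auto simp: E_def x_def)
      then show "cmod (x a b * E a b) \<le> 1 / real L" by (simp add: norm_mult)
    qed
    also have "\<dots> = real L" using L by simp
    finally have err: "cmod (\<Sum>a<L. \<Sum>b<L. x a b * E a b) \<le> real L" .
    have "(\<Sum>a<L. \<Sum>b<L. x a b * A a b)
        = D * (\<Sum>a<L. \<Sum>b<L. x a b * (if b \<le> a then 1 else 0)) + (\<Sum>a<L. \<Sum>b<L. x a b * E a b)"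
      unfolding sum_distrib_left sum.distrib[symmetric]
      by (intro sum.cong refl) (simp add: E_def algebra_simps)
    then have "cmod (\<Sum>a<L. \<Sum>b<L. x a b * A a b)
        \<ge> cmod D * cmod (\<Sum>a<L. \<Sum>b<L. x a b * (if b \<le> a then 1 else 0)) - real L"
      using err norm_diff_ineq[of "D * (\<Sum>a<L. \<Sum>b<L. x a b * (if b \<le> a then 1 else 0))"
          "\<Sum>a<L. \<Sum>b<L. x a b * E a b"] by (simp add: norm_mult)
    moreover have "cmod D * cmod (\<Sum>a<L. \<Sum>b<L. x a b * (if b \<le> a then 1 else 0)) \<ge> cmod D * (real N * harm N / (2 * pi))"
      using low by (rule mult_left_mono) simp
    moreover have "cmod D * (real N * harm N / (2 * pi)) > real L * (\<bar>C\<bar> + 1)"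
    proof -
      have "4 * pi * (\<bar>C\<bar> + 1) < cmod D * harm N" using N(2) assms by (simp add: field_simps)
      then have "real N * (4 * pi * (\<bar>C\<bar> + 1)) < real N * (cmod D * harm N)" using N(1) by simp
      then show ?thesis by (simp add: L_def field_simps)
    qed
    moreover have "C * real L \<le> \<bar>C\<bar> * real L" by (intro mult_right_mono) auto
    ultimately show ?thesis by (simp add: algebra_simps)
  qed
  show ?thesis using L form big by blast
qed

section \<open>Trigonometric polynomials\<close>

definition echar :: "nat \<Rightarrow> (nat \<Rightarrow> int) \<Rightarrow> (nat \<Rightarrow> real) \<Rightarrow> complex" where
  "echar n k t = exp (2 * of_real pi * \<i> * of_real (\<Sum>i<n. of_int (k i) * t i))"

definition freqs :: "nat \<Rightarrow> (nat \<Rightarrow> int) set" where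
  "freqs n = {k. \<forall>i\<ge>n. k i = 0}"

definition tsum :: "nat \<Rightarrow> (nat \<Rightarrow> int) set \<Rightarrow> ((nat \<Rightarrow> int) \<Rightarrow> complex) \<Rightarrow> (nat \<Rightarrow> real) \<Rightarrow> complex" where
  "tsum n F c = (\<lambda>t. \<Sum>k\<in>F. c k * echar n k t)"

lemma trig_poly_iff: "trig_poly n f \<longleftrightarrow> (\<exists>F c. finite F \<and> F \<subseteq> freqs n \<and> f = tsum n F c)"
  unfolding trig_poly_def tsum_def echar_def freqs_def by blast

lemma tsum_in_trig_polys: "finite F \<Longrightarrow> F \<subseteq> freqs n \<Longrightarrow> tsum n F c \<in> trig_polys n"
  unfolding trig_polys_def trig_poly_iff by blast

lemma echar_cis: "echar n k t = cis (2 * pi * (\<Sum>i<n. of_int (k i) * t i))"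
  unfolding echar_def cis_conv_exp by (simp add: mult_ac)

lemma norm_echar [simp]: "cmod (echar n k t) = 1"
  by (simp add: echar_cis)

lemma echar_0 [simp]: "echar n (\<lambda>_. 0) t = 1"
  by (simp add: echar_def)

lemma echar_add_freq: "echar n (\<lambda>i. k i + l i) t = echar n k t * echar n l t"
  by (simp add: echar_cis cis_mult sum.distrib distrib_right distrib_left)

lemma echar_minus_freq: "echar n (\<lambda>i. - k i) t = cnj (echar n k t)"
  by (simp add: echar_cis cis_cnj sum_negf)

lemma echar_diff_freq: "echar n (\<lambda>i. k i - l i) t = echar n k t * cnj (echar n l t)"
  using echar_add_freq[of n k "\<lambda>i. - l i" t] by (simp add: echar_minus_freq)

lemma echar_diff_point: "echar n k (\<lambda>i. s i - t i) = echar n k s * cnj (echar n k t)"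
  by (simp add: echar_cis cis_mult cis_cnj sum_subtractf right_diff_distrib)

lemma echar_add_point: "echar n k (\<lambda>i. s i + t i) = echar n k s * echar n k t"
  by (simp add: echar_cis cis_mult sum.distrib distrib_left)

text \<open>Periodicity: the supremum over the unit cube then bounds values at all real points, in
  particular at the translates and sample points used for averaging.\<close>

lemma echar_frac: "echar n k (\<lambda>i. frac (t i)) = echar n k t"
proof -
  have "(\<Sum>i<n. of_int (k i) * frac (t i)) = (\<Sum>i<n. of_int (k i) * t i) - of_int (\<Sum>i<n. k i * \<lfloor>t i\<rfloor>)"
    by (simp add: frac_def right_diff_distrib sum_subtractf)
  then have "echar n k (\<lambda>i. frac (t i)) =
      echar n k t * cnj (cis (2 * pi * of_int (\<Sum>i<n. k i * \<lfloor>t i\<rfloor>)))"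
    by (simp only: echar_cis cis_mult cis_cnj) (simp add: right_diff_distrib)
  also have "cis (2 * pi * of_int (\<Sum>i<n. k i * \<lfloor>t i\<rfloor>)) = 1"
    by (rule cis_multiple_2pi) (rule Ints_of_int)
  finally show ?thesis by simp
qed

lemma freqs_diff [intro]: "k \<in> freqs n \<Longrightarrow> l \<in> freqs n \<Longrightarrow> (\<lambda>i. k i - l i) \<in> freqs n"
  by (simp add: freqs_def)

lemma freqs_add [intro]: "k \<in> freqs n \<Longrightarrow> l \<in> freqs n \<Longrightarrow> (\<lambda>i. k i + l i) \<in> freqs n"
  by (simp add: freqs_def)

text \<open>A vector of digits is nonzero in all but finitely many bases.\<close>
lemma base_separating_vectors:
  assumes "finite D" and "\<And>m. m \<in> D \<Longrightarrow> \<exists>i<n. m i \<noteq> (0::int)"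
  shows "\<exists>H::nat. \<forall>m\<in>D. (\<Sum>i<n. m i * int H ^ i) \<noteq> 0"
proof -
  define p where "p m = (\<Sum>i<n. monom (m i) i)" for m :: "nat \<Rightarrow> int"
  have p_nz: "p m \<noteq> 0" if "m \<in> D" for m
  proof -
    obtain j where j: "j < n" "m j \<noteq> 0" using assms(2) \<open>m \<in> D\<close> by blast
    have "coeff (p m) j = (\<Sum>i<n. if i = j then m i else 0)"
      by (simp add: p_def coeff_sum)
    also have "\<dots> = m j" using j by simp
    finally show ?thesis using j by force
  qed
  have "finite (\<Union>m\<in>D. {x. poly (p m) x = 0})"
    using assms(1) p_nz by (auto intro: poly_roots_finite)
  then have "finite (int -` (\<Union>m\<in>D. {x. poly (p m) x = 0}))"
    by (rule finite_vimageI) simp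
  then obtain H where "H \<notin> int -` (\<Union>m\<in>D. {x. poly (p m) x = 0})"
    using ex_new_if_finite[OF infinite_UNIV_nat] by meson
  then have "\<forall>m\<in>D. poly (p m) (int H) \<noteq> 0" by auto
  then show ?thesis
    by (auto simp: p_def poly_sum poly_monom)
qed

text \<open>Sampling on the line through \<open>(1, H, H^2, ...)\<close> with step
  \<open>1 / M\<close> turns the frequency \<open>m\<close> into the single integer
  \<open>\<kappa> m\<close>. The base \<open>H\<close> keeps it nonzero for nonzero
  \<open>m\<close>, and \<open>M\<close> exceeds every modulus, so \<open>M\<close> divides it only
  for \<open>m = 0\<close>. Haar integration thus becomes a finite average that is exact on
  \<open>D\<close>.\<close>

lemma echar_orthogonality:
  assumes "finite D" and "D \<subseteq> freqs n"
  shows "\<exists>M>0. \<exists>t. \<forall>m\<in>D. (\<Sum>r<M. echar n m (t r)) = (if m = (\<lambda>_. 0) then of_nat M else 0)"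
proof -
  have "\<exists>i<n. m i \<noteq> 0" if "m \<in> D - {\<lambda>_. 0}" for m
  proof -
    have "m \<noteq> (\<lambda>_. 0)" using that by simp
    then obtain j where "m j \<noteq> 0" by (meson ext)
    moreover have "j < n"
      using that assms(2) \<open>m j \<noteq> 0\<close> unfolding freqs_def by (metis (mono_tags) Diff_iff mem_Collect_eq not_le subsetD)
    ultimately show ?thesis by blast
  qed
  then obtain H :: nat where H: "\<And>m. m \<in> D - {\<lambda>_. 0} \<Longrightarrow> (\<Sum>i<n. m i * int H ^ i) \<noteq> 0"
    using base_separating_vectors[of "D - {\<lambda>_. 0}" n] assms(1) by auto
  define \<kappa> where "\<kappa> m = (\<Sum>i<n. m i * int H ^ i)" for m
  define M where "M = nat (1 + (\<Sum>m\<in>D. \<bar>\<kappa> m\<bar>))"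
  have Mpos: "M > 0" unfolding M_def by (simp add: sum_nonneg add_pos_nonneg)
  have \<kappa>M: "\<bar>\<kappa> m\<bar> < int M" if "m \<in> D" for m
  proof -
    have "\<bar>\<kappa> m\<bar> \<le> (\<Sum>m\<in>D. \<bar>\<kappa> m\<bar>)"
      using assms(1) that by (intro member_le_sum) auto
    moreover have "0 \<le> (\<Sum>m\<in>D. \<bar>\<kappa> m\<bar>)" by (simp add: sum_nonneg)
    ultimately show ?thesis unfolding M_def by simp
  qed
  define t where "t r = (\<lambda>i. real r * real H ^ i / real M)" for r :: nat
  have pow: "echar n m (t r) = cis (2 * pi * of_int (\<kappa> m) / real M) ^ r" for m r
  proof -
    have "(\<Sum>i<n. of_int (m i) * t r i) = real r * of_int (\<kappa> m) / real M"
      by (simp add: t_def \<kappa>_def sum_distrib_left sum_divide_distrib mult_ac)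
    then have "echar n m (t r) = cis (real r * (2 * pi * of_int (\<kappa> m) / real M))"
      unfolding echar_cis by (simp add: mult_ac)
    then show ?thesis by (simp only: Complex.DeMoivre)
  qed
  have "(\<Sum>r<M. echar n m (t r)) = (if m = (\<lambda>_. 0) then of_nat M else 0)" if "m \<in> D" for m
  proof (cases "m = (\<lambda>_. 0)")
    case True
    then show ?thesis by simp
  next
    case False
    have k0: "\<kappa> m \<noteq> 0" using H False that by (simp add: \<kappa>_def)
    have "\<not> int M dvd \<kappa> m"
      using k0 \<kappa>M[OF that] zdvd_imp_le[of "int M" "\<bar>\<kappa> m\<bar>"] by auto
    then have "(\<Sum>r<M. cis (2 * pi * of_int (\<kappa> m) / real M) ^ r) = 0"
      using sum_roots_of_unity(1)[OF Mpos, of "\<kappa> m"] by simp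
    then show ?thesis using False by (simp add: pow)
  qed
  then show ?thesis using Mpos by blast
qed

text \<open>The sample depends on the frequency sets alone. One sample therefore serves all
  coefficient families at once, which comparing two expansions or modulating the coefficients
  requires.\<close>

lemma tsum_orthogonality:
  assumes "finite F" "F \<subseteq> freqs n" "finite G" "G \<subseteq> freqs n"
  shows "\<exists>M>0. \<exists>t. \<forall>k\<in>G. \<forall>c. (\<Sum>r<M. tsum n F c (t r) * cnj (echar n k (t r)))
           = of_nat M * (if k \<in> F then c k else 0)"
proof -
  let ?D = "(\<lambda>(k, l) i. k i - l i) ` (F \<times> G)"
  have D: "finite ?D" "?D \<subseteq> freqs n"
    using assms by (auto simp: image_subset_iff)
  obtain M t where M: "M > 0" and
    t: "\<forall>m\<in>?D. (\<Sum>r<M. echar n m (t r)) = (if m = (\<lambda>_. 0) then of_nat M else 0)"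
    using echar_orthogonality[OF D] by blast
  have "(\<Sum>r<M. tsum n F c (t r) * cnj (echar n k (t r))) = of_nat M * (if k \<in> F then c k else 0)"
    if k: "k \<in> G" for k c
  proof -
    have "(\<Sum>r<M. tsum n F c (t r) * cnj (echar n k (t r)))
        = (\<Sum>l\<in>F. c l * (\<Sum>r<M. echar n (\<lambda>i. l i - k i) (t r)))"
      unfolding tsum_def echar_diff_freq sum_distrib_left sum_distrib_right
      by (subst sum.swap) (simp add: mult_ac)
    also have "\<dots> = (\<Sum>l\<in>F. if l = k then c l * of_nat M else 0)"
    proof (rule sum.cong [OF refl])
      fix l assume l: "l \<in> F"
      have "(\<lambda>i. l i - k i) \<in> ?D" using l k by auto
      moreover have "(\<lambda>i. l i - k i) = (\<lambda>_. 0) \<longleftrightarrow> l = k" by (auto simp: fun_eq_iff)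
      ultimately show "c l * (\<Sum>r<M. echar n (\<lambda>i. l i - k i) (t r)) = (if l = k then c l * of_nat M else 0)"
        using bspec[OF t, of "\<lambda>i. l i - k i"] by simp
    qed
    also have "\<dots> = of_nat M * (if k \<in> F then c k else 0)"
      using assms(1) by simp
    finally show ?thesis .
  qed
  then show ?thesis using M by blast
qed

text \<open>The Fourier coefficient, read off from any finite expansion instead of an integral.
  Orthogonality makes it unambiguous: two expansions are padded with zeros to a common frequency set
  and tested against the same character.\<close>

definition tcoef :: "nat \<Rightarrow> ((nat \<Rightarrow> real) \<Rightarrow> complex) \<Rightarrow> (nat \<Rightarrow> int) \<Rightarrow> complex" where
  "tcoef n f k = (THE z. \<exists>F c. finite F \<and> F \<subseteq> freqs n \<and> f = tsum n F c \<and> z = (if k \<in> F then c k else 0))"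

lemma tcoef_tsum:
  assumes "finite F" "F \<subseteq> freqs n"
  shows "tcoef n (tsum n F c) k = (if k \<in> F then c k else 0)"
  unfolding tcoef_def
proof (rule the_equality)
  fix z assume "\<exists>G d. finite G \<and> G \<subseteq> freqs n \<and> tsum n F c = tsum n G d \<and> z = (if k \<in> G then d k else 0)"
  then obtain G d where G: "finite G" "G \<subseteq> freqs n" and eq: "tsum n F c = tsum n G d"
    and z: "z = (if k \<in> G then d k else 0)" by blast
  show "z = (if k \<in> F then c k else 0)"
  proof (cases "k \<in> F \<union> G")
    case True
    let ?c = "\<lambda>k. if k \<in> F then c k else 0" and ?d = "\<lambda>k. if k \<in> G then d k else 0"
    have "tsum n F c = tsum n (F \<union> G) ?c" "tsum n G d = tsum n (F \<union> G) ?d"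
      unfolding tsum_def using assms(1) G(1)
      by (auto intro!: ext sum.mono_neutral_cong_left)
    then have eq': "tsum n (F \<union> G) ?c = tsum n (F \<union> G) ?d" using eq by simp
    obtain M t where M: "M > 0" and
      t: "\<forall>l\<in>F \<union> G. \<forall>c. (\<Sum>r<M. tsum n (F \<union> G) c (t r) * cnj (echar n l (t r)))
           = of_nat M * (if l \<in> F \<union> G then c l else 0)"
      using tsum_orthogonality[of "F \<union> G" n "F \<union> G"] assms G by blast
    have "of_nat M * ?c k = of_nat M * ?d k"
      using bspec[OF t True, THEN spec, of ?c] bspec[OF t True, THEN spec, of ?d] True eq'
      by (auto split: if_splits)
    then show ?thesis using z M by auto
  next
    case False
    then show ?thesis using z by simp
  qed
qed (use assms in blast)

lemma trig_polys_expansion: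
  assumes "f \<in> trig_polys n"
  obtains F where "finite F" "F \<subseteq> freqs n" "f = tsum n F (tcoef n f)" "\<And>k. k \<notin> F \<Longrightarrow> tcoef n f k = 0"
proof -
  obtain F c where F: "finite F" "F \<subseteq> freqs n" and f: "f = tsum n F c"
    using assms unfolding trig_polys_def trig_poly_iff by auto
  have c: "tcoef n f k = (if k \<in> F then c k else 0)" for k
    unfolding f by (rule tcoef_tsum[OF F])
  have "f = tsum n F (tcoef n f)"
    unfolding tsum_def c by (subst f) (simp add: tsum_def)
  then show ?thesis using F c that by auto
qed

lemma tsum_mono_neutral:
  assumes "finite G" "F \<subseteq> G" "\<And>k. k \<in> G - F \<Longrightarrow> c k = 0"
  shows "tsum n F c = tsum n G c"
  unfolding tsum_def using assms by (auto intro!: ext sum.mono_neutral_left)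

lemma trig_polys_add:
  assumes "f \<in> trig_polys n" "g \<in> trig_polys n"
  shows "(\<lambda>x. f x + g x) \<in> trig_polys n"
    and "tcoef n (\<lambda>x. f x + g x) k = tcoef n f k + tcoef n g k"
proof -
  obtain F where F: "finite F" "F \<subseteq> freqs n" "f = tsum n F (tcoef n f)" "\<And>k. k \<notin> F \<Longrightarrow> tcoef n f k = 0"
    using trig_polys_expansion[OF assms(1)] by metis
  obtain G where G: "finite G" "G \<subseteq> freqs n" "g = tsum n G (tcoef n g)" "\<And>k. k \<notin> G \<Longrightarrow> tcoef n g k = 0"
    using trig_polys_expansion[OF assms(2)] by metis
  have "f = tsum n (F \<union> G) (tcoef n f)" "g = tsum n (F \<union> G) (tcoef n g)"
    using F G tsum_mono_neutral[of "F \<union> G" F "tcoef n f" n] tsum_mono_neutral[of "F \<union> G" G "tcoef n g" n] by auto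
  then have "f x + g x = tsum n (F \<union> G) (tcoef n f) x + tsum n (F \<union> G) (tcoef n g) x" for x
    by metis
  then have eq: "(\<lambda>x. f x + g x) = tsum n (F \<union> G) (\<lambda>k. tcoef n f k + tcoef n g k)"
    unfolding tsum_def by (simp only: sum.distrib distrib_right)
  show "(\<lambda>x. f x + g x) \<in> trig_polys n" unfolding eq by (rule tsum_in_trig_polys) (use F G in auto)
  show "tcoef n (\<lambda>x. f x + g x) k = tcoef n f k + tcoef n g k"
    unfolding eq using F G by (subst tcoef_tsum) auto
qed

lemma trig_polys_scale:
  assumes "f \<in> trig_polys n"
  shows "(\<lambda>x. z * f x) \<in> trig_polys n"
    and "tcoef n (\<lambda>x. z * f x) k = z * tcoef n f k"
proof -
  obtain F where F: "finite F" "F \<subseteq> freqs n" "f = tsum n F (tcoef n f)" "\<And>k. k \<notin> F \<Longrightarrow> tcoef n f k = 0"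
    using trig_polys_expansion[OF assms(1)] by metis
  have eq: "(\<lambda>x. z * f x) = tsum n F (\<lambda>k. z * tcoef n f k)"
    by (subst F(3)) (simp add: tsum_def sum_distrib_left mult_ac)
  show "(\<lambda>x. z * f x) \<in> trig_polys n" unfolding eq by (rule tsum_in_trig_polys) (use F in auto)
  show "tcoef n (\<lambda>x. z * f x) k = z * tcoef n f k"
    unfolding eq using F by (subst tcoef_tsum) auto
qed

section \<open>Symbols and norms\<close>

definition symb :: "nat \<Rightarrow> ((nat \<Rightarrow> nat) \<Rightarrow> complex) \<Rightarrow> (nat \<Rightarrow> int) \<Rightarrow> complex" where
  "symb n p k = (\<Sum>\<alpha>\<in>{\<alpha>. p \<alpha> \<noteq> 0}. p \<alpha> * (\<Prod>j<n. (2 * of_real pi * \<i> * of_int (k j)) ^ \<alpha> j))"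

lemma partial_tsum:
  assumes "finite F" "j < n"
  shows "partial j (tsum n F c) = tsum n F (\<lambda>k. c k * (2 * of_real pi * \<i> * of_int (k j)))"
proof
  fix t :: "nat \<Rightarrow> real"
  have split: "(\<Sum>i<n. of_int (k i) * (t(j := s)) i) = of_int (k j) * s + (\<Sum>i\<in>{..<n} - {j}. of_int (k i) * t i)"
    for s and k :: "nat \<Rightarrow> int"
    using assms(2) by (subst sum.remove[of _ j]) auto
  have "((\<lambda>s. tsum n F c (t(j := s))) has_vector_derivative
       (\<Sum>k\<in>F. c k * ((2 * of_real pi * \<i> * of_int (k j)) * echar n k t))) (at (t j))"
    unfolding tsum_def
  proof (intro has_vector_derivative_sum has_vector_derivative_mult_right)
    fix k
    let ?w = "2 * of_real pi * \<i> * of_int (k j)"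
      and ?u = "2 * of_real pi * \<i> * of_real (\<Sum>i\<in>{..<n} - {j}. of_int (k i) * t i)"
    have e: "echar n k (t(j := s)) = exp (?u + of_real s * ?w)" for s
      unfolding echar_def split by (simp add: algebra_simps)
    have "((\<lambda>z. exp (?u + z * ?w)) has_field_derivative ?w * exp (?u + of_real (t j) * ?w)) (at (of_real (t j)))"
      by (auto intro!: derivative_eq_intros)
    then have "((\<lambda>s. exp (?u + of_real s * ?w)) has_vector_derivative ?w * exp (?u + of_real (t j) * ?w)) (at (t j))"
      by (rule has_vector_derivative_real_field)
    moreover have "echar n k t = exp (?u + of_real (t j) * ?w)" using e[of "t j"] by simp
    ultimately show "((\<lambda>s. echar n k (t(j := s))) has_vector_derivative ?w * echar n k t) (at (t j))"
      by (simp only: e)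
  qed
  then show "partial j (tsum n F c) t = tsum n F (\<lambda>k. c k * (2 * of_real pi * \<i> * of_int (k j))) t"
    unfolding partial_def by (simp add: vector_derivative_at tsum_def mult_ac)
qed

lemma partial_funpow_tsum:
  assumes "finite F" "j < n"
  shows "(partial j ^^ m) (tsum n F c) = tsum n F (\<lambda>k. c k * (2 * of_real pi * \<i> * of_int (k j)) ^ m)"
  by (induction m) (simp_all add: partial_tsum[OF assms] mult_ac)

lemma Dmono_tsum:
  assumes "finite F"
  shows "Dmono n \<alpha> (tsum n F c) = tsum n F (\<lambda>k. c k * (\<Prod>j<n. (2 * of_real pi * \<i> * of_int (k j)) ^ \<alpha> j))"
proof -
  have "fold (\<lambda>j g. (partial j ^^ \<alpha> j) g) [0..<m] (tsum n F c)
      = tsum n F (\<lambda>k. c k * (\<Prod>j<m. (2 * of_real pi * \<i> * of_int (k j)) ^ \<alpha> j))" if "m \<le> n" for m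
    using that
    by (induction m) (simp_all add: partial_funpow_tsum[OF assms] mult_ac)
  then show ?thesis unfolding Dmono_def by simp
qed

lemma apply_op_tsum:
  assumes "finite F"
  shows "apply_op n p (tsum n F c) = tsum n F (\<lambda>k. c k * symb n p k)"
  unfolding apply_op_def symb_def Dmono_tsum[OF assms]
  unfolding tsum_def sum_distrib_left sum_distrib_right
  by (subst sum.swap) (simp add: mult_ac)

lemma apply_op_in_trig_polys: "f \<in> trig_polys n \<Longrightarrow> apply_op n p f \<in> trig_polys n"
  by (metis apply_op_tsum trig_polys_expansion tsum_in_trig_polys)

lemma apply_op_scale:
  assumes "f \<in> trig_polys n"
  shows "apply_op n p (\<lambda>x. z * f x) = (\<lambda>x. z * apply_op n p f x)"
proof -
  obtain F where F: "finite F" "f = tsum n F (tcoef n f)"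
    using trig_polys_expansion[OF assms(1)] by metis
  have eq: "(\<lambda>x. z * f x) = tsum n F (\<lambda>k. z * tcoef n f k)"
    by (subst F(2)) (simp add: tsum_def sum_distrib_left mult_ac)
  have "apply_op n p f = tsum n F (\<lambda>k. tcoef n f k * symb n p k)"
    by (subst F(2)) (rule apply_op_tsum[OF F(1)])
  then show ?thesis
    unfolding eq apply_op_tsum[OF F(1)] by (simp add: tsum_def sum_distrib_left mult_ac)
qed

section \<open>Supremum norms on the torus and the seminorm of the operators\<close>

definition torus_norm :: "nat \<Rightarrow> ((nat \<Rightarrow> real) \<Rightarrow> complex) \<Rightarrow> real" where
  "torus_norm n f = Sup ((\<lambda>t. cmod (f t)) ` torus_pts n)"

lemma torus_pts_nonempty: "torus_pts n \<noteq> {}"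
  by (auto simp: torus_pts_def intro!: exI[of _ "\<lambda>_. 0"])

lemma torus_norm_le: "(\<And>t. cmod (f t) \<le> B) \<Longrightarrow> torus_norm n f \<le> B"
  unfolding torus_norm_def by (rule cSup_least) (use torus_pts_nonempty in auto)

lemma tsum_le_torus_norm: "cmod (tsum n F c t) \<le> torus_norm n (tsum n F c)"
proof -
  have "cmod (tsum n F c s) \<le> (\<Sum>k\<in>F. cmod (c k))" for s
    unfolding tsum_def by (rule order_trans[OF norm_sum]) (simp add: norm_mult)
  then have "bdd_above ((\<lambda>t. cmod (tsum n F c t)) ` torus_pts n)" by (intro bdd_aboveI2)
  moreover have "(\<lambda>i. frac (t i)) \<in> torus_pts n"
    by (auto simp: torus_pts_def frac_lt_1)
  moreover have "tsum n F c (\<lambda>i. frac (t i)) = tsum n F c t"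
    by (simp add: tsum_def echar_frac)
  ultimately show ?thesis unfolding torus_norm_def by (metis (mono_tags, lifting) cSup_upper imageI)
qed

lemma le_torus_norm: "f \<in> trig_polys n \<Longrightarrow> cmod (f t) \<le> torus_norm n f"
  by (metis trig_polys_expansion tsum_le_torus_norm)

lemma torus_norm_nonneg: "f \<in> trig_polys n \<Longrightarrow> 0 \<le> torus_norm n f"
  by (rule order_trans[OF norm_ge_zero le_torus_norm])

lemma seminorm_T_eq: "seminorm_T n T f = Max ((\<lambda>p. torus_norm n (apply_op n p f)) ` set T)"
  by (simp add: seminorm_T_def torus_norm_def)

lemma torus_norm_le_seminorm_T: "p \<in> set T \<Longrightarrow> torus_norm n (apply_op n p f) \<le> seminorm_T n T f"
  by (simp add: seminorm_T_eq)

lemma seminorm_T_nonneg: "T \<noteq> [] \<Longrightarrow> f \<in> trig_polys n \<Longrightarrow> 0 \<le> seminorm_T n T f"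
  using torus_norm_le_seminorm_T[of "hd T" T n f] torus_norm_nonneg[OF apply_op_in_trig_polys[of f n "hd T"]]
  by (auto intro: order_trans)

lemma seminorm_T_scale:
  assumes "T \<noteq> []" "f \<in> trig_polys n"
  shows "seminorm_T n T (\<lambda>x. z * f x) \<le> cmod z * seminorm_T n T f"
proof -
  have "torus_norm n (apply_op n p (\<lambda>x. z * f x)) \<le> cmod z * seminorm_T n T f" if "p \<in> set T" for p
  proof (rule torus_norm_le)
    fix t
    have "cmod (apply_op n p f t) \<le> seminorm_T n T f"
      using le_torus_norm[OF apply_op_in_trig_polys[OF assms(2)], of p t] torus_norm_le_seminorm_T[OF that, of n f] by simp
    then show "cmod (apply_op n p (\<lambda>x. z * f x) t) \<le> cmod z * seminorm_T n T f"
      by (simp add: apply_op_scale[OF assms(2)] norm_mult mult_left_mono)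
  qed
  then show ?thesis unfolding seminorm_T_eq[of n T "\<lambda>x. z * f x"] using assms(1) by simp
qed

section \<open>Fejer functionals\<close>

definition freq_box :: "nat \<Rightarrow> int \<Rightarrow> int \<Rightarrow> (nat \<Rightarrow> int) set" where
  "freq_box n a b = {m \<in> freqs n. \<forall>i<n. a \<le> m i \<and> m i < b}"

lemma freq_box_eq: "freq_box n a b = (\<lambda>g i. if i < n then g i else 0) ` ({..<n} \<rightarrow>\<^sub>E {a..<b})"
proof (intro equalityI subsetI)
  fix m assume m: "m \<in> freq_box n a b"
  have "m = (\<lambda>i. if i < n then restrict m {..<n} i else 0)"
    using m by (auto simp: freq_box_def freqs_def)
  moreover have "restrict m {..<n} \<in> {..<n} \<rightarrow>\<^sub>E {a..<b}"
    using m by (auto simp: freq_box_def)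
  ultimately show "m \<in> (\<lambda>g i. if i < n then g i else 0) ` ({..<n} \<rightarrow>\<^sub>E {a..<b})" by (rule image_eqI)
next
  fix m assume "m \<in> (\<lambda>g i. if i < n then g i else 0) ` ({..<n} \<rightarrow>\<^sub>E {a..<b})"
  then obtain g where g: "g \<in> {..<n} \<rightarrow>\<^sub>E {a..<b}" and m: "m = (\<lambda>i. if i < n then g i else 0)"
    by (rule imageE)
  have "g i \<in> {a..<b}" if "i < n" for i using g that by (intro PiE_mem[OF g]) simp
  then show "m \<in> freq_box n a b" unfolding m by (simp add: freq_box_def freqs_def)
qed

lemma finite_freq_box: "finite (freq_box n a b)"
  unfolding freq_box_eq by (intro finite_imageI finite_PiE) auto

lemma card_freq_box: "card (freq_box n a b) = nat (b - a) ^ n"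
proof -
  have "inj_on (\<lambda>g i. if i < n then g i else (0::int)) ({..<n} \<rightarrow>\<^sub>E {a..<b})"
  proof (rule inj_onI)
    fix g h assume g: "g \<in> {..<n} \<rightarrow>\<^sub>E {a..<b}" and h: "h \<in> {..<n} \<rightarrow>\<^sub>E {a..<b}"
      and eq: "(\<lambda>i. if i < n then g i else (0::int)) = (\<lambda>i. if i < n then h i else 0)"
    show "g = h"
    proof (rule PiE_ext[OF g h])
      fix i assume "i \<in> {..<n}"
      then show "g i = h i" using fun_cong[OF eq, of i] by simp
    qed
  qed
  then show ?thesis unfolding freq_box_eq by (simp add: card_image card_PiE)
qed

text \<open>The Folner property of the integer lattice. With \<open>q\<close> bounding all entries
  of \<open>F\<close>, a cube of side \<open>R + 2 * q\<close> contains an inner cube of side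
  \<open>R\<close> that every shift from \<open>F\<close> keeps inside. The inner cube has the share
  \<open>(1 - u)^n\<close>; Bernoulli's inequality bounds it below by \<open>1 - n * u\<close>, and
  \<open>R\<close> is chosen with \<open>n * u \<le> \<epsilon>\<close>.\<close>

lemma almost_invariant_box:
  assumes "finite F" "F \<subseteq> freqs n" "\<epsilon> > 0"
  shows "\<exists>B. finite B \<and> B \<noteq> {} \<and> B \<subseteq> freqs n \<and>
    (\<forall>k\<in>F. (1 - \<epsilon>) * real (card B) \<le> real (card {m \<in> B. (\<lambda>i. m i + k i) \<in> B}))"
proof -
  define q where "q = nat (\<Sum>k\<in>F. \<Sum>i<n. \<bar>k i\<bar>)"
  have q: "\<bar>k i\<bar> \<le> int q" if "k \<in> F" "i < n" for k i
  proof -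
    have "\<bar>k i\<bar> \<le> (\<Sum>i<n. \<bar>k i\<bar>)" using that by (intro member_le_sum) auto
    also have "\<dots> \<le> (\<Sum>k\<in>F. \<Sum>i<n. \<bar>k i\<bar>)"
      using that assms(1) by (intro member_le_sum[of k]) (auto intro: sum_nonneg)
    finally show ?thesis by (simp add: q_def sum_nonneg)
  qed
  define R where "R = Suc (nat \<lceil>2 * real q * real n / \<epsilon>\<rceil>)"
  define B where "B = freq_box n 0 (int R + 2 * int q)"
  have cardB: "card B = (R + 2 * q) ^ n" by (simp add: B_def card_freq_box nat_add_distrib nat_mult_distrib)
  define u where "u = 2 * real q / (real R + 2 * real q)"
  have Rpos: "R > 0" by (simp add: R_def)
  have u: "0 \<le> u" "u \<le> 1" using Rpos by (auto simp: u_def field_simps)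
  have "real n * u \<le> \<epsilon>"
  proof -
    have "2 * real q * real n / \<epsilon> \<le> real R" unfolding R_def by linarith
    then have "2 * real q * real n \<le> \<epsilon> * real R" using assms(3) by (simp add: field_simps)
    also have "\<dots> \<le> \<epsilon> * (real R + 2 * real q)" using assms(3) by (intro mult_left_mono) auto
    finally show ?thesis using Rpos by (simp add: u_def field_simps)
  qed
  then have "1 - \<epsilon> \<le> 1 + real n * (- u)" by simp
  also have "\<dots> \<le> (1 + (- u)) ^ n" by (rule Bernoulli_inequality) (use u in auto)
  also have "1 + (- u) = real R / (real R + 2 * real q)" using Rpos by (simp add: u_def field_simps)
  finally have e: "1 - \<epsilon> \<le> (real R / (real R + 2 * real q)) ^ n" .
  have "(1 - \<epsilon>) * real (card B) \<le> real (R ^ n)"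
  proof -
    have "(1 - \<epsilon>) * real (card B) \<le> (real R / (real R + 2 * real q)) ^ n * real (card B)"
      by (rule mult_right_mono[OF e]) simp
    also have "\<dots> = ((real R / (real R + 2 * real q)) * (real R + 2 * real q)) ^ n"
      unfolding power_mult_distrib by (simp add: cardB)
    also have "(real R / (real R + 2 * real q)) * (real R + 2 * real q) = real R" using Rpos by simp
    also have "real R ^ n = real (R ^ n)" by simp
    finally show ?thesis .
  qed
  moreover have "R ^ n \<le> card {m \<in> B. (\<lambda>i. m i + k i) \<in> B}" if k: "k \<in> F" for k
  proof -
    have c: "card (freq_box n (int q) (int R + int q)) = R ^ n" by (simp add: card_freq_box)
    have sub: "freq_box n (int q) (int R + int q) \<subseteq> {m \<in> B. (\<lambda>i. m i + k i) \<in> B}"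
    proof
      fix m assume m: "m \<in> freq_box n (int q) (int R + int q)"
      have "m \<in> B" using m by (fastforce simp: freq_box_def B_def)
      moreover have "(\<lambda>i. m i + k i) \<in> freqs n"
        using m k assms(2) by (intro freqs_add) (auto simp: freq_box_def)
      moreover have "0 \<le> m i + k i \<and> m i + k i < int R + 2 * int q" if "i < n" for i
        using m q[OF k that] that by (force simp: freq_box_def)
      ultimately show "m \<in> {m \<in> B. (\<lambda>i. m i + k i) \<in> B}" by (simp add: B_def freq_box_def)
    qed
    have "finite {m \<in> B. (\<lambda>i. m i + k i) \<in> B}" by (simp add: B_def finite_freq_box)
    from card_mono[OF this sub] show ?thesis unfolding c .
  qed
  moreover have "finite B" "B \<subseteq> freqs n" by (simp add: B_def finite_freq_box) (auto simp: B_def freq_box_def)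
  moreover have "B \<noteq> {}" using cardB Rpos by auto
  ultimately show ?thesis by (intro exI[of _ B]) (auto intro: order_trans)
qed

text \<open>The \<open>k\<close>-th Fourier coefficient of \<open>apply_op n p f\<close>. The value
  0 off the trigonometric polynomials is the convention that \<open>lin_functional\<close>
  imposes.\<close>

definition coeff_functional :: "nat \<Rightarrow> ((nat \<Rightarrow> nat) \<Rightarrow> complex) \<Rightarrow> (nat \<Rightarrow> int) \<Rightarrow> ((nat \<Rightarrow> real) \<Rightarrow> complex) \<Rightarrow> complex" where
  "coeff_functional n p k = (\<lambda>f. if f \<in> trig_polys n then symb n p k * tcoef n f k else 0)"

text \<open>The zero frequency is included in \<open>F\<close> so that the constant function 1 has
  an expansion over the same set; the mean of the Fejer kernel is computed from it.\<close>

lemma apply_op_expansion: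
  assumes "f \<in> trig_polys n"
  obtains F where "finite F" "F \<subseteq> freqs n" "(\<lambda>_. 0) \<in> F"
    "apply_op n p f = tsum n F (\<lambda>k. coeff_functional n p k f)" "\<And>k. k \<notin> F \<Longrightarrow> coeff_functional n p k f = 0"
proof -
  obtain F where F: "finite F" "F \<subseteq> freqs n" "f = tsum n F (tcoef n f)" "\<And>k. k \<notin> F \<Longrightarrow> tcoef n f k = 0"
    using trig_polys_expansion[OF assms] by metis
  have "apply_op n p f = tsum n F (\<lambda>k. coeff_functional n p k f)"
    by (subst F(3)) (simp add: apply_op_tsum[OF F(1)] coeff_functional_def assms mult.commute)
  also have "\<dots> = tsum n (insert (\<lambda>_. 0) F) (\<lambda>k. coeff_functional n p k f)"
    by (rule tsum_mono_neutral) (use F in \<open>auto simp: coeff_functional_def\<close>)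
  finally show ?thesis
    using F by (intro that[of "insert (\<lambda>_. 0) F"]) (auto simp: freqs_def coeff_functional_def)
qed

lemma coeff_functional_bound:
  assumes "f \<in> trig_polys n"
  shows "cmod (coeff_functional n p k f) \<le> torus_norm n (apply_op n p f)"
proof -
  obtain F where F: "finite F" "F \<subseteq> freqs n" "apply_op n p f = tsum n F (\<lambda>k. coeff_functional n p k f)"
    "\<And>k. k \<notin> F \<Longrightarrow> coeff_functional n p k f = 0"
    using apply_op_expansion[OF assms] by metis
  show ?thesis
  proof (cases "k \<in> F")
    case True
    obtain M t where M: "M > 0" and t: "\<forall>k\<in>F. \<forall>c. (\<Sum>r<M. tsum n F c (t r) * cnj (echar n k (t r)))
           = of_nat M * (if k \<in> F then c k else 0)"
      using tsum_orthogonality[OF F(1,2) F(1,2)] by blast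
    have "real M * cmod (coeff_functional n p k f) = cmod (\<Sum>r<M. apply_op n p f (t r) * cnj (echar n k (t r)))"
      using bspec[OF t True, THEN spec, of "\<lambda>k. coeff_functional n p k f"] True F(3) by (simp add: norm_mult)
    also have "\<dots> \<le> (\<Sum>r<M. torus_norm n (apply_op n p f))"
      by (intro sum_norm_le) (simp add: norm_mult le_torus_norm apply_op_in_trig_polys assms)
    finally show ?thesis using M by simp
  next
    case False
    then show ?thesis using F(4) torus_norm_nonneg[OF apply_op_in_trig_polys[OF assms]] by simp
  qed
qed

text \<open>A Cesaro mean of the Fourier series of \<open>apply_op n p f\<close> at the point
  \<open>-s\<close>: grouping pairs by \<open>k = m - l\<close> gives frequency \<open>k\<close> the
  proportion of \<open>B\<close> that the shift by \<open>k\<close> keeps in \<open>B\<close>. The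
  sum over pairs exhibits the kernel as a squared modulus.\<close>

definition fejer_functional :: "nat \<Rightarrow> ((nat \<Rightarrow> nat) \<Rightarrow> complex) \<Rightarrow> (nat \<Rightarrow> int) set \<Rightarrow> (nat \<Rightarrow> real) \<Rightarrow>
    ((nat \<Rightarrow> real) \<Rightarrow> complex) \<Rightarrow> complex" where
  "fejer_functional n p B s = (\<lambda>f. \<Sum>m\<in>B. \<Sum>l\<in>B. cnj (echar n (\<lambda>i. m i - l i) s) / of_nat (card B) * coeff_functional n p (\<lambda>i. m i - l i) f)"

text \<open>The functional integrates a translate of \<^term>\<open>apply_op n p f\<close> against the kernel
  $|\sum_{m \in B} e_m|^2 / |B|$, which is nonnegative and has mean one.\<close>
lemma fejer_functional_bound:
  assumes f: "f \<in> trig_polys n" and B: "finite B" "B \<noteq> {}" "B \<subseteq> freqs n"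
  shows "cmod (fejer_functional n p B s f) \<le> torus_norm n (apply_op n p f)"
proof -
  obtain F where F: "finite F" "F \<subseteq> freqs n" "(\<lambda>_. 0) \<in> F"
    and op: "apply_op n p f = tsum n F (\<lambda>k. coeff_functional n p k f)" and ev0: "\<And>k. k \<notin> F \<Longrightarrow> coeff_functional n p k f = 0"
    using apply_op_expansion[OF f, of p] by metis
  define g where "g = apply_op n p f"
  have g: "g = tsum n F (\<lambda>k. coeff_functional n p k f)" unfolding g_def by (rule op)
  let ?d = "\<lambda>m l i. m i - l i :: int"
  let ?G = "(\<lambda>(m, l). ?d m l) ` (B \<times> B)"
  have G: "finite ?G" "?G \<subseteq> freqs n" using B by auto
  obtain M t where M: "M > 0" and t: "\<forall>k\<in>?G. \<forall>c. (\<Sum>r<M. tsum n F c (t r) * cnj (echar n k (t r)))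
           = of_nat M * (if k \<in> F then c k else 0)"
    using tsum_orthogonality[OF F(1,2) G] by blast
  have orth: "(\<Sum>r<M. tsum n F c (t r) * cnj (echar n (?d m l) (t r))) = of_nat M * (if ?d m l \<in> F then c (?d m l) else 0)"
    if "m \<in> B" "l \<in> B" for m l c
  proof -
    have "?d m l \<in> ?G" using that by (intro image_eqI[of _ _ "(m, l)"]) auto
    from bspec[OF t this] show ?thesis by blast
  qed
  define h where "h x = (cmod (\<Sum>m\<in>B. echar n m x))\<^sup>2" for x
  have h0: "0 \<le> h x" for x by (simp add: h_def)
  have h: "complex_of_real (h x) = (\<Sum>m\<in>B. \<Sum>l\<in>B. cnj (echar n (?d m l) x))" for x
  proof -
    have "complex_of_real (h x) = (\<Sum>l\<in>B. echar n l x) * cnj (\<Sum>m\<in>B. echar n m x)"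
      unfolding h_def by (rule complex_norm_square)
    also have "\<dots> = (\<Sum>m\<in>B. cnj (echar n m x)) * (\<Sum>l\<in>B. echar n l x)" by simp
    also have "\<dots> = (\<Sum>m\<in>B. \<Sum>l\<in>B. cnj (echar n m x) * echar n l x)" by (rule sum_product)
    finally show ?thesis by (simp add: echar_diff_freq)
  qed
  have paired: "(\<Sum>r<M. tsum n F c (t r) * of_real (h (t r)))
      = of_nat M * (\<Sum>m\<in>B. \<Sum>l\<in>B. if ?d m l \<in> F then c (?d m l) else 0)" for c
  proof -
    have "(\<Sum>r<M. tsum n F c (t r) * of_real (h (t r)))
        = (\<Sum>r<M. \<Sum>m\<in>B. \<Sum>l\<in>B. tsum n F c (t r) * cnj (echar n (?d m l) (t r)))"
      by (simp only: h sum_distrib_left)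
    also have "\<dots> = (\<Sum>m\<in>B. \<Sum>l\<in>B. \<Sum>r<M. tsum n F c (t r) * cnj (echar n (?d m l) (t r)))"
      by (rule sum_rotate3)
    also have "\<dots> = (\<Sum>m\<in>B. \<Sum>l\<in>B. of_nat M * (if ?d m l \<in> F then c (?d m l) else 0))"
      by (intro sum.cong refl) (rule orth)
    finally show ?thesis by (simp only: sum_distrib_left)
  qed
  \<comment> \<open>The mean of the kernel is its pairing with the constant 1, and only the pairs
    \<open>m = l\<close> contribute.\<close>
  have "of_real (\<Sum>r<M. h (t r)) = (\<Sum>r<M. tsum n F (\<lambda>k. if k = (\<lambda>_. 0) then 1 else 0) (t r) * complex_of_real (h (t r)))"
    using F by (simp add: tsum_def if_distrib[of "\<lambda>z. z * _"] cong: if_cong)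
  also have "\<dots> = of_nat M * (\<Sum>m\<in>B. \<Sum>l\<in>B. if m = l then 1 else 0)"
    unfolding paired using F(3) by (intro arg_cong2[where f = "(*)"] sum.cong refl) (auto simp: fun_eq_iff)
  also have "\<dots> = of_real (real M * real (card B))" using B by simp
  finally have mean: "(\<Sum>r<M. h (t r)) = real M * real (card B)" by (simp only: of_real_eq_iff)
  \<comment> \<open>The phases \<open>cnj (echar n k s)\<close> are those of a translate of
    \<open>g\<close> by \<open>s\<close>, so \<open>paired\<close> identifies the functional with an
    average of that translate against \<open>h\<close>.\<close>
  have "of_nat M * (of_nat (card B) * fejer_functional n p B s f)
      = of_nat M * (\<Sum>m\<in>B. \<Sum>l\<in>B. if ?d m l \<in> F then coeff_functional n p (?d m l) f * cnj (echar n (?d m l) s) else 0)"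
  proof -
    have "of_nat (card B) * fejer_functional n p B s f = (\<Sum>m\<in>B. \<Sum>l\<in>B. cnj (echar n (?d m l) s) * coeff_functional n p (?d m l) f)"
      using B by (simp add: fejer_functional_def sum_distrib_left card_gt_0_iff)
    also have "\<dots> = (\<Sum>m\<in>B. \<Sum>l\<in>B. if ?d m l \<in> F then coeff_functional n p (?d m l) f * cnj (echar n (?d m l) s) else 0)"
      by (intro sum.cong refl) (use ev0 in auto)
    finally show ?thesis by simp
  qed
  also have "\<dots> = (\<Sum>r<M. tsum n F (\<lambda>k. coeff_functional n p k f * cnj (echar n k s)) (t r) * of_real (h (t r)))"
    unfolding paired by simp
  also have "\<dots> = (\<Sum>r<M. g (\<lambda>i. t r i - s i) * of_real (h (t r)))"
    unfolding g by (simp add: tsum_def echar_diff_point mult_ac)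
  finally have "cmod (of_nat M * (of_nat (card B) * fejer_functional n p B s f)) = cmod (\<Sum>r<M. g (\<lambda>i. t r i - s i) * of_real (h (t r)))"
    by simp
  also have "\<dots> \<le> (\<Sum>r<M. torus_norm n g * h (t r))"
  proof (intro sum_norm_le)
    fix r
    have "cmod (g (\<lambda>i. t r i - s i)) \<le> torus_norm n g"
      unfolding g_def by (rule le_torus_norm[OF apply_op_in_trig_polys[OF f]])
    then show "cmod (g (\<lambda>i. t r i - s i) * of_real (h (t r))) \<le> torus_norm n g * h (t r)"
      using h0 by (simp add: norm_mult mult_right_mono)
  qed
  also have "\<dots> = torus_norm n g * (real M * real (card B))" by (simp only: mean flip: sum_distrib_left)
  finally show ?thesis using M B by (simp add: norm_mult g_def card_gt_0_iff)
qed

section \<open>Extension of multipliers\<close>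

text \<open>Averaging over translations kills the off-diagonal entries of \<open>Q\<close>; the Fejer weights of the
  diagonal tend to one along almost invariant sets \<open>B\<close>.\<close>
lemma multiplier_bound:
  assumes F: "finite F" "F \<subseteq> freqs n" and "C \<ge> 0"
    and H: "\<And>z B s. finite B \<Longrightarrow> B \<noteq> {} \<Longrightarrow> B \<subseteq> freqs n \<Longrightarrow>
      cmod (\<Sum>k\<in>F. z k * (\<Sum>m\<in>B. \<Sum>l\<in>B. cnj (echar n (\<lambda>i. m i - l i) s) / of_nat (card B) * Q k (\<lambda>i. m i - l i)))
      \<le> C * torus_norm n (tsum n F z)"
  shows "cmod (\<Sum>k\<in>F. x k * Q k k) \<le> C * torus_norm n (tsum n F x)"
proof -
  define W where "W = (\<Sum>k\<in>F. cmod (x k * Q k k))"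
  have W0: "W \<ge> 0" unfolding W_def by (simp add: sum_nonneg)
  let ?d = "\<lambda>m l i. m i - l i :: int"
  have main: "cmod (\<Sum>k\<in>F. x k * Q k k) \<le> C * torus_norm n (tsum n F x) + \<epsilon> * W" if eps: "\<epsilon> > 0" for \<epsilon>
  proof -
    obtain B where B: "finite B" "B \<noteq> {}" "B \<subseteq> freqs n" and
      inv: "\<And>k. k \<in> F \<Longrightarrow> (1 - \<epsilon>) * real (card B) \<le> real (card {m \<in> B. (\<lambda>i. m i + k i) \<in> B})"
      using almost_invariant_box[OF F eps] by blast
    define cardB where "cardB = complex_of_nat (card B)"
    have cardB: "cardB \<noteq> 0" using B by (simp add: cardB_def)
    \<comment> \<open>The Fejer weight of frequency \<open>k\<close>; the choice of \<open>B\<close>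
      places it between \<open>1 - \<epsilon>\<close> and 1 for \<open>k \<in> F\<close>.\<close>
    define \<nu> where "\<nu> k = real (card {m \<in> B. (\<lambda>i. m i + k i) \<in> B}) / real (card B)" for k
    have \<nu>1: "\<nu> k \<le> 1" for k
      using card_mono[of B "{m \<in> B. (\<lambda>i. m i + k i) \<in> B}"] B
      by (simp add: \<nu>_def divide_le_eq card_gt_0_iff)
    have \<nu>2: "1 - \<epsilon> \<le> \<nu> k" if "k \<in> F" for k
      using inv[OF that] B by (simp add: \<nu>_def le_divide_eq card_gt_0_iff)
    let ?G = "(\<lambda>(m, l). ?d m l) ` (B \<times> B)"
    have G: "finite ?G" "?G \<subseteq> freqs n" using B by auto
    obtain M t where M: "M > 0" and t: "\<forall>g\<in>?G. \<forall>c. (\<Sum>r<M. tsum n F c (t r) * cnj (echar n g (t r)))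
           = of_nat M * (if g \<in> F then c g else 0)"
      using tsum_orthogonality[OF F G] by blast
    have orth: "(\<Sum>r<M. echar n k (t r) * cnj (echar n (?d m l) (t r))) = (if ?d m l = k then of_nat M else 0)"
      if "k \<in> F" "m \<in> B" "l \<in> B" for k m l
    proof -
      have "?d m l \<in> ?G" using that by (intro image_eqI[of _ _ "(m, l)"]) auto
      from bspec[OF t this, THEN spec, of "\<lambda>j. if j = k then 1 else 0"]
      have "(\<Sum>r<M. tsum n F (\<lambda>j. if j = k then 1 else 0) (t r) * cnj (echar n (?d m l) (t r)))
          = (if ?d m l = k then of_nat M else 0)" using that(1) by auto
      then show ?thesis
        using that(1) F(1) by (simp add: tsum_def if_distrib[of "\<lambda>z. z * _"] cong: if_cong)
    qed
    have count: "(\<Sum>m\<in>B. \<Sum>l\<in>B. if ?d m l = k then 1 else 0) = of_real (\<nu> k) * cardB" for k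
    proof -
      have "(\<Sum>m\<in>B. \<Sum>l\<in>B. if ?d m l = k then 1 else (0::complex))
          = (\<Sum>l\<in>B. \<Sum>m\<in>B. if m = (\<lambda>i. l i + k i) then 1 else 0)"
        by (subst sum.swap) (intro sum.cong refl if_cong, auto simp: fun_eq_iff algebra_simps)
      also have "\<dots> = (\<Sum>l\<in>B. if (\<lambda>i. l i + k i) \<in> B then 1 else 0)" using B(1) by simp
      also have "\<dots> = of_nat (card {m \<in> B. (\<lambda>i. m i + k i) \<in> B})"
        using B(1) by (simp add: sum.If_cases Int_def)
      also have "\<dots> = of_real (\<nu> k) * cardB" using cardB by (simp add: \<nu>_def cardB_def)
      finally show ?thesis .
    qed
    let ?e = "\<lambda>r k m l. cnj (echar n (?d m l) (t r)) / cardB * Q k (?d m l)"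
    \<comment> \<open>The hypothesis is applied to the input translated by \<open>t r\<close>, while
      \<open>s = t r\<close> translates the output back. In the sum over \<open>r\<close> the two
      phases cancel exactly when \<open>m - l = k\<close>.\<close>
    have each: "cmod (\<Sum>k\<in>F. (x k * echar n k (t r)) * (\<Sum>m\<in>B. \<Sum>l\<in>B. ?e r k m l)) \<le> C * torus_norm n (tsum n F x)" for r
    proof -
      have "torus_norm n (tsum n F (\<lambda>k. x k * echar n k (t r))) \<le> torus_norm n (tsum n F x)"
      proof (rule torus_norm_le)
        fix u
        have "tsum n F (\<lambda>k. x k * echar n k (t r)) u = tsum n F x (\<lambda>i. t r i + u i)"
          by (simp add: tsum_def echar_add_point mult.assoc)
        then show "cmod (tsum n F (\<lambda>k. x k * echar n k (t r)) u) \<le> torus_norm n (tsum n F x)"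
          by (simp add: tsum_le_torus_norm)
      qed
      then have "C * torus_norm n (tsum n F (\<lambda>k. x k * echar n k (t r))) \<le> C * torus_norm n (tsum n F x)"
        using \<open>C \<ge> 0\<close> by (rule mult_left_mono)
      with H[OF B, of "\<lambda>k. x k * echar n k (t r)" "t r"] show ?thesis unfolding cardB_def by linarith
    qed
    have "(\<Sum>r<M. \<Sum>k\<in>F. (x k * echar n k (t r)) * (\<Sum>m\<in>B. \<Sum>l\<in>B. ?e r k m l))
        = (\<Sum>k\<in>F. \<Sum>r<M. \<Sum>m\<in>B. \<Sum>l\<in>B. (x k * echar n k (t r)) * ?e r k m l)"
      unfolding sum_distrib_left by (rule sum.swap)
    also have "\<dots> = (\<Sum>k\<in>F. \<Sum>m\<in>B. \<Sum>l\<in>B. \<Sum>r<M. (x k * echar n k (t r)) * ?e r k m l)"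
      by (intro sum.cong refl) (rule sum_rotate3)
    also have "\<dots> = (\<Sum>k\<in>F. \<Sum>m\<in>B. \<Sum>l\<in>B. of_nat M * (x k * Q k k / cardB) * (if ?d m l = k then 1 else 0))"
    proof (intro sum.cong refl)
      fix k m l assume kml: "k \<in> F" "m \<in> B" "l \<in> B"
      have "(\<Sum>r<M. (x k * echar n k (t r)) * ?e r k m l)
          = x k / cardB * Q k (?d m l) * (\<Sum>r<M. echar n k (t r) * cnj (echar n (?d m l) (t r)))"
        by (simp add: sum_distrib_left mult_ac)
      also have "\<dots> = of_nat M * (x k * Q k k / cardB) * (if ?d m l = k then 1 else 0)"
        unfolding orth[OF kml] by auto
      finally show "(\<Sum>r<M. (x k * echar n k (t r)) * ?e r k m l)
          = of_nat M * (x k * Q k k / cardB) * (if ?d m l = k then 1 else 0)" .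
    qed
    also have "\<dots> = (\<Sum>k\<in>F. of_nat M * (x k * Q k k / cardB) * (of_real (\<nu> k) * cardB))"
      by (simp only: count flip: sum_distrib_left)
    also have "\<dots> = of_nat M * (\<Sum>k\<in>F. x k * Q k k * of_real (\<nu> k))"
      using cardB by (simp add: sum_distrib_left mult_ac)
    finally have "real M * cmod (\<Sum>k\<in>F. x k * Q k k * of_real (\<nu> k))
        = cmod (\<Sum>r<M. \<Sum>k\<in>F. (x k * echar n k (t r)) * (\<Sum>m\<in>B. \<Sum>l\<in>B. ?e r k m l))"
      by (simp add: norm_mult)
    also have "\<dots> \<le> (\<Sum>r<M. C * torus_norm n (tsum n F x))" by (intro sum_norm_le each)
    finally have weighted: "cmod (\<Sum>k\<in>F. x k * Q k k * of_real (\<nu> k)) \<le> C * torus_norm n (tsum n F x)"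
      using M by simp
    have "cmod (\<Sum>k\<in>F. x k * Q k k * of_real (1 - \<nu> k)) \<le> (\<Sum>k\<in>F. \<epsilon> * cmod (x k * Q k k))"
    proof (rule sum_norm_le)
      fix k assume k: "k \<in> F"
      have "cmod (x k * Q k k * of_real (1 - \<nu> k)) = cmod (x k * Q k k) * (1 - \<nu> k)"
        using \<nu>1[of k] by (simp only: norm_mult norm_of_real)
      also have "\<dots> \<le> cmod (x k * Q k k) * \<epsilon>" using \<nu>2[OF k] by (intro mult_left_mono) auto
      finally show "cmod (x k * Q k k * of_real (1 - \<nu> k)) \<le> \<epsilon> * cmod (x k * Q k k)" by (simp only: mult.commute)
    qed
    also have "\<dots> = \<epsilon> * W" by (simp only: W_def sum_distrib_left)
    finally have rest: "cmod (\<Sum>k\<in>F. x k * Q k k * of_real (1 - \<nu> k)) \<le> \<epsilon> * W" .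
    have split: "(\<Sum>k\<in>F. x k * Q k k) = (\<Sum>k\<in>F. x k * Q k k * of_real (\<nu> k)) + (\<Sum>k\<in>F. x k * Q k k * of_real (1 - \<nu> k))"
      unfolding sum.distrib[symmetric] by (intro sum.cong refl) (simp add: algebra_simps)
    show ?thesis
      unfolding split using weighted rest norm_triangle_ineq[of "\<Sum>k\<in>F. x k * Q k k * of_real (\<nu> k)"
          "\<Sum>k\<in>F. x k * Q k k * of_real (1 - \<nu> k)"] by linarith
  qed
  show ?thesis
  proof (rule field_le_epsilon)
    fix e :: real assume e: "e > 0"
    have "e / (W + 1) * W \<le> e"
      using W0 e by (simp add: divide_le_eq mult_left_mono)
    moreover have "e / (W + 1) > 0" using W0 e by simp
    ultimately show "cmod (\<Sum>k\<in>F. x k * Q k k) \<le> C * torus_norm n (tsum n F x) + e"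
      using main[of "e / (W + 1)"] by linarith
  qed
qed

section \<open>Extending functionals to tuples of trigonometric polynomials\<close>

lemma torus_norm_add_le:
  "torus_norm n (tsum n F (\<lambda>k. x k + y k)) \<le> torus_norm n (tsum n F x) + torus_norm n (tsum n F y)"
proof (rule torus_norm_le)
  fix t
  have "tsum n F (\<lambda>k. x k + y k) t = tsum n F x t + tsum n F y t"
    by (simp add: tsum_def distrib_right sum.distrib)
  then show "cmod (tsum n F (\<lambda>k. x k + y k) t) \<le> torus_norm n (tsum n F x) + torus_norm n (tsum n F y)"
    using norm_triangle_ineq[of "tsum n F x t" "tsum n F y t"] tsum_le_torus_norm[of n F x t] tsum_le_torus_norm[of n F y t]
    by simp
qed

lemma torus_norm_scale_le: "torus_norm n (tsum n F (\<lambda>k. c * x k)) \<le> cmod c * torus_norm n (tsum n F x)"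
proof (rule torus_norm_le)
  fix t
  have "tsum n F (\<lambda>k. c * x k) t = c * tsum n F x t"
    by (simp add: tsum_def sum_distrib_left mult.assoc)
  then show "cmod (tsum n F (\<lambda>k. c * x k) t) \<le> cmod c * torus_norm n (tsum n F x)"
    by (simp add: norm_mult mult_left_mono tsum_le_torus_norm)
qed

lemma torus_norm_tsum_nonneg: "0 \<le> torus_norm n (tsum n F x)"
  by (rule order_trans[OF norm_ge_zero tsum_le_torus_norm])

text \<open>The map \<open>f \<mapsto> (apply_op n p f)\<close> over \<open>p \<in> set T\<close> is
  isometric into tuples under the maximum of the supremum norms. The bound says that
  \<open>b\<close> defines a functional on its image, and Hahn-Banach extends it to all tuples with
  frequencies in \<open>F\<close>, encoded as arrays on \<open>F \<times> set T\<close>.\<close>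

lemma pointwise_extension:
  assumes "T \<noteq> []" and F: "finite F" and "C \<ge> 0"
    and bound: "\<And>a. cmod (\<Sum>k\<in>F. a k * b k) \<le> C * seminorm_T n T (tsum n F a)"
  shows "\<exists>\<beta>. (\<forall>k\<in>F. (\<Sum>p\<in>set T. \<beta> k p * symb n p k) = b k) \<and>
     (\<forall>p\<in>set T. \<forall>z. cmod (\<Sum>k\<in>F. z k * \<beta> k p) \<le> C * torus_norm n (tsum n F z))"
proof -
  define N where "N x = Max ((\<lambda>p. torus_norm n (tsum n F (\<lambda>k. x (k, p)))) ` set T)" for x
  define q where "q x = C * N x" for x
  have N_upper: "torus_norm n (tsum n F (\<lambda>k. x (k, p))) \<le> N x" if "p \<in> set T" for x p
    unfolding N_def using that by simp
  have N_least: "N x \<le> D" if "\<And>p. p \<in> set T \<Longrightarrow> torus_norm n (tsum n F (\<lambda>k. x (k, p))) \<le> D" for x D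
    unfolding N_def using that \<open>T \<noteq> []\<close> by simp
  have N_add: "N (\<lambda>i. x i + y i) \<le> N x + N y" for x y
    by (intro N_least order_trans[OF torus_norm_add_le] add_mono N_upper)
  have N_scale: "N (\<lambda>i. c * x i) \<le> cmod c * N x" for c x
    by (intro N_least order_trans[OF torus_norm_scale_le] mult_left_mono N_upper) auto
  have N_hom: "N (\<lambda>i. c * x i) = cmod c * N x" for c x
  proof (cases "c = 0")
    case True
    have "0 \<le> N (\<lambda>i. c * x i)"
      using order_trans[OF torus_norm_tsum_nonneg N_upper[of "hd T"]] \<open>T \<noteq> []\<close> by simp
    then show ?thesis using N_scale[of c x] True by simp
  next
    case False
    have "N x = N (\<lambda>i. inverse c * (c * x i))" using False by (simp flip: mult.assoc)
    also have "\<dots> \<le> cmod (inverse c) * N (\<lambda>i. c * x i)" by (rule N_scale)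
    finally have "cmod c * N x \<le> cmod c * (inverse (cmod c) * N (\<lambda>i. c * x i))"
      by (intro mult_left_mono) (simp_all only: norm_inverse norm_ge_zero)
    also have "\<dots> = N (\<lambda>i. c * x i)" using False by simp
    finally have "cmod c * N x \<le> N (\<lambda>i. c * x i)" .
    then show ?thesis using N_scale[of c x] by simp
  qed
  define I where "I = F \<times> set T"
  have finI: "finite I" using F by (simp add: I_def)
  define u where "u j i = (if fst i = j \<and> i \<in> I then symb n (snd i) j else 0)" for j i
  have "q (\<lambda>i. x i + y i) \<le> q x + q y" for x y
    using mult_left_mono[OF N_add \<open>C \<ge> 0\<close>] by (simp add: q_def distrib_left)
  moreover have "q (\<lambda>i. c * x i) = cmod c * q x" for c x by (simp add: q_def N_hom)
  moreover note finI F
  moreover have "u j i = 0" if "i \<notin> I" for i j using that by (simp add: u_def)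
  moreover have "cmod (\<Sum>j\<in>F. a j * b j) \<le> q (\<lambda>i. \<Sum>j\<in>F. a j * u j i)" for a
  proof -
    have "(\<Sum>j\<in>F. a j * u j (k, p)) = a k * symb n p k" if "k \<in> F" "p \<in> set T" for k p
    proof -
      have "(\<Sum>j\<in>F. a j * u j (k, p)) = (\<Sum>j\<in>F. if j = k then a j * symb n p j else 0)"
        using that by (intro sum.cong) (auto simp: u_def I_def)
      then show ?thesis using that F by simp
    qed
    then have "N (\<lambda>i. \<Sum>j\<in>F. a j * u j i) = Max ((\<lambda>p. torus_norm n (tsum n F (\<lambda>k. a k * symb n p k))) ` set T)"
      unfolding N_def tsum_def by (intro arg_cong[where f = Max] image_cong refl) simp
    also have "\<dots> = seminorm_T n T (tsum n F a)" by (simp add: seminorm_T_eq apply_op_tsum[OF F])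
    finally show ?thesis using bound[of a] by (simp add: q_def)
  qed
  ultimately have "\<exists>\<beta>. (\<forall>j\<in>F. (\<Sum>i\<in>I. \<beta> i * u j i) = b j) \<and>
      (\<forall>x. (\<forall>i. i \<notin> I \<longrightarrow> x i = 0) \<longrightarrow> cmod (\<Sum>i\<in>I. \<beta> i * x i) \<le> q x)"
    by (rule seminorm_extension)
  then obtain \<beta> where \<beta>1: "\<And>j. j \<in> F \<Longrightarrow> (\<Sum>i\<in>I. \<beta> i * u j i) = b j"
    and \<beta>2: "\<And>x. (\<And>i. i \<notin> I \<Longrightarrow> x i = 0) \<Longrightarrow> cmod (\<Sum>i\<in>I. \<beta> i * x i) \<le> q x" by blast
  show ?thesis
  proof (intro exI[of _ "\<lambda>k p. \<beta> (k, p)"] conjI ballI allI)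
    fix k assume k: "k \<in> F"
    have "b k = (\<Sum>j\<in>F. \<Sum>p\<in>set T. \<beta> (j, p) * u k (j, p))"
      using \<beta>1[OF k] by (simp add: I_def sum.cartesian_product)
    also have "\<dots> = (\<Sum>j\<in>F. if j = k then (\<Sum>p\<in>set T. \<beta> (k, p) * symb n p k) else 0)"
      using k by (intro sum.cong) (auto simp: u_def I_def)
    also have "\<dots> = (\<Sum>p\<in>set T. \<beta> (k, p) * symb n p k)" using k F by simp
    finally show "(\<Sum>p\<in>set T. \<beta> (k, p) * symb n p k) = b k" by simp
  next
    fix p and z :: "(nat \<Rightarrow> int) \<Rightarrow> complex" assume p: "p \<in> set T"
    \<comment> \<open>A tuple whose only nonzero component is the one at \<open>p\<close>:
      restricting the extended functional to it bounds each component separately.\<close>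
    define x where "x i = (if i \<in> I \<and> snd i = p then z (fst i) else 0)" for i
    have "(\<Sum>i\<in>I. \<beta> i * x i) = (\<Sum>k\<in>F. \<Sum>p'\<in>set T. \<beta> (k, p') * x (k, p'))"
      by (simp add: I_def sum.cartesian_product)
    also have "\<dots> = (\<Sum>k\<in>F. \<Sum>p'\<in>set T. if p' = p then z k * \<beta> (k, p) else 0)"
      by (intro sum.cong) (auto simp: x_def I_def)
    also have "\<dots> = (\<Sum>k\<in>F. z k * \<beta> (k, p))" using p by simp
    finally have "cmod (\<Sum>k\<in>F. z k * \<beta> (k, p)) \<le> q x" using \<beta>2[of x] by (simp add: x_def)
    also have "\<dots> \<le> C * torus_norm n (tsum n F z)"
      unfolding q_def
    proof (intro mult_left_mono N_least \<open>C \<ge> 0\<close>)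
      fix p' assume p': "p' \<in> set T"
      show "torus_norm n (tsum n F (\<lambda>k. x (k, p'))) \<le> torus_norm n (tsum n F z)"
      proof (cases "p' = p")
        case True
        then have "tsum n F (\<lambda>k. x (k, p')) = tsum n F z"
          unfolding tsum_def using p by (intro ext sum.cong) (auto simp: x_def I_def)
        then show ?thesis by simp
      next
        case False
        then have "tsum n F (\<lambda>k. x (k, p')) = (\<lambda>_. 0)" by (simp add: tsum_def x_def)
        then show ?thesis using torus_norm_tsum_nonneg by (intro torus_norm_le) simp
      qed
    qed
    finally show "cmod (\<Sum>k\<in>F. z k * \<beta> (k, p)) \<le> C * torus_norm n (tsum n F z)" .
  qed
qed

text \<open>The extensions chosen at the points \<open>y\<close> need not vary continuously.
  Averaging finitely many of them with a partition of unity repairs this: convexity preserves the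
  norm bound exactly, and since \<open>b\<close> varies by at most \<open>\<epsilon>\<close> where a
  weight is nonzero, the extension property survives up to \<open>\<epsilon>\<close>.\<close>

lemma continuous_extension:
  assumes K: "compact_space K" and "T \<noteq> []" and F: "finite F" and "C \<ge> 0" and "\<epsilon> > 0"
    and b: "\<And>k. k \<in> F \<Longrightarrow> b k \<in> cont_fun K"
    and bound: "\<And>a y. y \<in> topspace K \<Longrightarrow> cmod (\<Sum>k\<in>F. a k * b k y) \<le> C * seminorm_T n T (tsum n F a)"
  shows "\<exists>\<beta>. (\<forall>k p. \<beta> k p \<in> cont_fun K) \<and>
     (\<forall>k\<in>F. \<forall>x\<in>topspace K. cmod ((\<Sum>p\<in>set T. symb n p k * \<beta> k p x) - b k x) \<le> \<epsilon>) \<and>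
     (\<forall>p\<in>set T. \<forall>z. \<forall>x\<in>topspace K. cmod (\<Sum>k\<in>F. z k * \<beta> k p x) \<le> C * torus_norm n (tsum n F z))"
proof -
  have "\<exists>\<beta>. (\<forall>k\<in>F. (\<Sum>p\<in>set T. \<beta> k p * symb n p k) = b k y) \<and>
     (\<forall>p\<in>set T. \<forall>z. cmod (\<Sum>k\<in>F. z k * \<beta> k p) \<le> C * torus_norm n (tsum n F z))"
    if "y \<in> topspace K" for y
    by (rule pointwise_extension[OF \<open>T \<noteq> []\<close> F \<open>C \<ge> 0\<close>]) (rule bound[OF that])
  then have "\<forall>y\<in>topspace K. \<exists>\<beta>. (\<forall>k\<in>F. (\<Sum>p\<in>set T. \<beta> k p * symb n p k) = b k y) \<and>
     (\<forall>p\<in>set T. \<forall>z. cmod (\<Sum>k\<in>F. z k * \<beta> k p) \<le> C * torus_norm n (tsum n F z))" by (rule ballI)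
  from bchoice[OF this] obtain \<gamma> where
    \<gamma>: "\<forall>y\<in>topspace K. (\<forall>k\<in>F. (\<Sum>p\<in>set T. \<gamma> y k p * symb n p k) = b k y) \<and>
     (\<forall>p\<in>set T. \<forall>z. cmod (\<Sum>k\<in>F. z k * \<gamma> y k p) \<le> C * torus_norm n (tsum n F z))" by (rule exE)
  have \<gamma>1: "(\<Sum>p\<in>set T. \<gamma> y k p * symb n p k) = b k y" if "y \<in> topspace K" "k \<in> F" for y k
    using bspec[OF \<gamma> that(1)] that(2) by simp
  have \<gamma>2: "cmod (\<Sum>k\<in>F. z k * \<gamma> y k p) \<le> C * torus_norm n (tsum n F z)" if "y \<in> topspace K" "p \<in> set T" for y p z
    using bspec[OF \<gamma> that(1)] that(2) by simp
  have "\<forall>k\<in>F. continuous_map K euclidean (b k)" using b by (simp add: cont_fun_def)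
  from finite_partition_of_unity[OF K F this \<open>\<epsilon> > 0\<close>]
  obtain Y \<phi> where PU: "finite Y \<and> Y \<subseteq> topspace K \<and> (\<forall>y\<in>Y. continuous_map K euclideanreal (\<phi> y)) \<and>
    (\<forall>x\<in>topspace K. (\<Sum>y\<in>Y. \<phi> y x) = 1 \<and>
       (\<forall>y\<in>Y. 0 \<le> \<phi> y x \<and> (\<phi> y x \<noteq> 0 \<longrightarrow> (\<forall>k\<in>F. cmod (b k x - b k y) \<le> \<epsilon>))))"
    by (elim exE)
  then have Y: "finite Y" "Y \<subseteq> topspace K" by simp_all
  have \<phi>c: "continuous_map K euclideanreal (\<phi> y)" if "y \<in> Y" for y using PU that by simp
  have \<phi>1: "(\<Sum>y\<in>Y. \<phi> y x) = 1" if "x \<in> topspace K" for x using PU that by simp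
  have \<phi>0: "0 \<le> \<phi> y x" if "x \<in> topspace K" "y \<in> Y" for x y using PU that by simp
  have \<phi>b: "cmod (b k x - b k y) \<le> \<epsilon>" if "x \<in> topspace K" "y \<in> Y" "\<phi> y x \<noteq> 0" "k \<in> F" for x y k
    using PU that by simp
  define \<beta> where "\<beta> k p x = (if x \<in> topspace K then \<Sum>y\<in>Y. of_real (\<phi> y x) * \<gamma> y k p else 0)" for k p x
  have avg: "cmod (\<Sum>y\<in>Y. of_real (\<phi> y x) * w y) \<le> D"
    if x: "x \<in> topspace K" and w: "\<And>y. y \<in> Y \<Longrightarrow> \<phi> y x \<noteq> 0 \<Longrightarrow> cmod (w y) \<le> D" for x D and w :: "_ \<Rightarrow> complex"
  proof -
    have "cmod (\<Sum>y\<in>Y. of_real (\<phi> y x) * w y) \<le> (\<Sum>y\<in>Y. \<phi> y x * D)"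
    proof (rule sum_norm_le)
      fix y assume y: "y \<in> Y"
      show "cmod (of_real (\<phi> y x) * w y) \<le> \<phi> y x * D"
        using w[OF y] \<phi>0[OF x y] by (cases "\<phi> y x = 0") (auto simp: norm_mult intro: mult_left_mono)
    qed
    also have "\<dots> = D" using \<phi>1[OF x] by (simp flip: sum_distrib_right)
    finally show ?thesis .
  qed
  show ?thesis
  proof (intro exI[of _ \<beta>] conjI allI ballI)
    fix k p
    have "continuous_map K euclidean (\<lambda>x. \<Sum>y\<in>Y. of_real (\<phi> y x) * \<gamma> y k p)"
      unfolding continuous_map_atin
    proof
      fix x assume x: "x \<in> topspace K"
      have "(\<phi> y \<longlongrightarrow> \<phi> y x) (atin K x)" if "y \<in> Y" for y
        using \<phi>c[OF that] x by (auto simp: continuous_map_atin)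
      then have "((\<lambda>x. \<Sum>y\<in>Y. of_real (\<phi> y x) * \<gamma> y k p) \<longlongrightarrow> (\<Sum>y\<in>Y. of_real (\<phi> y x) * \<gamma> y k p)) (atin K x)"
        by (intro tendsto_intros) auto
      then show "limitin euclidean (\<lambda>x. \<Sum>y\<in>Y. of_real (\<phi> y x) * \<gamma> y k p) (\<Sum>y\<in>Y. of_real (\<phi> y x) * \<gamma> y k p) (atin K x)"
        by simp
    qed
    then have "continuous_map K euclidean (\<beta> k p)"
      by (rule continuous_map_eq) (simp add: \<beta>_def)
    then show "\<beta> k p \<in> cont_fun K" by (simp add: cont_fun_def \<beta>_def)
  next
    fix k x assume k: "k \<in> F" and x: "x \<in> topspace K"
    have "(\<Sum>p\<in>set T. symb n p k * \<beta> k p x) = (\<Sum>p\<in>set T. \<Sum>y\<in>Y. of_real (\<phi> y x) * (\<gamma> y k p * symb n p k))"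
      using x by (simp add: \<beta>_def sum_distrib_left mult_ac)
    also have "\<dots> = (\<Sum>y\<in>Y. of_real (\<phi> y x) * (\<Sum>p\<in>set T. \<gamma> y k p * symb n p k))"
      unfolding sum_distrib_left by (rule sum.swap)
    also have "\<dots> = (\<Sum>y\<in>Y. of_real (\<phi> y x) * b k y)"
      using \<gamma>1[OF _ k] Y by (intro sum.cong) auto
    finally have "(\<Sum>p\<in>set T. symb n p k * \<beta> k p x) - b k x = (\<Sum>y\<in>Y. of_real (\<phi> y x) * b k y) - of_real (\<Sum>y\<in>Y. \<phi> y x) * b k x"
      using \<phi>1[OF x] by simp
    also have "\<dots> = (\<Sum>y\<in>Y. of_real (\<phi> y x) * (b k y - b k x))"
      by (simp add: sum_distrib_right right_diff_distrib sum_subtractf)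
    finally show "cmod ((\<Sum>p\<in>set T. symb n p k * \<beta> k p x) - b k x) \<le> \<epsilon>"
      using avg[OF x, of "\<lambda>y. b k y - b k x" \<epsilon>] \<phi>b[OF x _ _ k] by (simp add: norm_minus_commute)
  next
    fix p z x assume p: "p \<in> set T" and x: "x \<in> topspace K"
    have "(\<Sum>k\<in>F. z k * \<beta> k p x) = (\<Sum>k\<in>F. \<Sum>y\<in>Y. of_real (\<phi> y x) * (z k * \<gamma> y k p))"
      using x by (simp add: \<beta>_def sum_distrib_left mult_ac)
    also have "\<dots> = (\<Sum>y\<in>Y. of_real (\<phi> y x) * (\<Sum>k\<in>F. z k * \<gamma> y k p))"
      unfolding sum_distrib_left by (rule sum.swap)
    finally show "cmod (\<Sum>k\<in>F. z k * \<beta> k p x) \<le> C * torus_norm n (tsum n F z)"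
      using avg[OF x, of "\<lambda>y. \<Sum>k\<in>F. z k * \<gamma> y k p"] \<gamma>2[OF _ p] Y by auto
  qed
qed

section \<open>Duals and the multiplier matrix\<close>

definition fun_subspace :: "('b \<Rightarrow> complex) set \<Rightarrow> bool" where
  "fun_subspace S \<longleftrightarrow> (\<lambda>_. 0) \<in> S \<and> (\<forall>u\<in>S. \<forall>v\<in>S. (\<lambda>x. u x + v x) \<in> S) \<and> (\<forall>c. \<forall>u\<in>S. (\<lambda>x. c * u x) \<in> S)"

lemma fun_subspace_add: "fun_subspace S \<Longrightarrow> u \<in> S \<Longrightarrow> v \<in> S \<Longrightarrow> (\<lambda>x. u x + v x) \<in> S"
  by (simp add: fun_subspace_def)

lemma fun_subspace_scale: "fun_subspace S \<Longrightarrow> u \<in> S \<Longrightarrow> (\<lambda>x. c * u x) \<in> S"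
  by (simp add: fun_subspace_def)

lemma fun_subspace_sum:
  assumes "fun_subspace S" "finite F" "\<And>k. k \<in> F \<Longrightarrow> g k \<in> S"
  shows "(\<lambda>x. \<Sum>k\<in>F. c k * g k x) \<in> S"
  using assms(2,3)
proof (induction F)
  case empty
  then show ?case using assms(1) by (simp add: fun_subspace_def)
next
  case (insert k F)
  then have "(\<lambda>x. c k * g k x) \<in> S" "(\<lambda>x. \<Sum>k\<in>F. c k * g k x) \<in> S"
    using assms(1) by (simp_all add: fun_subspace_def)
  then show ?case using assms(1) insert(1,2) by (simp add: fun_subspace_def)
qed

lemma lin_op_mem: "lin_op S R h \<Longrightarrow> u \<in> S \<Longrightarrow> h u \<in> R"
  by (simp add: lin_op_def)

lemma lin_op_add: "lin_op S R h \<Longrightarrow> u \<in> S \<Longrightarrow> v \<in> S \<Longrightarrow> h (\<lambda>x. u x + v x) = (\<lambda>y. h u y + h v y)"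
  by (simp add: lin_op_def)

lemma lin_op_scale: "lin_op S R h \<Longrightarrow> u \<in> S \<Longrightarrow> h (\<lambda>x. c * u x) = (\<lambda>y. c * h u y)"
  by (simp add: lin_op_def)

lemma lin_op_zero:
  assumes "lin_op S R h" "fun_subspace S"
  shows "h (\<lambda>_. 0) = (\<lambda>_. 0)"
  using lin_op_scale[OF assms(1), of "\<lambda>_. 0" 0] assms(2) by (simp add: fun_subspace_def)

lemma lin_op_sum:
  assumes h: "lin_op S R h" and S: "fun_subspace S" and "finite F" "\<And>k. k \<in> F \<Longrightarrow> g k \<in> S"
  shows "h (\<lambda>x. \<Sum>k\<in>F. c k * g k x) = (\<lambda>y. \<Sum>k\<in>F. c k * h (g k) y)"
  using assms(3,4)
proof (induction F)
  case empty
  then show ?case using lin_op_zero[OF h S] by simp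
next
  case (insert k F)
  have g: "g k \<in> S" using insert by simp
  have 1: "(\<lambda>x. c k * g k x) \<in> S" using g S by (simp add: fun_subspace_def)
  have 2: "(\<lambda>x. \<Sum>k\<in>F. c k * g k x) \<in> S" using fun_subspace_sum[OF S insert(1)] insert(4) by simp
  have "h (\<lambda>x. \<Sum>k\<in>insert k F. c k * g k x) = h (\<lambda>x. c k * g k x + (\<Sum>k\<in>F. c k * g k x))"
    using insert(1,2) by simp
  also have "\<dots> = (\<lambda>y. h (\<lambda>x. c k * g k x) y + h (\<lambda>x. \<Sum>k\<in>F. c k * g k x) y)"
    by (rule lin_op_add[OF h 1 2])
  also have "h (\<lambda>x. c k * g k x) = (\<lambda>y. c k * h (g k) y)"
    by (rule lin_op_scale[OF h g])
  also have "h (\<lambda>x. \<Sum>k\<in>F. c k * g k x) = (\<lambda>y. \<Sum>k\<in>F. c k * h (g k) y)"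
    using insert by simp
  finally show ?case using insert(1,2) by simp
qed

lemma lin_functional_add: "lin_functional S \<Phi> \<Longrightarrow> u \<in> S \<Longrightarrow> v \<in> S \<Longrightarrow> \<Phi> (\<lambda>x. u x + v x) = \<Phi> u + \<Phi> v"
  by (simp add: lin_functional_def)

lemma lin_functional_scale: "lin_functional S \<Phi> \<Longrightarrow> u \<in> S \<Longrightarrow> \<Phi> (\<lambda>x. c * u x) = c * \<Phi> u"
  by (simp add: lin_functional_def)

lemma lin_functional_sum:
  assumes \<Phi>: "lin_functional S \<Phi>" and S: "fun_subspace S" and "finite F" "\<And>k. k \<in> F \<Longrightarrow> g k \<in> S"
  shows "\<Phi> (\<lambda>x. \<Sum>k\<in>F. c k * g k x) = (\<Sum>k\<in>F. c k * \<Phi> (g k))"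
proof -
  \<comment> \<open>A functional is an operator into functions on a one-point set, so the rule for
    operators applies.\<close>
  have "lin_op S UNIV (\<lambda>u (_::unit). \<Phi> u)"
    using \<Phi> by (simp add: lin_op_def lin_functional_def)
  then have "(\<lambda>_::unit. \<Phi> (\<lambda>x. \<Sum>k\<in>F. c k * g k x)) = (\<lambda>_. \<Sum>k\<in>F. c k * \<Phi> (g k))"
    by (rule lin_op_sum[OF _ S assms(3,4)])
  then show ?thesis by (rule fun_cong)
qed

lemma fun_subspace_dual_space: "fun_subspace (dual_space S N)"
  unfolding fun_subspace_def
proof (intro conjI ballI allI)
  show "(\<lambda>_. 0) \<in> dual_space S N"
    by (auto simp: dual_space_def lin_functional_def intro: exI[of _ 0])
next
  fix \<phi> \<psi> assume \<phi>: "\<phi> \<in> dual_space S N" and \<psi>: "\<psi> \<in> dual_space S N"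
  obtain C D where C: "\<And>u. u \<in> S \<Longrightarrow> cmod (\<phi> u) \<le> C * N u" and D: "\<And>u. u \<in> S \<Longrightarrow> cmod (\<psi> u) \<le> D * N u"
    using \<phi> \<psi> by (auto simp: dual_space_def)
  have "cmod (\<phi> u + \<psi> u) \<le> (C + D) * N u" if "u \<in> S" for u
    using C[OF that] D[OF that] norm_triangle_ineq[of "\<phi> u" "\<psi> u"] by (simp add: distrib_right)
  moreover have "lin_functional S (\<lambda>u. \<phi> u + \<psi> u)"
    using \<phi> \<psi> by (simp add: dual_space_def lin_functional_def distrib_left)
  ultimately show "(\<lambda>u. \<phi> u + \<psi> u) \<in> dual_space S N" unfolding dual_space_def by blast
next
  fix c \<phi> assume \<phi>: "\<phi> \<in> dual_space S N"
  obtain C where C: "\<And>u. u \<in> S \<Longrightarrow> cmod (\<phi> u) \<le> C * N u"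
    using \<phi> by (auto simp: dual_space_def)
  have "cmod (c * \<phi> u) \<le> (cmod c * C) * N u" if "u \<in> S" for u
    using C[OF that] by (simp add: norm_mult mult.assoc mult_left_mono)
  moreover have "lin_functional S (\<lambda>u. c * \<phi> u)"
    using \<phi> by (simp add: dual_space_def lin_functional_def distrib_left)
  ultimately show "(\<lambda>u. c * \<phi> u) \<in> dual_space S N" unfolding dual_space_def by blast
qed

section \<open>Dual norms and functionals on trigonometric polynomials\<close>

lemma le_dual_norm:
  assumes \<phi>: "\<phi> \<in> dual_space S N" and nonneg: "\<And>u. u \<in> S \<Longrightarrow> 0 \<le> N u" and u: "u \<in> S" "N u \<le> 1"
  shows "cmod (\<phi> u) \<le> dual_norm S N \<phi>"
proof -
  obtain C where C: "\<And>u. u \<in> S \<Longrightarrow> cmod (\<phi> u) \<le> C * N u"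
    using \<phi> by (auto simp: dual_space_def)
  have "cmod (\<phi> v) \<le> \<bar>C\<bar>" if v: "v \<in> S" "N v \<le> 1" for v
  proof -
    have "cmod (\<phi> v) \<le> C * N v" using C v by simp
    also have "\<dots> \<le> \<bar>C\<bar> * 1" using nonneg[OF v(1)] v(2) by (intro mult_mono) auto
    finally show ?thesis by simp
  qed
  then have "bdd_above {cmod (\<phi> u) | u. u \<in> S \<and> N u \<le> 1}" by (auto intro!: bdd_aboveI[of _ "\<bar>C\<bar>"])
  then show ?thesis unfolding dual_norm_def by (rule cSup_upper[rotated]) (use u in blast)
qed

lemma dual_norm_le:
  assumes "v \<in> S" "N v \<le> 1" "\<And>u. u \<in> S \<Longrightarrow> N u \<le> 1 \<Longrightarrow> cmod (\<phi> u) \<le> D"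
  shows "dual_norm S N \<phi> \<le> D"
  unfolding dual_norm_def by (rule cSup_least) (use assms in auto)

lemma fun_subspace_trig_polys: "fun_subspace (trig_polys n)"
proof -
  have "(\<lambda>_. 0) = tsum n {} (\<lambda>_. 0)" by (simp add: tsum_def)
  then have "(\<lambda>_. 0) \<in> trig_polys n" using tsum_in_trig_polys[of "{}" n] by simp
  then show ?thesis by (simp add: fun_subspace_def trig_polys_add trig_polys_scale)
qed

lemma zero_trig_poly: "(\<lambda>_. 0) \<in> trig_polys n"
  using fun_subspace_trig_polys by (simp add: fun_subspace_def)

lemma seminorm_T_zero: "T \<noteq> [] \<Longrightarrow> seminorm_T n T (\<lambda>_. 0) \<le> 1"
  using seminorm_T_scale[OF _ zero_trig_poly, of T n 0] by simp

lemma CT_dual_norm_nonneg: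
  assumes "T \<noteq> []" "\<phi> \<in> CT_dual n T"
  shows "0 \<le> CT_dual_norm n T \<phi>"
  unfolding CT_dual_norm_def
  by (rule order_trans[OF norm_ge_zero le_dual_norm[OF assms(2)[unfolded CT_dual_def] _ zero_trig_poly seminorm_T_zero[OF assms(1)]]])
     (rule seminorm_T_nonneg[OF assms(1)])

lemma CT_dual_bound:
  assumes "T \<noteq> []" "\<phi> \<in> CT_dual n T" "f \<in> trig_polys n"
  shows "cmod (\<phi> f) \<le> CT_dual_norm n T \<phi> * seminorm_T n T f"
proof -
  let ?N = "seminorm_T n T f"
  have N0: "0 \<le> ?N" by (rule seminorm_T_nonneg[OF assms(1,3)])
  show ?thesis
  proof (cases "?N = 0")
    \<comment> \<open>Normalising \<open>f\<close> is impossible on the null space of the seminorm;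
      there the boundedness of \<open>\<phi>\<close> with some constant already forces the value
      0.\<close>
    case True
    obtain C where "\<And>u. u \<in> trig_polys n \<Longrightarrow> cmod (\<phi> u) \<le> C * seminorm_T n T u"
      using assms(2) by (auto simp: CT_dual_def dual_space_def)
    from this[OF assms(3)] True show ?thesis by simp
  next
    case False
    then have pos: "?N > 0" using N0 by simp
    let ?u = "\<lambda>x. of_real (1 / ?N) * f x"
    have u: "?u \<in> trig_polys n" by (rule trig_polys_scale(1)[OF assms(3)])
    have "seminorm_T n T ?u \<le> cmod (of_real (1 / ?N)) * ?N"
      by (rule seminorm_T_scale[OF assms(1,3)])
    also have "\<dots> = 1" using pos by (simp add: norm_divide)
    finally have "cmod (\<phi> ?u) \<le> CT_dual_norm n T \<phi>"
      unfolding CT_dual_norm_def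
      by (intro le_dual_norm[OF assms(2)[unfolded CT_dual_def]] seminorm_T_nonneg[OF assms(1)] u)
    moreover have "\<phi> ?u = of_real (1 / ?N) * \<phi> f"
      using assms(2) by (intro lin_functional_scale[OF _ assms(3)]) (simp add: CT_dual_def dual_space_def)
    ultimately have "cmod (of_real (1 / ?N) * \<phi> f) \<le> CT_dual_norm n T \<phi>" by (simp only:)
    then have "(1 / ?N) * cmod (\<phi> f) \<le> CT_dual_norm n T \<phi>"
      using pos by (simp only: norm_mult norm_of_real abs_of_pos zero_less_divide_1_iff)
    then show ?thesis using pos by (simp add: field_simps)
  qed
qed

lemma CT_dualI:
  assumes "T \<noteq> []" "lin_functional (trig_polys n) \<phi>"
    "\<And>f. f \<in> trig_polys n \<Longrightarrow> cmod (\<phi> f) \<le> seminorm_T n T f"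
  shows "\<phi> \<in> CT_dual n T" "CT_dual_norm n T \<phi> \<le> 1"
proof -
  show "\<phi> \<in> CT_dual n T"
    unfolding CT_dual_def dual_space_def using assms(2,3) by (auto intro!: exI[of _ 1])
  show "CT_dual_norm n T \<phi> \<le> 1"
    unfolding CT_dual_norm_def
    by (rule dual_norm_le[where N = "seminorm_T n T", OF zero_trig_poly seminorm_T_zero[OF assms(1)]])
       (use assms(3) in \<open>auto intro: order_trans\<close>)
qed

lemma lin_functional_coeff_functional: "lin_functional (trig_polys n) (coeff_functional n p k)"
  by (simp add: lin_functional_def coeff_functional_def trig_polys_add trig_polys_scale distrib_left mult_ac)

lemma coeff_functional_CT_dual:
  assumes "p \<in> set T"
  shows "coeff_functional n p k \<in> CT_dual n T" "CT_dual_norm n T (coeff_functional n p k) \<le> 1"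
proof -
  have T: "T \<noteq> []" using assms by auto
  have b: "cmod (coeff_functional n p k f) \<le> seminorm_T n T f" if "f \<in> trig_polys n" for f
    using coeff_functional_bound[OF that] torus_norm_le_seminorm_T[OF assms] by (rule order_trans)
  show "coeff_functional n p k \<in> CT_dual n T" "CT_dual_norm n T (coeff_functional n p k) \<le> 1"
    using CT_dualI[OF T lin_functional_coeff_functional b] by auto
qed

lemma fun_subspace_CT_dual: "fun_subspace (CT_dual n T)"
  unfolding CT_dual_def by (rule fun_subspace_dual_space)

lemma fejer_functional_eq_pairs: "fejer_functional n p B s = (\<lambda>f. \<Sum>(m, l)\<in>B \<times> B.
    cnj (echar n (\<lambda>i. m i - l i) s) / of_nat (card B) * coeff_functional n p (\<lambda>i. m i - l i) f)"
  unfolding fejer_functional_def by (simp add: sum.cartesian_product)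

lemma fejer_functional_CT_dual:
  assumes p: "p \<in> set T" and B: "finite B" "B \<noteq> {}" "B \<subseteq> freqs n"
  shows "fejer_functional n p B s \<in> CT_dual n T" "CT_dual_norm n T (fejer_functional n p B s) \<le> 1"
proof -
  have T: "T \<noteq> []" using p by auto
  have fin: "finite (B \<times> B)" using B by simp
  have "(\<lambda>f. \<Sum>x\<in>B \<times> B. (case x of (m, l) \<Rightarrow> cnj (echar n (\<lambda>i. m i - l i) s) / of_nat (card B))
      * (case x of (m, l) \<Rightarrow> coeff_functional n p (\<lambda>i. m i - l i)) f) \<in> CT_dual n T"
    by (rule fun_subspace_sum[OF fun_subspace_CT_dual fin]) (auto intro: coeff_functional_CT_dual(1)[OF p])
  then show mem: "fejer_functional n p B s \<in> CT_dual n T"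
    unfolding fejer_functional_eq_pairs by (simp add: case_prod_unfold)
  have b: "cmod (fejer_functional n p B s f) \<le> seminorm_T n T f" if "f \<in> trig_polys n" for f
    using fejer_functional_bound[OF that B] torus_norm_le_seminorm_T[OF p] by (rule order_trans)
  have "lin_functional (trig_polys n) (fejer_functional n p B s)"
    using mem by (simp add: CT_dual_def dual_space_def)
  from CT_dualI(2)[OF T this b] show "CT_dual_norm n T (fejer_functional n p B s) \<le> 1" .
qed

section \<open>The canonical embedding into the bidual and factorization through
  \<open>C(K)\<close>\<close>

definition embed_bidual :: "nat \<Rightarrow> ((nat \<Rightarrow> nat) \<Rightarrow> complex) list \<Rightarrow> ((nat \<Rightarrow> real) \<Rightarrow> complex) \<Rightarrow>
    (((nat \<Rightarrow> real) \<Rightarrow> complex) \<Rightarrow> complex) \<Rightarrow> complex" where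
  "embed_bidual n T f = (\<lambda>\<phi>. if \<phi> \<in> CT_dual n T then \<phi> f else 0)"

lemma CT_dual_zero: "(\<lambda>_. 0) \<in> CT_dual n T"
  using fun_subspace_CT_dual by (simp add: fun_subspace_def)

lemma CT_dual_norm_zero: "T \<noteq> [] \<Longrightarrow> CT_dual_norm n T (\<lambda>_. 0) \<le> 1"
  unfolding CT_dual_norm_def
  by (rule dual_norm_le[where N = "seminorm_T n T", OF zero_trig_poly seminorm_T_zero]) auto

lemma embed_bidual:
  assumes "T \<noteq> []" "f \<in> trig_polys n"
  shows "embed_bidual n T f \<in> CT_bidual n T" "CT_bidual_norm n T (embed_bidual n T f) \<le> seminorm_T n T f"
proof -
  have b: "cmod (embed_bidual n T f \<phi>) \<le> seminorm_T n T f * CT_dual_norm n T \<phi>" if "\<phi> \<in> CT_dual n T" for \<phi>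
    using CT_dual_bound[OF assms(1) that assms(2)] that by (simp add: embed_bidual_def mult.commute)
  have "lin_functional (CT_dual n T) (embed_bidual n T f)"
    using fun_subspace_CT_dual[of n T] by (simp add: lin_functional_def embed_bidual_def fun_subspace_def)
  then show "embed_bidual n T f \<in> CT_bidual n T"
    unfolding CT_bidual_def dual_space_def using b by blast
  show "CT_bidual_norm n T (embed_bidual n T f) \<le> seminorm_T n T f"
    unfolding CT_bidual_norm_def
  proof (rule dual_norm_le[where N = "CT_dual_norm n T", OF CT_dual_zero CT_dual_norm_zero[OF assms(1)]])
    fix \<phi> assume \<phi>: "\<phi> \<in> CT_dual n T" "CT_dual_norm n T \<phi> \<le> 1"
    have "cmod (embed_bidual n T f \<phi>) \<le> seminorm_T n T f * CT_dual_norm n T \<phi>" by (rule b[OF \<phi>(1)])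
    also have "\<dots> \<le> seminorm_T n T f * 1"
      by (rule mult_left_mono[OF \<phi>(2) seminorm_T_nonneg[OF assms]])
    finally show "cmod (embed_bidual n T f \<phi>) \<le> seminorm_T n T f" by simp
  qed
qed

lemma lin_op_embed_bidual: "T \<noteq> [] \<Longrightarrow> lin_op (trig_polys n) (CT_bidual n T) (embed_bidual n T)"
  unfolding lin_op_def
proof (intro conjI ballI allI)
  fix u v assume uv: "u \<in> trig_polys n" "v \<in> trig_polys n"
  have "\<phi> (\<lambda>x. u x + v x) = \<phi> u + \<phi> v" if "\<phi> \<in> CT_dual n T" for \<phi>
    using that by (intro lin_functional_add[OF _ uv]) (simp add: CT_dual_def dual_space_def)
  then show "embed_bidual n T (\<lambda>x. u x + v x) = (\<lambda>y. embed_bidual n T u y + embed_bidual n T v y)"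
    by (auto simp: embed_bidual_def)
next
  fix c u assume u: "u \<in> trig_polys n"
  have "\<phi> (\<lambda>x. c * u x) = c * \<phi> u" if "\<phi> \<in> CT_dual n T" for \<phi>
    using that by (intro lin_functional_scale[OF _ u]) (simp add: CT_dual_def dual_space_def)
  then show "embed_bidual n T (\<lambda>x. c * u x) = (\<lambda>y. c * embed_bidual n T u y)"
    by (auto simp: embed_bidual_def)
qed (rule embed_bidual(1))

lemma le_CT_bidual_norm:
  assumes "T \<noteq> []" "\<Phi> \<in> CT_bidual n T" "\<phi> \<in> CT_dual n T" "CT_dual_norm n T \<phi> \<le> 1"
  shows "cmod (\<Phi> \<phi>) \<le> CT_bidual_norm n T \<Phi>"
  unfolding CT_bidual_norm_def
  by (rule le_dual_norm[where N = "CT_dual_norm n T", OF assms(2)[unfolded CT_bidual_def] _ assms(3,4)])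
     (rule CT_dual_norm_nonneg[OF assms(1)])

lemma fun_subspace_cont_fun: "fun_subspace (cont_fun K)"
  unfolding fun_subspace_def
proof (intro conjI ballI allI)
  show "(\<lambda>_. 0) \<in> cont_fun K" by (simp add: cont_fun_def)
next
  fix u v assume "u \<in> cont_fun K" "v \<in> cont_fun K"
  then show "(\<lambda>x. u x + v x) \<in> cont_fun K"
    by (auto simp: cont_fun_def intro: continuous_map_add)
next
  fix c u assume u: "u \<in> cont_fun K"
  then show "(\<lambda>x. c * u x) \<in> cont_fun K"
    by (auto simp: cont_fun_def continuous_map_atin intro!: tendsto_intros)
qed

lemma le_sup_norm:
  assumes "compact_space K" "g \<in> cont_fun K" "x \<in> topspace K"
  shows "cmod (g x) \<le> sup_norm K g"
proof -
  have "compactin euclidean (g ` topspace K)"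
    using assms by (intro image_compactin[of K]) (auto simp: cont_fun_def compact_space_def)
  then have "bounded (g ` topspace K)" by (simp add: compact_imp_bounded)
  then obtain D where "\<And>y. y \<in> topspace K \<Longrightarrow> cmod (g y) \<le> D" unfolding bounded_iff by auto
  then have "bdd_above {cmod (g x) | x. x \<in> topspace K}" by (auto intro!: bdd_aboveI[of _ D])
  then show ?thesis unfolding sup_norm_def by (rule cSup_upper[rotated]) (use assms in blast)
qed

lemma sup_norm_le:
  assumes "topspace K \<noteq> {}" "\<And>x. x \<in> topspace K \<Longrightarrow> cmod (g x) \<le> D"
  shows "sup_norm K g \<le> D"
  unfolding sup_norm_def by (rule cSup_least) (use assms in auto)

text \<open>Complementation is used only as a factorization of the identity of \<open>X\<close>
  through \<open>C(K)\<close>: \<open>A\<close> is the projection followed by the inverse of the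
  isomorphism, so \<open>A\<close> undoes \<open>J\<close> on \<open>X\<close>.\<close>

lemma iso_complemented_CK_factorization:
  assumes X: "fun_subspace X" and K: "compact_space K" "topspace K \<noteq> {}"
    and iso: "iso_complemented_CK X NX K" and NX: "\<forall>u\<in>X. 0 \<le> NX u"
  shows "\<exists>J A C D. lin_op X (cont_fun K) J \<and> lin_op (cont_fun K) X A \<and> (\<forall>u\<in>X. A (J u) = u) \<and>
    C \<ge> 0 \<and> (\<forall>u\<in>X. sup_norm K (J u) \<le> C * NX u) \<and>
    D \<ge> 0 \<and> (\<forall>g\<in>cont_fun K. NX (A g) \<le> D * sup_norm K g)"
proof -
  obtain Y Pr J where Pr: "lin_op (cont_fun K) (cont_fun K) Pr"
    and bPr: "bdd_op (cont_fun K) (sup_norm K) (sup_norm K) Pr"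
    and idem: "\<forall>g\<in>cont_fun K. Pr (Pr g) = Pr g" and Y: "Pr ` cont_fun K = Y"
    and J: "lin_op X Y J" and bij: "bij_betw J X Y" and bJ: "bdd_op X NX (sup_norm K) J"
    and bI: "bdd_op Y (sup_norm K) NX (the_inv_into X J)"
    using iso unfolding iso_complemented_CK_def by (elim exE conjE)
  have sup0: "0 \<le> sup_norm K g" if g: "g \<in> cont_fun K" for g
  proof -
    obtain x where "x \<in> topspace K" using K(2) by blast
    from order_trans[OF norm_ge_zero le_sup_norm[OF K(1) g this]] show ?thesis .
  qed
  have YK: "Y \<subseteq> cont_fun K" using Y lin_op_mem[OF Pr] by auto
  have inj: "inj_on J X" and img: "J ` X = Y" using bij by (auto simp: bij_betw_def)
  let ?I = "the_inv_into X J"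
  define A where "A g = ?I (Pr g)" for g
  have PY: "Pr g \<in> Y" if "g \<in> cont_fun K" for g using Y that by auto
  have IX: "?I y \<in> X" if "y \<in> Y" for y using the_inv_into_into[OF inj, of y X] that img by simp
  have JI: "J (?I y) = y" if "y \<in> Y" for y using f_the_inv_into_f[OF inj, of y] that img by simp
  have IJ: "?I (J u) = u" if "u \<in> X" for u by (rule the_inv_into_f_f[OF inj that])
  have Xadd: "(\<lambda>x. u x + v x) \<in> X" if "u \<in> X" "v \<in> X" for u v
    by (rule fun_subspace_add[OF X that])
  have Xscale: "(\<lambda>x. c * u x) \<in> X" if "u \<in> X" for u c
    by (rule fun_subspace_scale[OF X that])
  have linA: "lin_op (cont_fun K) X A"
    unfolding lin_op_def
  proof (intro conjI ballI allI)
    fix u v assume u: "u \<in> cont_fun K" and v: "v \<in> cont_fun K"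
    have "Pr (\<lambda>x. u x + v x) = (\<lambda>y. Pr u y + Pr v y)" by (rule lin_op_add[OF Pr u v])
    also have "\<dots> = (\<lambda>y. J (A u) y + J (A v) y)" unfolding A_def JI[OF PY[OF u]] JI[OF PY[OF v]] ..
    also have "\<dots> = J (\<lambda>x. A u x + A v x)"
      unfolding A_def by (rule lin_op_add[OF J IX[OF PY[OF u]] IX[OF PY[OF v]], symmetric])
    finally have "A (\<lambda>x. u x + v x) = ?I (J (\<lambda>x. A u x + A v x))" by (simp only: A_def)
    also have "\<dots> = (\<lambda>x. A u x + A v x)"
      by (rule IJ) (unfold A_def, rule Xadd[OF IX[OF PY[OF u]] IX[OF PY[OF v]]])
    finally show "A (\<lambda>x. u x + v x) = (\<lambda>x. A u x + A v x)" .
  next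
    fix c u assume u: "u \<in> cont_fun K"
    have "Pr (\<lambda>x. c * u x) = (\<lambda>y. c * Pr u y)" by (rule lin_op_scale[OF Pr u])
    also have "\<dots> = (\<lambda>y. c * J (A u) y)" unfolding A_def JI[OF PY[OF u]] ..
    also have "\<dots> = J (\<lambda>x. c * A u x)"
      unfolding A_def by (rule lin_op_scale[OF J IX[OF PY[OF u]], symmetric])
    finally have "A (\<lambda>x. c * u x) = ?I (J (\<lambda>x. c * A u x))" by (simp only: A_def)
    also have "\<dots> = (\<lambda>x. c * A u x)"
      by (rule IJ) (unfold A_def, rule Xscale[OF IX[OF PY[OF u]]])
    finally show "A (\<lambda>x. c * u x) = (\<lambda>x. c * A u x)" .
  next
    fix u assume "u \<in> cont_fun K"
    then show "A u \<in> X" unfolding A_def by (intro IX PY)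
  qed
  have linJ: "lin_op X (cont_fun K) J"
    unfolding lin_op_def
    using lin_op_add[OF J] lin_op_scale[OF J] lin_op_mem[OF J] YK by (simp add: subset_iff)
  have AJ: "A (J u) = u" if u: "u \<in> X" for u
  proof -
    have "J u \<in> Y" by (rule lin_op_mem[OF J u])
    then obtain g where g: "g \<in> cont_fun K" "J u = Pr g" using Y by auto
    have "Pr (J u) = J u" unfolding g(2) by (rule bspec[OF idem g(1)])
    then show ?thesis by (simp add: A_def IJ[OF u])
  qed
  obtain c1 where c1: "\<And>u. u \<in> X \<Longrightarrow> sup_norm K (J u) \<le> c1 * NX u" using bJ by (auto simp: bdd_op_def)
  obtain c2 where c2: "\<And>g. g \<in> cont_fun K \<Longrightarrow> sup_norm K (Pr g) \<le> c2 * sup_norm K g" using bPr by (auto simp: bdd_op_def)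
  obtain c3 where c3: "\<And>y. y \<in> Y \<Longrightarrow> NX (?I y) \<le> c3 * sup_norm K y" using bI by (auto simp: bdd_op_def)
  \<comment> \<open>The constants in \<open>bdd_op\<close> may be negative; as the norms are
    nonnegative, their absolute values serve as well.\<close>
  have J_le: "sup_norm K (J u) \<le> \<bar>c1\<bar> * NX u" if "u \<in> X" for u
    using c1[OF that] mult_right_mono[OF abs_ge_self[of c1] bspec[OF NX that]] by linarith
  have A_le: "NX (A g) \<le> (\<bar>c3\<bar> * \<bar>c2\<bar>) * sup_norm K g" if g: "g \<in> cont_fun K" for g
  proof -
    have Pg: "Pr g \<in> cont_fun K" by (rule lin_op_mem[OF Pr g])
    have "NX (A g) \<le> c3 * sup_norm K (Pr g)" unfolding A_def by (rule c3[OF PY[OF g]])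
    also have "\<dots> \<le> \<bar>c3\<bar> * sup_norm K (Pr g)" by (intro mult_right_mono sup0[OF Pg]) simp
    also have "\<dots> \<le> \<bar>c3\<bar> * (\<bar>c2\<bar> * sup_norm K g)"
      using c2[OF g] mult_right_mono[OF abs_ge_self[of c2] sup0[OF g]] by (intro mult_left_mono) auto
    finally show ?thesis by (simp add: mult.assoc)
  qed
  show ?thesis
    by (rule exI[of _ J], rule exI[of _ A], rule exI[of _ "\<bar>c1\<bar>"], rule exI[of _ "\<bar>c3\<bar> * \<bar>c2\<bar>"])
       (intro conjI ballI linJ linA AJ J_le A_le, auto)
qed

lemma CT_bidual_norm_nonneg:
  assumes "T \<noteq> []" "\<Phi> \<in> CT_bidual n T"
  shows "0 \<le> CT_bidual_norm n T \<Phi>"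
  by (rule order_trans[OF norm_ge_zero le_CT_bidual_norm[OF assms CT_dual_zero CT_dual_norm_zero[OF assms(1)]]])

lemma fun_subspace_CT_bidual: "fun_subspace (CT_bidual n T)"
  unfolding CT_bidual_def by (rule fun_subspace_dual_space)

text \<open>The symbols at frequency \<open>k\<close> form a vector, and \<open>P\<close> consists of rank one matrices that approximately
  project onto the line spanned by it, with entries acting boundedly as Fourier multipliers on \<open>F\<close>.\<close>
definition multiplier_matrix ::
  "nat \<Rightarrow> ((nat \<Rightarrow> nat) \<Rightarrow> complex) set \<Rightarrow> real \<Rightarrow> (nat \<Rightarrow> int) set \<Rightarrow> real \<Rightarrow>
   (((nat \<Rightarrow> nat) \<Rightarrow> complex) \<Rightarrow> ((nat \<Rightarrow> nat) \<Rightarrow> complex) \<Rightarrow> (nat \<Rightarrow> int) \<Rightarrow> complex) \<Rightarrow> bool" where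
  "multiplier_matrix n S C F \<eta> P \<longleftrightarrow>
    (\<forall>k\<in>F. \<forall>p\<in>S. \<forall>p'\<in>S. \<forall>p''\<in>S. symb n p'' k * P p p' k = symb n p k * P p'' p' k) \<and>
    (\<forall>k\<in>F. \<forall>p\<in>S. cmod ((\<Sum>p'\<in>S. symb n p' k * P p p' k) - symb n p k) \<le> \<eta>) \<and>
    (\<forall>p\<in>S. \<forall>p'\<in>S. \<forall>x. cmod (\<Sum>k\<in>F. x k * P p p' k) \<le> C * torus_norm n (tsum n F x))"

text \<open>\<open>A (\<beta> k p')\<close> stands for the image of the tuple with the
  \<open>k\<close>-th character in component \<open>p'\<close> and 0 elsewhere, and
  \<open>P p p' k\<close> is its \<open>k\<close>-th coefficient under the operator
  \<open>p\<close>. The constant is the product of the norm bounds for \<open>A\<close> and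
  \<open>J\<close>, hence independent of \<open>F\<close> and \<open>\<eta>\<close>.\<close>

lemma multiplier_matrix_exists:
  assumes T: "T \<noteq> []" and K: "compact_space K" "topspace K \<noteq> {}"
    and iso: "iso_complemented_CK (CT_bidual n T) (CT_bidual_norm n T) K"
  shows "\<exists>C\<ge>0. \<forall>F \<eta>. finite F \<longrightarrow> F \<subseteq> freqs n \<longrightarrow> \<eta> > 0 \<longrightarrow> (\<exists>P. multiplier_matrix n (set T) C F \<eta> P)"
proof -
  have "\<forall>\<Phi>\<in>CT_bidual n T. 0 \<le> CT_bidual_norm n T \<Phi>" using CT_bidual_norm_nonneg[OF T] by (rule ballI)
  from iso_complemented_CK_factorization[OF fun_subspace_CT_bidual K iso this]
  obtain J A C1 C2 where J: "lin_op (CT_bidual n T) (cont_fun K) J" and A: "lin_op (cont_fun K) (CT_bidual n T) A"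
    and AJ: "\<forall>u\<in>CT_bidual n T. A (J u) = u"
    and C1: "C1 \<ge> 0" "\<forall>u\<in>CT_bidual n T. sup_norm K (J u) \<le> C1 * CT_bidual_norm n T u"
    and C2: "C2 \<ge> 0" "\<forall>g\<in>cont_fun K. CT_bidual_norm n T (A g) \<le> C2 * sup_norm K g"
    by (elim exE conjE)
  define C where "C = C2 * C1"
  have C0: "C \<ge> 0" using C1 C2 by (simp add: C_def)
  have A_eval: "cmod (A g \<phi>) \<le> C2 * D"
    if g: "g \<in> cont_fun K" and D: "\<And>x. x \<in> topspace K \<Longrightarrow> cmod (g x) \<le> D"
      and \<phi>: "\<phi> \<in> CT_dual n T" "CT_dual_norm n T \<phi> \<le> 1" for g \<phi> D
  proof -
    have "cmod (A g \<phi>) \<le> CT_bidual_norm n T (A g)"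
      by (rule le_CT_bidual_norm[OF T lin_op_mem[OF A g] \<phi>])
    also have "\<dots> \<le> C2 * sup_norm K g" by (rule bspec[OF C2(2) g])
    also have "\<dots> \<le> C2 * D" by (intro mult_left_mono C2(1) sup_norm_le K(2) D)
    finally show ?thesis .
  qed
  define L where "L f = J (embed_bidual n T f)" for f
  have L_mem: "L f \<in> cont_fun K" if "f \<in> trig_polys n" for f
    unfolding L_def by (rule lin_op_mem[OF J embed_bidual(1)[OF T that]])
  have linL: "lin_op (trig_polys n) (cont_fun K) L"
    unfolding lin_op_def
  proof (intro conjI ballI allI)
    fix u v assume u: "u \<in> trig_polys n" and v: "v \<in> trig_polys n"
    show "L (\<lambda>x. u x + v x) = (\<lambda>y. L u y + L v y)"
      unfolding L_def lin_op_add[OF lin_op_embed_bidual[OF T] u v]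
      by (rule lin_op_add[OF J embed_bidual(1)[OF T u] embed_bidual(1)[OF T v]])
  next
    fix c u assume u: "u \<in> trig_polys n"
    show "L (\<lambda>x. c * u x) = (\<lambda>y. c * L u y)"
      unfolding L_def lin_op_scale[OF lin_op_embed_bidual[OF T] u]
      by (rule lin_op_scale[OF J embed_bidual(1)[OF T u]])
  qed (rule L_mem)
  have L_le: "cmod (L f y) \<le> C1 * seminorm_T n T f" if f: "f \<in> trig_polys n" and y: "y \<in> topspace K" for f y
  proof -
    have "cmod (L f y) \<le> sup_norm K (L f)" by (rule le_sup_norm[OF K(1) L_mem[OF f] y])
    also have "\<dots> \<le> C1 * CT_bidual_norm n T (embed_bidual n T f)"
      unfolding L_def by (rule bspec[OF C1(2) embed_bidual(1)[OF T f]])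
    also have "\<dots> \<le> C1 * seminorm_T n T f" by (rule mult_left_mono[OF embed_bidual(2)[OF T f] C1(1)])
    finally show ?thesis .
  qed
  have "\<exists>P. multiplier_matrix n (set T) C F \<eta> P" if F: "finite F" "F \<subseteq> freqs n" and \<eta>: "\<eta> > 0" for F \<eta>
  proof -
    define b where "b k = L (echar n k)" for k
    have ek: "echar n k \<in> trig_polys n" if "k \<in> F" for k
    proof -
      have "echar n k = tsum n {k} (\<lambda>_. 1)" by (simp add: tsum_def)
      then show ?thesis using tsum_in_trig_polys[of "{k}" n] F(2) that by auto
    qed
    have b_mem: "b k \<in> cont_fun K" if "k \<in> F" for k unfolding b_def by (rule L_mem[OF ek[OF that]])
    have b_bound: "cmod (\<Sum>k\<in>F. a k * b k y) \<le> C1 * seminorm_T n T (tsum n F a)" if y: "y \<in> topspace K" for a y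
    proof -
      have "L (tsum n F a) = (\<lambda>y. \<Sum>k\<in>F. a k * b k y)"
        unfolding b_def tsum_def by (rule lin_op_sum[OF linL fun_subspace_trig_polys F(1) ek])
      then show ?thesis using L_le[OF tsum_in_trig_polys[OF F] y, of a] by simp
    qed
    \<comment> \<open>The error \<open>\<epsilon>\<close> is multiplied by \<open>C2\<close> when
      \<open>A\<close> is applied; adding 1 keeps the quotient defined if
      \<open>C2 = 0\<close>.\<close>
    define \<epsilon> where "\<epsilon> = \<eta> / (C2 + 1)"
    have \<epsilon>: "\<epsilon> > 0" using \<eta> C2(1) by (simp add: \<epsilon>_def)
    have C2\<epsilon>: "C2 * \<epsilon> \<le> \<eta>" using \<eta> C2(1) by (simp add: \<epsilon>_def divide_le_eq mult_ac mult_left_mono)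
    have "\<exists>\<beta>. (\<forall>k p. \<beta> k p \<in> cont_fun K) \<and>
     (\<forall>k\<in>F. \<forall>x\<in>topspace K. cmod ((\<Sum>p\<in>set T. symb n p k * \<beta> k p x) - b k x) \<le> \<epsilon>) \<and>
     (\<forall>p\<in>set T. \<forall>z. \<forall>x\<in>topspace K. cmod (\<Sum>k\<in>F. z k * \<beta> k p x) \<le> C1 * torus_norm n (tsum n F z))"
      by (rule continuous_extension[OF K(1) T F(1) C1(1) \<epsilon>]) (erule b_mem, erule b_bound)
    then obtain \<beta> where \<beta>: "(\<forall>k p. \<beta> k p \<in> cont_fun K) \<and>
     (\<forall>k\<in>F. \<forall>x\<in>topspace K. cmod ((\<Sum>p\<in>set T. symb n p k * \<beta> k p x) - b k x) \<le> \<epsilon>) \<and>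
     (\<forall>p\<in>set T. \<forall>z. \<forall>x\<in>topspace K. cmod (\<Sum>k\<in>F. z k * \<beta> k p x) \<le> C1 * torus_norm n (tsum n F z))"
      by (elim exE)
    have \<beta>_mem: "\<beta> k p \<in> cont_fun K" for k p using \<beta> by simp
    have \<beta>_approx: "cmod ((\<Sum>p\<in>set T. symb n p k * \<beta> k p x) - b k x) \<le> \<epsilon>" if "k \<in> F" "x \<in> topspace K" for k x
      using \<beta> that by simp
    have \<beta>_bound: "cmod (\<Sum>k\<in>F. z k * \<beta> k p x) \<le> C1 * torus_norm n (tsum n F z)"
      if "p \<in> set T" "x \<in> topspace K" for p z x
      using \<beta> that by simp
    have A_lin: "lin_functional (CT_dual n T) (A (\<beta> k p))" for k p
      using lin_op_mem[OF A \<beta>_mem[of k p]] by (simp add: CT_bidual_def dual_space_def)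
    define P where "P p p' k = A (\<beta> k p') (coeff_functional n p k)" for p p' k
    have P1: "symb n p'' k * P p p' k = symb n p k * P p'' p' k" if "p \<in> set T" "p'' \<in> set T" for k p p' p''
    proof -
      \<comment> \<open>For fixed \<open>k\<close>, all coefficient functionals are multiples of the
        single functional \<open>tcoef n f k\<close>, with the symbols as factors. This is the
        source of rank one.\<close>
      have "(\<lambda>f. symb n p'' k * coeff_functional n p k f) = (\<lambda>f. symb n p k * coeff_functional n p'' k f)"
        by (simp add: coeff_functional_def fun_eq_iff)
      then have "A (\<beta> k p') (\<lambda>f. symb n p'' k * coeff_functional n p k f) = A (\<beta> k p') (\<lambda>f. symb n p k * coeff_functional n p'' k f)"
        by simp
      then show ?thesis
        unfolding P_def lin_functional_scale[OF A_lin coeff_functional_CT_dual(1)[OF that(1)]]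
          lin_functional_scale[OF A_lin coeff_functional_CT_dual(1)[OF that(2)]] .
    qed
    have P2: "cmod ((\<Sum>p'\<in>set T. symb n p' k * P p p' k) - symb n p k) \<le> \<eta>" if k: "k \<in> F" and p: "p \<in> set T" for k p
    proof -
      let ?s = "\<lambda>x. \<Sum>p'\<in>set T. symb n p' k * \<beta> k p' x"
      let ?m = "\<lambda>x. - 1 * b k x"
      have s: "?s \<in> cont_fun K" by (rule fun_subspace_sum[OF fun_subspace_cont_fun]) (simp_all add: \<beta>_mem)
      have m: "?m \<in> cont_fun K" by (rule fun_subspace_scale[OF fun_subspace_cont_fun b_mem[OF k]])
      have sm: "(\<lambda>x. ?s x + ?m x) \<in> cont_fun K"
        by (rule fun_subspace_add[OF fun_subspace_cont_fun s m])
      have "A ?s = (\<lambda>y. \<Sum>p'\<in>set T. symb n p' k * A (\<beta> k p') y)"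
        by (rule lin_op_sum[OF A fun_subspace_cont_fun]) (simp_all add: \<beta>_mem)
      moreover have "A ?m = (\<lambda>y. - 1 * A (b k) y)" by (rule lin_op_scale[OF A b_mem[OF k]])
      \<comment> \<open>Since \<open>A\<close> undoes \<open>J\<close>, the function
        \<open>b k\<close> returns the character itself, whose \<open>k\<close>-th coefficient under
        \<open>p\<close> is the symbol.\<close>
      moreover have "A (b k) = embed_bidual n T (echar n k)"
        unfolding b_def L_def by (rule bspec[OF AJ embed_bidual(1)[OF T ek[OF k]]])
      moreover have "embed_bidual n T (echar n k) (coeff_functional n p k) = symb n p k"
      proof -
        have "tcoef n (echar n k) k = 1"
          using tcoef_tsum[of "{k}" n "\<lambda>_. 1" k] F(2) k by (auto simp: tsum_def)
        then show ?thesis using coeff_functional_CT_dual(1)[OF p] ek[OF k] by (simp add: embed_bidual_def coeff_functional_def)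
      qed
      ultimately have "A (\<lambda>x. ?s x + ?m x) (coeff_functional n p k) = (\<Sum>p'\<in>set T. symb n p' k * P p p' k) - symb n p k"
        unfolding lin_op_add[OF A s m] by (simp add: P_def)
      moreover have "cmod (A (\<lambda>x. ?s x + ?m x) (coeff_functional n p k)) \<le> C2 * \<epsilon>"
        by (rule A_eval[OF sm _ coeff_functional_CT_dual[OF p]]) (use \<beta>_approx[OF k] in simp)
      ultimately show ?thesis using C2\<epsilon> by simp
    qed
    have P3: "cmod (\<Sum>k\<in>F. x k * P p p' k) \<le> C * torus_norm n (tsum n F x)"
      if p: "p \<in> set T" and p': "p' \<in> set T" for p p' x
      unfolding P_def
    \<comment> \<open>\<open>Q\<close> also records the unwanted coefficients at
      \<open>m \<noteq> k\<close>. The averaging lemma needs a bound for their Fejer combinations,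
      which holds because Fejer functionals lie in the unit ball of the dual.\<close>
    proof (rule multiplier_bound[OF F C0, where Q = "\<lambda>k m. A (\<beta> k p') (coeff_functional n p m)"])
      fix z :: "(nat \<Rightarrow> int) \<Rightarrow> complex" and B s
      assume B: "finite B" "B \<noteq> {}" "B \<subseteq> freqs n"
      have fin: "finite (B \<times> B)" using B by simp
      let ?c = "\<lambda>x. case x of (m, l) \<Rightarrow> cnj (echar n (\<lambda>i. m i - l i) s) / of_nat (card B)"
      let ?g = "\<lambda>x. case x of (m, l) \<Rightarrow> coeff_functional n p (\<lambda>i. m i - l i)"
      have fej: "fejer_functional n p B s = (\<lambda>f. \<Sum>x\<in>B \<times> B. ?c x * ?g x f)"
        unfolding fejer_functional_eq_pairs by (simp add: case_prod_unfold)
      have inner: "A (\<beta> k p') (fejer_functional n p B s)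
          = (\<Sum>m\<in>B. \<Sum>l\<in>B. cnj (echar n (\<lambda>i. m i - l i) s) / of_nat (card B) * A (\<beta> k p') (coeff_functional n p (\<lambda>i. m i - l i)))" for k
      proof -
        have "A (\<beta> k p') (fejer_functional n p B s) = (\<Sum>x\<in>B \<times> B. ?c x * A (\<beta> k p') (?g x))"
          unfolding fej by (rule lin_functional_sum[OF A_lin fun_subspace_CT_dual fin]) (auto intro: coeff_functional_CT_dual(1)[OF p])
        also have "\<dots> = (\<Sum>m\<in>B. \<Sum>l\<in>B. cnj (echar n (\<lambda>i. m i - l i) s) / of_nat (card B) * A (\<beta> k p') (coeff_functional n p (\<lambda>i. m i - l i)))"
          by (simp add: sum.cartesian_product case_prod_unfold)
        finally show ?thesis .
      qed
      let ?h = "\<lambda>x. \<Sum>k\<in>F. z k * \<beta> k p' x"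
      have h: "?h \<in> cont_fun K" by (rule fun_subspace_sum[OF fun_subspace_cont_fun F(1)]) (rule \<beta>_mem)
      have "A ?h = (\<lambda>y. \<Sum>k\<in>F. z k * A (\<beta> k p') y)"
        by (rule lin_op_sum[OF A fun_subspace_cont_fun F(1)]) (rule \<beta>_mem)
      then have "A ?h (fejer_functional n p B s) = (\<Sum>k\<in>F. z k * (\<Sum>m\<in>B. \<Sum>l\<in>B.
          cnj (echar n (\<lambda>i. m i - l i) s) / of_nat (card B) * A (\<beta> k p') (coeff_functional n p (\<lambda>i. m i - l i))))"
        by (simp only: inner)
      moreover have "cmod (A ?h (fejer_functional n p B s)) \<le> C2 * (C1 * torus_norm n (tsum n F z))"
        by (rule A_eval[OF h _ fejer_functional_CT_dual[OF p B]]) (rule \<beta>_bound[OF p'])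
      ultimately show "cmod (\<Sum>k\<in>F. z k * (\<Sum>m\<in>B. \<Sum>l\<in>B.
          cnj (echar n (\<lambda>i. m i - l i) s) / of_nat (card B) * A (\<beta> k p') (coeff_functional n p (\<lambda>i. m i - l i))))
        \<le> C * torus_norm n (tsum n F z)"
        by (simp only: C_def mult.assoc)
    qed
    show ?thesis
      unfolding multiplier_matrix_def
      by (intro exI[of _ P] conjI ballI allI P1 P2 P3)
  qed
  with C0 show ?thesis by blast
qed

section \<open>Senior parts and dilations\<close>

lemma finite_positive_lower_bound:
  assumes "finite E" "\<And>x. x \<in> E \<Longrightarrow> x > (0::real)"
  obtains \<delta> where "\<delta> > 0" "\<And>x. x \<in> E \<Longrightarrow> \<delta> \<le> x"
  using assms by (intro that[of "Min (insert 1 E)"]) auto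

text \<open>Simultaneous Diophantine approximation of the numbers \<open>1 / a i\<close> makes the homogeneity pattern
  integral without changing the senior parts.\<close>
lemma integer_weights:
  fixes a :: "nat \<Rightarrow> real" and \<A> :: "(nat \<Rightarrow> nat) set"
  assumes a: "\<And>i. i < n \<Longrightarrow> a i > 0" and "finite \<A>"
    and le: "\<And>\<alpha>. \<alpha> \<in> \<A> \<Longrightarrow> (\<Sum>i<n. real (\<alpha> i) / a i) \<le> 1"
  shows "\<exists>w q. (\<forall>i<n. w i > (0::nat)) \<and> (\<forall>\<alpha>\<in>\<A>. (\<Sum>i<n. w i * \<alpha> i) \<le> q \<and>
     ((\<Sum>i<n. w i * \<alpha> i) = q \<longleftrightarrow> (\<Sum>i<n. real (\<alpha> i) / a i) = 1))"
proof -
  define s where "s \<alpha> = (\<Sum>i<n. real (\<alpha> i) / a i)" for \<alpha>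
  define m where "m \<alpha> = (\<Sum>i<n. real (\<alpha> i))" for \<alpha> :: "nat \<Rightarrow> nat"
  have m0: "m \<alpha> \<ge> 0" for \<alpha> by (simp add: m_def sum_nonneg)
  have m1: "m \<alpha> + 1 > 0" for \<alpha> using m0[of \<alpha>] by linarith
  \<comment> \<open>Three kinds of thresholds for the approximation error: below
    \<open>1 / a i\<close> the integers \<open>p i\<close> are positive; below
    \<open>1 / (m \<alpha> + 1)\<close> the weight of a senior multiindex is within less than 1 of
    \<open>q\<close> and so equals it; below \<open>(1 - s \<alpha>) / (m \<alpha> + 1)\<close> the
    other weights stay strictly under \<open>q\<close>. Writing \<open>m \<alpha> + 1\<close> makes
    the estimates strict and the denominators nonzero.\<close>
  define E where "E = (\<lambda>i. 1 / a i) ` {..<n} \<union> (\<lambda>\<alpha>. 1 / (m \<alpha> + 1)) ` \<A>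
      \<union> (\<lambda>\<alpha>. (1 - s \<alpha>) / (m \<alpha> + 1)) ` {\<alpha>\<in>\<A>. s \<alpha> < 1}"
  have "finite E" using \<open>finite \<A>\<close> by (simp add: E_def)
  moreover have "x > 0" if "x \<in> E" for x
    using that a m1 by (auto simp: E_def)
  ultimately obtain \<delta> where \<delta>: "\<delta> > 0" "\<And>x. x \<in> E \<Longrightarrow> \<delta> \<le> x"
    by (rule finite_positive_lower_bound) auto
  obtain N0 where N0: "inverse (real (Suc N0)) < \<delta>" using reals_Archimedean[OF \<delta>(1)] by blast
  obtain q p where q: "0 < q" and p: "\<And>i. i < n \<Longrightarrow> \<bar>of_int q * (1 / a i) - of_int (p i)\<bar> < 1 / real (Suc N0)"
    using Dirichlet_approx_simult[of "Suc N0" n "\<lambda>i. 1 / a i"] by (metis zero_less_Suc)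
  have p\<delta>: "\<bar>of_int q * (1 / a i) - of_int (p i)\<bar> < \<delta>" if "i < n" for i
    using p[OF that] N0 by (simp add: inverse_eq_divide)
  have q1: "(1::real) \<le> of_int q" using q by simp
  have ppos: "p i > 0" if i: "i < n" for i
  proof -
    have "\<delta> \<le> 1 / a i" using i by (intro \<delta>(2)) (auto simp: E_def)
    also have "\<dots> \<le> of_int q * (1 / a i)" using q1 a[OF i] by (simp add: divide_right_mono)
    finally have "0 < real_of_int (p i)" using p\<delta>[OF i] by linarith
    then show ?thesis by simp
  qed
  have close: "\<bar>of_int q * s \<alpha> - (\<Sum>i<n. of_int (p i) * real (\<alpha> i))\<bar> \<le> \<delta> * m \<alpha>" for \<alpha>
  proof -
    have "of_int q * s \<alpha> - (\<Sum>i<n. of_int (p i) * real (\<alpha> i))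
        = (\<Sum>i<n. (of_int q * (1 / a i) - of_int (p i)) * real (\<alpha> i))"
      by (simp add: s_def sum_distrib_left left_diff_distrib sum_subtractf)
    also have "\<bar>\<dots>\<bar> \<le> (\<Sum>i<n. \<delta> * real (\<alpha> i))"
    proof (intro order_trans[OF sum_abs] sum_mono)
      fix i assume "i \<in> {..<n}"
      then have "\<bar>of_int q * (1 / a i) - of_int (p i)\<bar> \<le> \<delta>" using p\<delta>[of i] by simp
      then show "\<bar>(of_int q * (1 / a i) - of_int (p i)) * real (\<alpha> i)\<bar> \<le> \<delta> * real (\<alpha> i)"
        unfolding abs_mult by (intro mult_mono) auto
    qed
    also have "\<dots> = \<delta> * m \<alpha>" by (simp add: m_def sum_distrib_left)
    finally show ?thesis .
  qed
  define w where "w i = nat (p i)" for i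
  have sum_w: "real (\<Sum>i<n. w i * \<alpha> i) = (\<Sum>i<n. of_int (p i) * real (\<alpha> i))" for \<alpha>
    using ppos by (auto simp: w_def less_imp_le intro!: sum.cong)
  have "(\<Sum>i<n. w i * \<alpha> i) \<le> nat q \<and> ((\<Sum>i<n. w i * \<alpha> i) = nat q \<longleftrightarrow> s \<alpha> = 1)" if \<alpha>: "\<alpha> \<in> \<A>" for \<alpha>
  proof (cases "s \<alpha> = 1")
    case True
    have "\<delta> * (m \<alpha> + 1) \<le> 1"
      using \<delta>(2)[of "1 / (m \<alpha> + 1)"] \<alpha> m1[of \<alpha>] by (simp add: E_def pos_le_divide_eq)
    then have "\<delta> * m \<alpha> < 1" using \<delta>(1) by (simp add: distrib_left)
    then have "\<bar>of_int q - real (\<Sum>i<n. w i * \<alpha> i)\<bar> < 1"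
      using close[of \<alpha>] True unfolding sum_w by simp
    then have "\<bar>q - int (\<Sum>i<n. w i * \<alpha> i)\<bar> < 1" by linarith
    then have "q = int (\<Sum>i<n. w i * \<alpha> i)" by linarith
    then have "nat q = (\<Sum>i<n. w i * \<alpha> i)" by (simp only: nat_int)
    then show ?thesis using True by simp
  next
    case False
    then have s1: "s \<alpha> < 1" using le[OF \<alpha>] by (simp add: s_def)
    have "\<delta> * (m \<alpha> + 1) \<le> 1 - s \<alpha>"
      using \<delta>(2)[of "(1 - s \<alpha>) / (m \<alpha> + 1)"] \<alpha> s1 m1[of \<alpha>] by (simp add: E_def pos_le_divide_eq)
    then have "\<delta> * m \<alpha> < 1 - s \<alpha>" using \<delta>(1) by (simp add: distrib_left)
    also have "\<dots> \<le> of_int q * (1 - s \<alpha>)" using q1 s1 by simp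
    finally have "real (\<Sum>i<n. w i * \<alpha> i) < of_int q"
      using close[of \<alpha>] unfolding sum_w by (simp add: right_diff_distrib abs_le_iff)
    then have "int (\<Sum>i<n. w i * \<alpha> i) < q" by linarith
    then show ?thesis using False by linarith
  qed
  moreover have "\<forall>i<n. w i > 0" using ppos by (simp add: w_def)
  ultimately show ?thesis unfolding s_def by blast
qed

section \<open>Symbols under anisotropic dilations and recovery of an operator from its
  symbol\<close>

lemma symb_superset:
  assumes "finite \<A>" "{\<alpha>. p \<alpha> \<noteq> 0} \<subseteq> \<A>"
  shows "symb n p k = (\<Sum>\<alpha>\<in>\<A>. p \<alpha> * (\<Prod>j<n. (2 * of_real pi * \<i> * of_int (k j)) ^ \<alpha> j))"
  unfolding symb_def using assms by (intro sum.mono_neutral_left) auto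

text \<open>Taking \<open>N ^ w j\<close> out of each coordinate gives the monomial
  \<open>\<alpha>\<close> the factor \<open>N\<close> to its weight; after division by
  \<open>N ^ q\<close> only weight \<open>q\<close> survives, that is, the senior part. The fixed
  shift contributes \<open>m j / N ^ w j\<close>, which vanishes because the weights are
  positive.\<close>

lemma symb_dilation_limit:
  fixes w :: "nat \<Rightarrow> nat" and k m :: "nat \<Rightarrow> int"
  assumes p: "diff_op n p" and w: "\<And>i. i < n \<Longrightarrow> w i > 0"
    and q: "\<And>\<alpha>. p \<alpha> \<noteq> 0 \<Longrightarrow> (\<Sum>i<n. w i * \<alpha> i) \<le> q"
      "\<And>\<alpha>. p \<alpha> \<noteq> 0 \<Longrightarrow> (\<Sum>i<n. w i * \<alpha> i) = q \<longleftrightarrow> (\<Sum>i<n. real (\<alpha> i) / a i) = 1"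
  shows "(\<lambda>N. symb n p (\<lambda>i. m i + int N ^ w i * k i) / of_nat N ^ q) \<longlonglongrightarrow> symb n (senior n a p) k"
proof -
  let ?c = "2 * complex_of_real pi * \<i>"
  define e where "e \<alpha> = (\<Sum>i<n. w i * \<alpha> i)" for \<alpha> :: "nat \<Rightarrow> nat"
  have fin: "finite {\<alpha>. p \<alpha> \<noteq> 0}" using p by (simp add: diff_op_def)
  have inv: "(\<lambda>N. 1 / complex_of_nat N ^ d) \<longlonglongrightarrow> 0" if "d > 0" for d
    using tendsto_power[OF lim_inverse_n[where 'a = complex], of d] that
    by (simp add: power_inverse inverse_eq_divide power_one_over zero_power)
  define X where "X N \<alpha> = (\<Prod>j<n. (?c * (of_int (m j) * (1 / of_nat N ^ w j) + of_int (k j))) ^ \<alpha> j)" for N \<alpha>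
  have X: "(\<lambda>N. X N \<alpha>) \<longlonglongrightarrow> (\<Prod>j<n. (?c * (of_int (m j) * 0 + of_int (k j))) ^ \<alpha> j)" for \<alpha>
    unfolding X_def using w by (intro tendsto_intros inv) auto
  define R where "R N \<alpha> = complex_of_nat N ^ e \<alpha> / of_nat N ^ q" for N \<alpha>
  have R: "(\<lambda>N. R N \<alpha>) \<longlonglongrightarrow> (if e \<alpha> = q then 1 else 0)" if \<alpha>: "p \<alpha> \<noteq> 0" for \<alpha>
  proof (cases "e \<alpha> = q")
    case True
    have "eventually (\<lambda>N. R N \<alpha> = 1) sequentially"
      using eventually_gt_at_top[of "0::nat"] by eventually_elim (simp add: R_def True)
    then show ?thesis using True by (simp add: tendsto_eventually)
  next
    case False
    then have d: "q - e \<alpha> > 0" using q(1)[OF \<alpha>] by (simp add: e_def)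
    have "eventually (\<lambda>N. R N \<alpha> = 1 / of_nat N ^ (q - e \<alpha>)) sequentially"
      using eventually_gt_at_top[of "0::nat"]
      by eventually_elim (use q(1)[OF \<alpha>] in \<open>simp add: R_def e_def power_diff\<close>)
    then show ?thesis using False inv[OF d] by (simp add: tendsto_cong)
  qed
  have "eventually (\<lambda>N. symb n p (\<lambda>i. m i + int N ^ w i * k i) / of_nat N ^ q = (\<Sum>\<alpha>\<in>{\<alpha>. p \<alpha> \<noteq> 0}. p \<alpha> * (X N \<alpha> * R N \<alpha>))) sequentially"
    using eventually_gt_at_top[of "0::nat"]
  proof eventually_elim
    case (elim N)
    have "(\<Prod>j<n. (?c * of_int (m j + int N ^ w j * k j)) ^ \<alpha> j) / of_nat N ^ q = X N \<alpha> * R N \<alpha>" for \<alpha>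
    proof -
      have "?c * of_int (m j + int N ^ w j * k j)
          = of_nat N ^ w j * (?c * (of_int (m j) * (1 / of_nat N ^ w j) + of_int (k j)))" for j
        using elim by (simp add: field_simps)
      then have "(\<Prod>j<n. (?c * of_int (m j + int N ^ w j * k j)) ^ \<alpha> j)
          = (\<Prod>j<n. (of_nat N ^ w j) ^ \<alpha> j) * X N \<alpha>"
        by (simp only: X_def power_mult_distrib prod.distrib)
      also have "(\<Prod>j<n. (complex_of_nat N ^ w j) ^ \<alpha> j) = of_nat N ^ e \<alpha>"
        by (simp only: e_def power_sum power_mult)
      finally show ?thesis by (simp add: R_def)
    qed
    then show ?case
      unfolding symb_def sum_divide_distrib times_divide_eq_right[symmetric] by simp
  qed
  moreover have "(\<lambda>N. \<Sum>\<alpha>\<in>{\<alpha>. p \<alpha> \<noteq> 0}. p \<alpha> * (X N \<alpha> * R N \<alpha>)) \<longlonglongrightarrow>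
      (\<Sum>\<alpha>\<in>{\<alpha>. p \<alpha> \<noteq> 0}. p \<alpha> * ((\<Prod>j<n. (?c * (of_int (m j) * 0 + of_int (k j))) ^ \<alpha> j) * (if e \<alpha> = q then 1 else 0)))"
    by (intro tendsto_sum tendsto_mult tendsto_const X R) simp
  moreover have "(\<Sum>\<alpha>\<in>{\<alpha>. p \<alpha> \<noteq> 0}. p \<alpha> * ((\<Prod>j<n. (?c * (of_int (m j) * 0 + of_int (k j))) ^ \<alpha> j) * (if e \<alpha> = q then 1 else 0)))
      = symb n (senior n a p) k"
  proof -
    have "symb n (senior n a p) k = (\<Sum>\<alpha>\<in>{\<alpha>. p \<alpha> \<noteq> 0}. senior n a p \<alpha> * (\<Prod>j<n. (?c * of_int (k j)) ^ \<alpha> j))"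
      by (rule symb_superset[OF fin]) (auto simp: senior_def)
    also have "\<dots> = (\<Sum>\<alpha>\<in>{\<alpha>. p \<alpha> \<noteq> 0}. p \<alpha> * ((\<Prod>j<n. (?c * (of_int (m j) * 0 + of_int (k j))) ^ \<alpha> j) * (if e \<alpha> = q then 1 else 0)))"
      using q(2) by (intro sum.cong) (auto simp: senior_def e_def)
    finally show ?thesis by simp
  qed
  ultimately show ?thesis by (simp add: tendsto_cong)
qed

text \<open>Kronecker substitution: on the curve \<open>k i = x ^ (H ^ i)\<close> the symbol becomes
  a polynomial in the single variable \<open>x\<close>. The base \<open>H\<close> separates the
  occurring multiindices, so distinct monomials get distinct exponents \<open>E\<close> and no
  coefficients merge. A polynomial with infinitely many roots is zero.\<close>

lemma symb_eq_0_imp: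
  assumes p: "diff_op n p" and zero: "\<And>k. k \<in> freqs n \<Longrightarrow> symb n p k = 0"
  shows "p \<alpha> = 0"
proof (rule ccontr)
  assume \<alpha>: "p \<alpha> \<noteq> 0"
  let ?c = "2 * complex_of_real pi * \<i>" and ?A = "{\<alpha>. p \<alpha> \<noteq> 0}"
  have fin: "finite ?A" using p by (simp add: diff_op_def)
  let ?D = "(\<lambda>(\<beta>, \<gamma>) i. int (\<beta> i) - int (\<gamma> i)) ` {x \<in> ?A \<times> ?A. fst x \<noteq> snd x}"
  have finD: "finite ?D" using fin by simp
  have nzD: "\<exists>i<n. m i \<noteq> 0" if mD: "m \<in> ?D" for m
  proof -
    obtain \<beta> \<gamma> where b: "p \<beta> \<noteq> 0" "p \<gamma> \<noteq> 0" "\<beta> \<noteq> \<gamma>" and m: "m = (\<lambda>i. int (\<beta> i) - int (\<gamma> i))"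
      using mD by auto
    obtain i where i: "\<beta> i \<noteq> \<gamma> i" using b(3) by (meson ext)
    have "i < n"
    proof (rule ccontr)
      assume "\<not> i < n"
      then have "\<beta> i = 0" "\<gamma> i = 0" using p b by (simp_all add: diff_op_def)
      then show False using i by simp
    qed
    then show ?thesis using i m by auto
  qed
  obtain H :: nat where H: "\<forall>m\<in>?D. (\<Sum>i<n. m i * int H ^ i) \<noteq> 0"
    using base_separating_vectors[of ?D n, OF finD nzD] by blast
  define E where "E \<beta> = (\<Sum>i<n. \<beta> i * H ^ i)" for \<beta> :: "nat \<Rightarrow> nat"
  have inj: "\<beta> = \<gamma>" if "p \<beta> \<noteq> 0" "p \<gamma> \<noteq> 0" "E \<beta> = E \<gamma>" for \<beta> \<gamma>
  proof (rule ccontr)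
    assume "\<beta> \<noteq> \<gamma>"
    then have "(\<lambda>i. int (\<beta> i) - int (\<gamma> i)) \<in> ?D"
      using that by (intro image_eqI[of _ _ "(\<beta>, \<gamma>)"]) auto
    from bspec[OF H this] have "(\<Sum>i<n. int (\<beta> i) * int H ^ i) \<noteq> (\<Sum>i<n. int (\<gamma> i) * int H ^ i)"
      by (simp add: left_diff_distrib sum_subtractf)
    moreover have "int (E \<beta>) = int (E \<gamma>)" using that by simp
    ultimately show False by (simp add: E_def)
  qed
  define r where "r \<beta> = p \<beta> * ?c ^ (\<Sum>i<n. \<beta> i)" for \<beta>
  define Q where "Q = (\<Sum>\<beta>\<in>?A. monom (r \<beta>) (E \<beta>))"
  have "poly Q (of_nat x) = 0" for x :: nat
  proof -
    define k where "k i = (if i < n then int x ^ (H ^ i) else 0)" for i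
    have "k \<in> freqs n" by (simp add: k_def freqs_def)
    from zero[OF this] have "0 = (\<Sum>\<beta>\<in>?A. p \<beta> * (\<Prod>j<n. (?c * of_int (k j)) ^ \<beta> j))" by (simp add: symb_def)
    also have "\<dots> = (\<Sum>\<beta>\<in>?A. r \<beta> * of_nat x ^ E \<beta>)"
    proof (intro sum.cong refl)
      fix \<beta>
      have "(\<Prod>j<n. (?c * of_int (k j)) ^ \<beta> j) = (\<Prod>j<n. ?c ^ \<beta> j * of_nat x ^ (\<beta> j * H ^ j))"
        by (intro prod.cong refl) (simp add: k_def power_mult_distrib power_mult[symmetric] mult.commute)
      also have "\<dots> = ?c ^ (\<Sum>i<n. \<beta> i) * of_nat x ^ E \<beta>"
        by (simp only: prod.distrib E_def power_sum)
      finally show "p \<beta> * (\<Prod>j<n. (?c * of_int (k j)) ^ \<beta> j) = r \<beta> * of_nat x ^ E \<beta>"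
        by (simp add: r_def)
    qed
    finally show ?thesis by (simp add: Q_def poly_sum poly_monom)
  qed
  then have "range (of_nat :: nat \<Rightarrow> complex) \<subseteq> {x. poly Q x = 0}" by auto
  moreover have "infinite (range (of_nat :: nat \<Rightarrow> complex))"
    by (rule range_inj_infinite) (simp add: inj_on_def)
  ultimately have "Q = 0" using poly_roots_finite[of Q] finite_subset by blast
  then have "0 = coeff Q (E \<alpha>)" by simp
  also have "\<dots> = (\<Sum>\<beta>\<in>?A. if \<beta> = \<alpha> then r \<beta> else 0)"
    unfolding Q_def coeff_sum coeff_monom using inj \<alpha> by (intro sum.cong refl if_cong) auto
  also have "\<dots> = r \<alpha>" using \<alpha> fin by simp
  finally show False using \<alpha> by (simp add: r_def)
qed

lemma symb_linear:
  assumes "diff_op n u" "diff_op n v"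
  shows "diff_op n (\<lambda>\<alpha>. x * u \<alpha> + y * v \<alpha>)"
    and "symb n (\<lambda>\<alpha>. x * u \<alpha> + y * v \<alpha>) k = x * symb n u k + y * symb n v k"
proof -
  let ?A = "{\<alpha>. u \<alpha> \<noteq> 0} \<union> {\<alpha>. v \<alpha> \<noteq> 0}"
  have fin: "finite ?A" using assms by (simp add: diff_op_def)
  have sub: "{\<alpha>. x * u \<alpha> + y * v \<alpha> \<noteq> 0} \<subseteq> ?A" by auto
  show "diff_op n (\<lambda>\<alpha>. x * u \<alpha> + y * v \<alpha>)"
    unfolding diff_op_def
  proof (intro conjI allI impI)
    show "finite {\<alpha>. x * u \<alpha> + y * v \<alpha> \<noteq> 0}" by (rule finite_subset[OF sub fin])
  next
    fix \<alpha> i assume "x * u \<alpha> + y * v \<alpha> \<noteq> 0" "n \<le> i"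
    then have "u \<alpha> \<noteq> 0 \<or> v \<alpha> \<noteq> 0" by auto
    then show "\<alpha> i = 0" using assms \<open>n \<le> i\<close> by (auto simp: diff_op_def)
  qed
  have "symb n u k = (\<Sum>\<alpha>\<in>?A. u \<alpha> * (\<Prod>j<n. (2 * of_real pi * \<i> * of_int (k j)) ^ \<alpha> j))"
    "symb n v k = (\<Sum>\<alpha>\<in>?A. v \<alpha> * (\<Prod>j<n. (2 * of_real pi * \<i> * of_int (k j)) ^ \<alpha> j))"
    by (rule symb_superset[OF fin], blast)+
  then show "symb n (\<lambda>\<alpha>. x * u \<alpha> + y * v \<alpha>) k = x * symb n u k + y * symb n v k"
    unfolding symb_superset[OF fin sub]
    by (simp add: distrib_right sum.distrib sum_distrib_left mult.assoc)
qed

text \<open>If all minors vanish and the symbol of \<open>u\<close> is nonzero at \<open>l\<close>,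
  the combination of \<open>u\<close> and \<open>v\<close> with the two symbol values at
  \<open>l\<close> as coefficients has zero symbol, hence is zero, against independence.\<close>

lemma lin_indep2_minor:
  assumes "diff_op n u" "diff_op n v" "lin_indep2 u v"
  shows "\<exists>k\<in>freqs n. \<exists>l\<in>freqs n. symb n u k * symb n v l \<noteq> symb n v k * symb n u l"
proof (rule ccontr)
  assume "\<not> (\<exists>k\<in>freqs n. \<exists>l\<in>freqs n. symb n u k * symb n v l \<noteq> symb n v k * symb n u l)"
  then have eq: "symb n u k * symb n v l = symb n v k * symb n u l" if "k \<in> freqs n" "l \<in> freqs n" for k l
    using that by blast
  have li: "x = 0 \<and> y = 0" if "\<And>\<alpha>. x * u \<alpha> + y * v \<alpha> = 0" for x y
    using assms(3) that unfolding lin_indep2_def by blast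
  show False
  proof (cases "\<forall>l\<in>freqs n. symb n u l = 0")
    case True
    then have "u \<alpha> = 0" for \<alpha> by (intro symb_eq_0_imp[OF assms(1)]) simp
    then show False using li[of 1 0] by simp
  next
    case False
    then obtain l where l: "l \<in> freqs n" "symb n u l \<noteq> 0" by blast
    have "symb n v l * u \<alpha> + (- symb n u l) * v \<alpha> = 0" for \<alpha>
    proof (rule symb_eq_0_imp[OF symb_linear(1)[OF assms(1,2)]])
      fix k assume "k \<in> freqs n"
      then show "symb n (\<lambda>\<alpha>. symb n v l * u \<alpha> + (- symb n u l) * v \<alpha>) k = 0"
        unfolding symb_linear(2)[OF assms(1,2)] using eq[of k l] l(1) by (simp add: mult.commute)
    qed
    then show False using li[of "symb n v l" "- symb n u l"] l(2) by simp
  qed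
qed

lemma diff_op_senior: "diff_op n p \<Longrightarrow> diff_op n (senior n a p)"
  unfolding diff_op_def senior_def by (auto elim!: rev_finite_subset split: if_splits)

text \<open>Each scale is chosen after the earlier ones are fixed, so the earlier summand is a fixed
  shift in the dilation limit and finitely many eventual conditions must be met. The later index
  thus always dictates the direction of the symbol vector.\<close>

lemma lacunary_scales:
  fixes w :: "nat \<Rightarrow> nat" and \<kappa> :: "nat \<Rightarrow> nat \<Rightarrow> int"
  assumes "finite S" and "\<eta> > 0"
    and lim: "\<And>p m k. p \<in> S \<Longrightarrow> (\<lambda>N. symb n p (\<lambda>i. m i + int N ^ w i * k i) / of_nat N ^ q) \<longlonglongrightarrow> \<tau> p k"
  shows "\<exists>z :: nat \<Rightarrow> nat. \<forall>j. z j \<ge> 1 \<and> (\<forall>i\<in>{..<j}. \<forall>p\<in>S.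
    cmod (symb n p (\<lambda>l. int (z i) ^ w l * \<kappa> i l + int (z j) ^ w l * \<kappa> j l) / of_nat (z j) ^ q - \<tau> p (\<kappa> j)) \<le> \<eta>)"
proof (rule dependent_wellorder_choice)
  fix r j and f g :: "nat \<Rightarrow> nat" assume "\<And>i. i < j \<Longrightarrow> f i = g i"
  then show "(r \<ge> 1 \<and> (\<forall>i\<in>{..<j}. \<forall>p\<in>S.
      cmod (symb n p (\<lambda>l. int (f i) ^ w l * \<kappa> i l + int r ^ w l * \<kappa> j l) / of_nat r ^ q - \<tau> p (\<kappa> j)) \<le> \<eta>)) =
    (r \<ge> 1 \<and> (\<forall>i\<in>{..<j}. \<forall>p\<in>S.
      cmod (symb n p (\<lambda>l. int (g i) ^ w l * \<kappa> i l + int r ^ w l * \<kappa> j l) / of_nat r ^ q - \<tau> p (\<kappa> j)) \<le> \<eta>))"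
    by simp
next
  fix j and f :: "nat \<Rightarrow> nat"
  have "eventually (\<lambda>r. cmod (symb n p (\<lambda>l. int (f i) ^ w l * \<kappa> i l + int r ^ w l * \<kappa> j l) / of_nat r ^ q - \<tau> p (\<kappa> j)) \<le> \<eta>) sequentially"
    if "p \<in> S" for i p
    using tendstoD[OF lim[OF that, of "\<lambda>l. int (f i) ^ w l * \<kappa> i l" "\<kappa> j"] \<open>\<eta> > 0\<close>]
    by (rule eventually_mono) (simp add: dist_norm)
  then have "eventually (\<lambda>r. r \<ge> 1 \<and> (\<forall>i\<in>{..<j}. \<forall>p\<in>S.
      cmod (symb n p (\<lambda>l. int (f i) ^ w l * \<kappa> i l + int r ^ w l * \<kappa> j l) / of_nat r ^ q - \<tau> p (\<kappa> j)) \<le> \<eta>)) sequentially"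
    using \<open>finite S\<close>
    by (intro eventually_conj eventually_ge_at_top eventually_ball_finite ballI) auto
  then show "\<exists>r. r \<ge> 1 \<and> (\<forall>i\<in>{..<j}. \<forall>p\<in>S.
      cmod (symb n p (\<lambda>l. int (f i) ^ w l * \<kappa> i l + int r ^ w l * \<kappa> j l) / of_nat r ^ q - \<tau> p (\<kappa> j)) \<le> \<eta>)"
    using eventually_happens by force
qed

text \<open>The constant counts the errors: one \<open>\<eta>\<close> from the projection property,
  one from moving \<open>u p\<close> to \<open>\<tau> p\<close>, and \<open>C * \<eta>\<close> for
  each summand in which \<open>u\<close> is replaced by \<open>\<tau>\<close>.\<close>

lemma near_projection_eval:
  fixes P :: "'s \<Rightarrow> complex" and u \<tau> :: "'s \<Rightarrow> complex"
  assumes "finite S" "p \<in> S" and u: "\<And>s. s \<in> S \<Longrightarrow> cmod (u s - \<tau> s) \<le> \<eta>"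
    and P: "\<And>s. s \<in> S \<Longrightarrow> cmod (P s) \<le> C" and proj: "cmod ((\<Sum>s\<in>S. u s * P s) - u p) \<le> \<eta>" and "C \<ge> 0"
  shows "cmod ((\<Sum>s\<in>S. P s * \<tau> s) - \<tau> p) \<le> (2 + real (card S) * C) * \<eta>"
proof -
  have eq: "(\<Sum>s\<in>S. P s * \<tau> s) - \<tau> p = ((\<Sum>s\<in>S. u s * P s) - u p) + (u p - \<tau> p) - (\<Sum>s\<in>S. (u s - \<tau> s) * P s)"
    by (simp add: right_diff_distrib sum_subtractf mult.commute)
  have "cmod (\<Sum>s\<in>S. (u s - \<tau> s) * P s) \<le> (\<Sum>s\<in>S. \<eta> * C)"
  proof (rule sum_norm_le)
    fix s assume s: "s \<in> S"
    show "cmod ((u s - \<tau> s) * P s) \<le> \<eta> * C"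
      unfolding norm_mult
      by (intro mult_mono u P s norm_ge_zero order_trans[OF norm_ge_zero u[OF s]])
  qed
  then have "cmod (\<Sum>s\<in>S. (u s - \<tau> s) * P s) \<le> real (card S) * (\<eta> * C)" by simp
  then have "cmod ((\<Sum>s\<in>S. P s * \<tau> s) - \<tau> p) \<le> \<eta> + \<eta> + real (card S) * (\<eta> * C)"
    unfolding eq using proj u[OF assms(2)]
      norm_triangle_ineq4[of "((\<Sum>s\<in>S. u s * P s) - u p) + (u p - \<tau> p)" "\<Sum>s\<in>S. (u s - \<tau> s) * P s"]
      norm_triangle_ineq[of "(\<Sum>s\<in>S. u s * P s) - u p" "u p - \<tau> p"] by linarith
  then show ?thesis by (simp add: algebra_simps)
qed

text \<open>By the rank one relations \<open>(P1, P2)\<close> is \<open>(u1, u2)\<close> scaled by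
  \<open>Q / v\<close>. The vector \<open>(u1, u2)\<close> is close to
  \<open>(\<tau>1, \<tau>2)\<close>, which the combination kills, and a third component with nonzero
  limit \<open>\<sigma>\<close> bounds the denominator below by half of its modulus.\<close>

lemma near_annihilator:
  fixes u1 u2 \<tau>1 \<tau>2 v \<sigma> P1 P2 Q :: complex
  assumes u: "cmod (u1 - \<tau>1) \<le> \<eta>" "cmod (u2 - \<tau>2) \<le> \<eta>" "cmod (v - \<sigma>) \<le> \<eta>"
    and \<eta>: "\<eta> \<le> cmod \<sigma> / 2" "\<sigma> \<noteq> 0" and Q: "cmod Q \<le> C"
    and rank: "v * P1 = u1 * Q" "v * P2 = u2 * Q"
  shows "cmod (\<tau>2 * P1 - \<tau>1 * P2) \<le> 2 * (cmod \<tau>1 + cmod \<tau>2) * C / cmod \<sigma> * \<eta>"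
proof -
  have "v * (\<tau>2 * P1 - \<tau>1 * P2) = (\<tau>2 * (u1 - \<tau>1) - \<tau>1 * (u2 - \<tau>2)) * Q"
    using rank by algebra
  then have "cmod v * cmod (\<tau>2 * P1 - \<tau>1 * P2) = cmod (\<tau>2 * (u1 - \<tau>1) - \<tau>1 * (u2 - \<tau>2)) * cmod Q"
    by (metis norm_mult)
  also have "\<dots> \<le> ((cmod \<tau>1 + cmod \<tau>2) * \<eta>) * C"
  proof (intro mult_mono Q norm_ge_zero)
    have "cmod (\<tau>2 * (u1 - \<tau>1) - \<tau>1 * (u2 - \<tau>2)) \<le> cmod \<tau>2 * cmod (u1 - \<tau>1) + cmod \<tau>1 * cmod (u2 - \<tau>2)"
      unfolding norm_mult[symmetric] by (rule norm_triangle_ineq4)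
    also have "\<dots> \<le> cmod \<tau>2 * \<eta> + cmod \<tau>1 * \<eta>" by (intro add_mono mult_left_mono u) auto
    finally show "cmod (\<tau>2 * (u1 - \<tau>1) - \<tau>1 * (u2 - \<tau>2)) \<le> (cmod \<tau>1 + cmod \<tau>2) * \<eta>"
      by (simp add: algebra_simps)
    show "0 \<le> (cmod \<tau>1 + cmod \<tau>2) * \<eta>" using order_trans[OF norm_ge_zero u(1)] by simp
  qed
  finally have *: "cmod v * cmod (\<tau>2 * P1 - \<tau>1 * P2) \<le> ((cmod \<tau>1 + cmod \<tau>2) * \<eta>) * C" .
  have "cmod \<sigma> - cmod v \<le> \<eta>" using u(3) norm_triangle_ineq2[of \<sigma> v] by (simp add: norm_minus_commute)
  then have "cmod \<sigma> / 2 \<le> cmod v" using \<eta>(1) by simp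
  then have "cmod \<sigma> / 2 * cmod (\<tau>2 * P1 - \<tau>1 * P2) \<le> cmod v * cmod (\<tau>2 * P1 - \<tau>1 * P2)"
    by (rule mult_right_mono) simp
  with * have "cmod \<sigma> / 2 * cmod (\<tau>2 * P1 - \<tau>1 * P2) \<le> ((cmod \<tau>1 + cmod \<tau>2) * \<eta>) * C" by linarith
  then show ?thesis using \<eta>(2) by (simp add: field_simps)
qed

section \<open>The contradiction\<close>

text \<open>The degenerate case: over an empty \<open>K\<close> the supremum norm is taken over the
  empty set, outside the reach of the norm estimates. But then \<open>C(K)\<close> is zero, so
  injectivity of \<open>J\<close> makes the embedded characters zero.\<close>

lemma iso_complemented_CK_empty:
  assumes "T \<noteq> []" "topspace K = {}" "p \<in> set T" "k \<in> freqs n"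
    and iso: "iso_complemented_CK (CT_bidual n T) (CT_bidual_norm n T) K"
  shows "symb n p k = 0"
proof -
  have cont0: "g = (\<lambda>_. 0)" if "g \<in> cont_fun K" for g
    using that assms(2) by (auto simp: cont_fun_def)
  obtain Y Pr J where Pr: "lin_op (cont_fun K) (cont_fun K) Pr" and Y: "Pr ` cont_fun K = Y"
    and J: "lin_op (CT_bidual n T) Y J" and bij: "bij_betw J (CT_bidual n T) Y"
    using iso unfolding iso_complemented_CK_def by (elim exE conjE)
  have Y0: "y = (\<lambda>_. 0)" if "y \<in> Y" for y
    using that Y lin_op_mem[OF Pr] cont0 by auto
  have inj: "inj_on J (CT_bidual n T)" using bij by (simp add: bij_betw_def)
  have ek: "echar n k \<in> trig_polys n" and tk: "tcoef n (echar n k) k = 1"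
    using tsum_in_trig_polys[of "{k}" n "\<lambda>_. 1"] tcoef_tsum[of "{k}" n "\<lambda>_. 1" k] assms(4)
    by (auto simp: tsum_def)
  have mem: "embed_bidual n T (echar n k) \<in> CT_bidual n T" "(\<lambda>_. 0) \<in> CT_bidual n T"
    using embed_bidual(1)[OF assms(1) ek] fun_subspace_CT_bidual[of n T] by (simp_all add: fun_subspace_def)
  have "J (embed_bidual n T (echar n k)) = J (\<lambda>_. 0)"
    using Y0[OF lin_op_mem[OF J mem(1)]] Y0[OF lin_op_mem[OF J mem(2)]] by simp
  from inj_onD[OF inj this mem] have "embed_bidual n T (echar n k) (coeff_functional n p k) = 0" by simp
  then show ?thesis
    using coeff_functional_CT_dual(1)[OF assms(3)] ek tk by (simp add: embed_bidual_def coeff_functional_def)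
qed

text \<open>Coinciding frequencies pool their coefficients, so the map \<open>kk\<close> may repeat
  values and the scales need not be shown to separate the frequencies.\<close>

lemma sum_over_image_fibres:
  fixes x :: "nat \<Rightarrow> nat \<Rightarrow> complex"
  assumes F: "finite F" and kk: "\<And>a b. a < L \<Longrightarrow> b < L \<Longrightarrow> kk a b \<in> F"
  shows "(\<Sum>k\<in>F. (\<Sum>a<L. \<Sum>b<L. if kk a b = k then x a b else 0) * g k) = (\<Sum>a<L. \<Sum>b<L. x a b * g (kk a b))"
proof -
  have "(\<Sum>k\<in>F. (\<Sum>a<L. \<Sum>b<L. if kk a b = k then x a b else 0) * g k)
      = (\<Sum>k\<in>F. \<Sum>a<L. \<Sum>b<L. (if kk a b = k then x a b else 0) * g k)"
    by (simp only: sum_distrib_right)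
  also have "\<dots> = (\<Sum>a<L. \<Sum>b<L. \<Sum>k\<in>F. (if kk a b = k then x a b else 0) * g k)"
    by (rule sum_rotate3)
  also have "\<dots> = (\<Sum>a<L. \<Sum>b<L. x a b * g (kk a b))"
  proof (intro sum.cong refl)
    fix a b assume "a \<in> {..<L}" "b \<in> {..<L}"
    then have "kk a b \<in> F" using kk by simp
    have "(\<Sum>k\<in>F. (if kk a b = k then x a b else 0) * g k) = (\<Sum>k\<in>F. if k = kk a b then x a b * g k else 0)"
      by (intro sum.cong) auto
    also have "\<dots> = x a b * g (kk a b)" using \<open>kk a b \<in> F\<close> F by simp
    finally show "(\<Sum>k\<in>F. (if kk a b = k then x a b else 0) * g k) = x a b * g (kk a b)" .
  qed
  finally show ?thesis .
qed

text \<open>The constant \<open>C\<close> is fixed before \<open>F\<close> and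
  \<open>\<eta>\<close>. This permits choosing first the size \<open>L\<close> from
  \<open>C\<close>, then the accuracy from \<open>L\<close>, and only then the scales and the
  frequency set.\<close>

lemma no_uniform_multiplier_matrix:
  fixes w :: "nat \<Rightarrow> nat"
  assumes S: "finite S" and p: "p1 \<in> S" "p2 \<in> S" and "C \<ge> 0"
    and lim: "\<And>p m k. p \<in> S \<Longrightarrow> (\<lambda>N. symb n p (\<lambda>i. m i + int N ^ w i * k i) / of_nat N ^ q) \<longlonglongrightarrow> \<tau> p k"
    and k0: "k0 \<in> freqs n" "k1 \<in> freqs n"
    and minor: "\<tau> p1 k0 * \<tau> p2 k1 \<noteq> \<tau> p2 k0 * \<tau> p1 k1"
    and mult: "\<And>F \<eta>. finite F \<Longrightarrow> F \<subseteq> freqs n \<Longrightarrow> \<eta> > 0 \<Longrightarrow> \<exists>P. multiplier_matrix n S C F \<eta> P"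
  shows False
proof -
  define D where "D = \<tau> p2 k1 * \<tau> p1 k0 - \<tau> p1 k1 * \<tau> p2 k0"
  have D: "D \<noteq> 0" using minor by (simp add: D_def mult.commute)
  define Y where "Y = cmod (\<tau> p1 k1) + cmod (\<tau> p2 k1)"
  define Z where "Z = (\<Sum>p\<in>S. cmod (\<tau> p k0))"
  have Y0: "Y \<ge> 0" and Z0: "Z \<ge> 0" by (simp_all add: Y_def Z_def sum_nonneg)
  obtain p3 where p3: "p3 \<in> S" "\<tau> p3 k1 \<noteq> 0"
  proof -
    have "\<tau> p1 k1 \<noteq> 0 \<or> \<tau> p2 k1 \<noteq> 0" using minor by auto
    then show ?thesis using p that by blast
  qed
  define g where "g = cmod (\<tau> p3 k1)"
  have g: "g > 0" using p3 by (simp add: g_def)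
  \<comment> \<open>The bound per unit of \<open>L\<close> for the pairing of the test matrix with
    \<open>\<alpha>\<close>: \<open>Y\<close> bounds the row, \<open>Z\<close> the column,
    \<open>C\<close> the multipliers.\<close>
  define C3 where "C3 = Z * Y * C"
  obtain L x where L: "L > 0"
    and x1: "\<forall>s t. (\<forall>a. cmod (s a) \<le> 1) \<longrightarrow> (\<forall>b. cmod (t b) \<le> 1) \<longrightarrow>
        cmod (\<Sum>a<L. \<Sum>b<L. x a b * (s a * t b)) \<le> real L"
    and x2: "\<forall>A. (\<forall>a<L. \<forall>b<L. cmod (A a b - (if b \<le> a then D else 0)) \<le> 1 / real L) \<longrightarrow>
        cmod (\<Sum>a<L. \<Sum>b<L. x a b * A a b) > C3 * real L"
    using triangular_truncation[OF D, of C3] by blast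
  \<comment> \<open>The two summands are the error constants of the cases \<open>b \<le> a\<close>
    and \<open>a < b\<close>; both are nonnegative, so their sum serves either case.\<close>
  define W where "W = Y * (2 + real (card S) * C) + Z * (2 * Y * C / g)"
  have W1: "Y * (2 + real (card S) * C) \<ge> 0" and W2: "Z * (2 * Y * C / g) \<ge> 0"
    using Y0 Z0 \<open>C \<ge> 0\<close> g by simp_all
  \<comment> \<open>The first bound keeps the symbol of \<open>p3\<close> away from zero, the second
    gives the accuracy \<open>1 / L\<close> demanded of the triangular pattern.\<close>
  define \<eta> where "\<eta> = min (g / 2) (1 / (real L * (W + 1)))"
  have \<eta>: "\<eta> > 0" "\<eta> \<le> g / 2" using g L W1 W2 by (auto simp: \<eta>_def W_def)
  have W\<eta>: "W * \<eta> \<le> 1 / real L"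
  proof -
    have "W * \<eta> \<le> (W + 1) * \<eta>" using \<eta>(1) by (intro mult_right_mono) auto
    also have "\<dots> \<le> (W + 1) * (1 / (real L * (W + 1)))"
      using W1 W2 by (intro mult_left_mono) (auto simp: \<eta>_def W_def)
    also have "\<dots> = 1 / real L"
    proof -
      have "W + 1 \<noteq> 0" using W1 W2 by (simp add: W_def)
      then show ?thesis by simp
    qed
    finally show ?thesis .
  qed
  \<comment> \<open>Interleaving: the frequency \<open>f (2 * a + 1) + f (2 * b)\<close> is dominated by its first summand iff
    \<open>b \<le> a\<close>, which produces the triangular pattern.\<close>
  define \<kappa> where "\<kappa> j = (if even j then k1 else k0)" for j :: nat
  obtain z :: "nat \<Rightarrow> nat" where z: "\<forall>j. z j \<ge> 1 \<and> (\<forall>i\<in>{..<j}. \<forall>p\<in>S.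
    cmod (symb n p (\<lambda>l. int (z i) ^ w l * \<kappa> i l + int (z j) ^ w l * \<kappa> j l) / of_nat (z j) ^ q - \<tau> p (\<kappa> j)) \<le> \<eta>)"
    using lacunary_scales[where \<kappa> = \<kappa> and \<tau> = \<tau> and n = n and w = w and q = q, OF S \<eta>(1) lim] by blast
  define f where "f j = (\<lambda>l. int (z j) ^ w l * \<kappa> j l)" for j
  have f_freq: "f j \<in> freqs n" for j using k0 by (simp add: f_def \<kappa>_def freqs_def)
  define kk where "kk a b = (\<lambda>l. f (2 * a + 1) l + f (2 * b) l)" for a b
  define F where "F = (\<lambda>(a, b). kk a b) ` ({..<L} \<times> {..<L})"
  have F: "finite F" "F \<subseteq> freqs n"
    unfolding F_def kk_def using freqs_add[OF f_freq f_freq] by auto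
  have kkF: "kk a b \<in> F" if "a < L" "b < L" for a b
    unfolding F_def using that by (intro image_eqI[of _ _ "(a, b)"]) auto
  obtain P where P: "multiplier_matrix n S C F \<eta> P" using mult[OF F \<eta>(1)] by blast
  have P1: "symb n p'' k * P p p' k = symb n p k * P p'' p' k"
    if "k \<in> F" "p \<in> S" "p' \<in> S" "p'' \<in> S" for k p p' p''
    using P that unfolding multiplier_matrix_def by simp
  have P2: "cmod ((\<Sum>p'\<in>S. symb n p' k * P p p' k) - symb n p k) \<le> \<eta>" if "k \<in> F" "p \<in> S" for k p
    using P that unfolding multiplier_matrix_def by simp
  have P3: "cmod (\<Sum>k\<in>F. y k * P p p' k) \<le> C * torus_norm n (tsum n F y)" if "p \<in> S" "p' \<in> S" for p p' y
    using P that unfolding multiplier_matrix_def by simp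
  have Pbd: "cmod (P p p' k) \<le> C" if k: "k \<in> F" and pp: "p \<in> S" "p' \<in> S" for p p' k
  proof -
    have sel: "(\<Sum>l\<in>F. (if l = k then 1 else 0) * h l) = h k" for h :: "_ \<Rightarrow> complex"
      using k F(1) by (simp add: if_distrib[of "\<lambda>z. z * _"] cong: if_cong)
    have "torus_norm n (tsum n F (\<lambda>l. if l = k then 1 else 0)) \<le> 1"
      by (rule torus_norm_le) (simp add: tsum_def sel)
    then have "C * torus_norm n (tsum n F (\<lambda>l. if l = k then 1 else 0)) \<le> C * 1"
      using \<open>C \<ge> 0\<close> by (rule mult_left_mono)
    then show ?thesis using P3[OF pp, of "\<lambda>l. if l = k then 1 else 0"] by (simp add: sel)
  qed
  define \<alpha> where "\<alpha> k = (\<Sum>p'\<in>S. (\<tau> p2 k1 * P p1 p' k - \<tau> p1 k1 * P p2 p' k) * \<tau> p' k0)" for k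
  have approx: "cmod (\<alpha> (kk a b) - (if b \<le> a then D else 0)) \<le> 1 / real L" if ab: "a < L" "b < L" for a b
  proof -
    let ?k = "kk a b"
    note kF = kkF[OF ab]
    define j where "j = (if b \<le> a then 2 * a + 1 else 2 * b)"
    define i where "i = (if b \<le> a then 2 * b else 2 * a + 1)"
    have ij: "i < j" by (simp add: i_def j_def)
    have kij: "?k = (\<lambda>l. int (z i) ^ w l * \<kappa> i l + int (z j) ^ w l * \<kappa> j l)"
      by (simp add: kk_def f_def i_def j_def add.commute)
    have zj: "z j \<ge> 1" using z by simp
    \<comment> \<open>Division by the dominant scale normalises the symbols. The rank one relation
      is homogeneous, and the projection error does not grow because \<open>s\<close> has modulus at
      least 1.\<close>
    define s where "s = complex_of_nat (z j) ^ q"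
    have s: "s \<noteq> 0" using zj by (simp add: s_def)
    have s1: "cmod s \<ge> 1" using zj by (simp add: s_def norm_power)
    define u where "u p = symb n p ?k / s" for p
    have u: "cmod (u p - \<tau> p (\<kappa> j)) \<le> \<eta>" if "p \<in> S" for p
      using z ij that unfolding u_def s_def kij by simp
    have u1: "u p'' * P p p' ?k = u p * P p'' p' ?k" if "p \<in> S" "p' \<in> S" "p'' \<in> S" for p p' p''
      using P1[OF kF that] by (simp add: u_def)
    have u2: "cmod ((\<Sum>p'\<in>S. u p' * P p p' ?k) - u p) \<le> \<eta>" if "p \<in> S" for p
    proof -
      have "(\<Sum>p'\<in>S. u p' * P p p' ?k) - u p = ((\<Sum>p'\<in>S. symb n p' ?k * P p p' ?k) - symb n p ?k) / s"
        by (simp add: u_def diff_divide_distrib sum_divide_distrib)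
      then have "cmod ((\<Sum>p'\<in>S. u p' * P p p' ?k) - u p) = cmod ((\<Sum>p'\<in>S. symb n p' ?k * P p p' ?k) - symb n p ?k) / cmod s"
        by (simp only: norm_divide)
      also have "\<dots> \<le> cmod ((\<Sum>p'\<in>S. symb n p' ?k * P p p' ?k) - symb n p ?k) / 1"
        using s1 by (intro divide_left_mono) auto
      finally show ?thesis using P2[OF kF that] by simp
    qed
    show ?thesis
    proof (cases "b \<le> a")
      case True
      then have \<kappa>j: "\<kappa> j = k0" by (simp add: \<kappa>_def j_def)
      have E: "cmod ((\<Sum>p'\<in>S. P p p' ?k * \<tau> p' k0) - \<tau> p k0) \<le> (2 + real (card S) * C) * \<eta>" if "p \<in> S" for p
        by (rule near_projection_eval[where u = u and \<tau> = "\<lambda>p. \<tau> p k0", OF S that])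
           (use u u2[OF that] Pbd[OF kF that] \<kappa>j \<open>C \<ge> 0\<close> in auto)
      let ?e = "\<lambda>p. (\<Sum>p'\<in>S. P p p' ?k * \<tau> p' k0) - \<tau> p k0"
      have "\<alpha> ?k - D = \<tau> p2 k1 * ?e p1 - \<tau> p1 k1 * ?e p2"
        by (simp add: \<alpha>_def D_def right_diff_distrib left_diff_distrib sum_subtractf sum_distrib_left mult.assoc)
      then have "cmod (\<alpha> ?k - D) \<le> cmod (\<tau> p2 k1) * cmod (?e p1) + cmod (\<tau> p1 k1) * cmod (?e p2)"
        unfolding norm_mult[symmetric] by (simp only: norm_triangle_ineq4)
      also have "\<dots> \<le> cmod (\<tau> p2 k1) * ((2 + real (card S) * C) * \<eta>) + cmod (\<tau> p1 k1) * ((2 + real (card S) * C) * \<eta>)"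
        by (intro add_mono mult_left_mono E p norm_ge_zero)
      also have "\<dots> = (Y * (2 + real (card S) * C)) * \<eta>" by (simp add: Y_def algebra_simps)
      also have "\<dots> \<le> W * \<eta>" using W2 \<eta>(1) by (intro mult_right_mono) (auto simp: W_def)
      finally show ?thesis using True W\<eta> by simp
    next
      case False
      then have \<kappa>j: "\<kappa> j = k1" by (simp add: \<kappa>_def j_def)
      have E: "cmod (\<tau> p2 k1 * P p1 p' ?k - \<tau> p1 k1 * P p2 p' ?k) \<le> 2 * Y * C / g * \<eta>" if "p' \<in> S" for p'
        unfolding Y_def g_def
        by (rule near_annihilator[where ?u1.0 = "u p1" and ?u2.0 = "u p2" and v = "u p3" and Q = "P p3 p' ?k"])
           (use u[OF p(1)] u[OF p(2)] u[OF p3(1)] \<kappa>j \<eta>(2) p3(2) Pbd[OF kF p3(1) that]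
             u1[OF p(1) that p3(1)] u1[OF p(2) that p3(1)] in \<open>simp_all add: g_def\<close>)
      have "cmod (\<alpha> ?k) \<le> (\<Sum>p'\<in>S. (2 * Y * C / g * \<eta>) * cmod (\<tau> p' k0))"
        unfolding \<alpha>_def
      proof (rule sum_norm_le)
        fix p' assume "p' \<in> S"
        from mult_right_mono[OF E[OF this] norm_ge_zero]
        show "cmod ((\<tau> p2 k1 * P p1 p' ?k - \<tau> p1 k1 * P p2 p' ?k) * \<tau> p' k0) \<le> 2 * Y * C / g * \<eta> * cmod (\<tau> p' k0)"
          by (simp only: norm_mult)
      qed
      also have "\<dots> = (Z * (2 * Y * C / g)) * \<eta>"
        by (simp only: Z_def sum_distrib_left[symmetric]) (simp add: mult_ac)
      also have "\<dots> \<le> W * \<eta>" using W1 \<eta>(1) by (intro mult_right_mono) (auto simp: W_def)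
      finally show ?thesis using False W\<eta> by simp
    qed
  qed
  have big: "cmod (\<Sum>a<L. \<Sum>b<L. x a b * \<alpha> (kk a b)) > C3 * real L"
    using x2[rule_format, of "\<lambda>a b. \<alpha> (kk a b)"] approx by blast
  define X where "X k = (\<Sum>a<L. \<Sum>b<L. if kk a b = k then x a b else 0)" for k
  have fibre: "(\<Sum>k\<in>F. X k * h k) = (\<Sum>a<L. \<Sum>b<L. x a b * h (kk a b))" for h
    unfolding X_def by (rule sum_over_image_fibres[OF F(1) kkF])
  \<comment> \<open>Characters turn sums of frequencies into products, so the value of the
    polynomial at \<open>t\<close> is the bilinear form of \<open>x\<close> at two unimodular
    sequences, one on odd and one on even indices.\<close>
  have uX: "torus_norm n (tsum n F X) \<le> real L"
  proof (rule torus_norm_le)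
    fix t
    have "tsum n F X t = (\<Sum>a<L. \<Sum>b<L. x a b * (echar n (f (2 * a + 1)) t * echar n (f (2 * b)) t))"
      unfolding tsum_def fibre by (simp only: kk_def echar_add_freq)
    then show "cmod (tsum n F X t) \<le> real L"
      using x1[rule_format, of "\<lambda>a. echar n (f (2 * a + 1)) t" "\<lambda>b. echar n (f (2 * b)) t"] by simp
  qed
  have small: "cmod (\<Sum>k\<in>F. X k * P p p' k) \<le> C * real L" if "p \<in> S" "p' \<in> S" for p p'
    using P3[OF that, of X] mult_left_mono[OF uX \<open>C \<ge> 0\<close>] by linarith
  have "(\<Sum>k\<in>F. X k * \<alpha> k)
      = (\<Sum>p'\<in>S. (\<tau> p2 k1 * (\<Sum>k\<in>F. X k * P p1 p' k) - \<tau> p1 k1 * (\<Sum>k\<in>F. X k * P p2 p' k)) * \<tau> p' k0)"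
  proof -
    have "(\<Sum>k\<in>F. X k * \<alpha> k) = (\<Sum>k\<in>F. \<Sum>p'\<in>S. X k * ((\<tau> p2 k1 * P p1 p' k - \<tau> p1 k1 * P p2 p' k) * \<tau> p' k0))"
      by (simp only: \<alpha>_def sum_distrib_left)
    also have "\<dots> = (\<Sum>p'\<in>S. \<Sum>k\<in>F. X k * ((\<tau> p2 k1 * P p1 p' k - \<tau> p1 k1 * P p2 p' k) * \<tau> p' k0))"
      by (rule sum.swap)
    also have "\<dots> = (\<Sum>p'\<in>S. (\<tau> p2 k1 * (\<Sum>k\<in>F. X k * P p1 p' k) - \<tau> p1 k1 * (\<Sum>k\<in>F. X k * P p2 p' k)) * \<tau> p' k0)"
      unfolding sum_distrib_left sum_subtractf[symmetric] sum_distrib_right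
      by (intro sum.cong refl) (simp add: algebra_simps)
    finally show ?thesis .
  qed
  also have "cmod \<dots> \<le> (\<Sum>p'\<in>S. (Y * (C * real L)) * cmod (\<tau> p' k0))"
  proof (rule sum_norm_le)
    fix p' assume p': "p' \<in> S"
    have "cmod (\<tau> p2 k1 * (\<Sum>k\<in>F. X k * P p1 p' k) - \<tau> p1 k1 * (\<Sum>k\<in>F. X k * P p2 p' k))
        \<le> cmod (\<tau> p2 k1) * cmod (\<Sum>k\<in>F. X k * P p1 p' k) + cmod (\<tau> p1 k1) * cmod (\<Sum>k\<in>F. X k * P p2 p' k)"
      unfolding norm_mult[symmetric] by (rule norm_triangle_ineq4)
    also have "\<dots> \<le> cmod (\<tau> p2 k1) * (C * real L) + cmod (\<tau> p1 k1) * (C * real L)"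
      by (intro add_mono mult_left_mono small p p' norm_ge_zero)
    also have "\<dots> = Y * (C * real L)" by (simp add: Y_def algebra_simps)
    finally show "cmod ((\<tau> p2 k1 * (\<Sum>k\<in>F. X k * P p1 p' k) - \<tau> p1 k1 * (\<Sum>k\<in>F. X k * P p2 p' k)) * \<tau> p' k0)
        \<le> Y * (C * real L) * cmod (\<tau> p' k0)"
      unfolding norm_mult by (rule mult_right_mono) simp
  qed
  also have "\<dots> = C3 * real L" 
    by (simp only: C3_def Z_def sum_distrib_left[symmetric]) (simp add: mult_ac)
  finally show False using big by (simp add: fibre)
qed

theorem theorem1:
  fixes n :: nat and T :: "((nat \<Rightarrow> nat) \<Rightarrow> complex) list" and a :: "nat \<Rightarrow> real"
    and K :: "'k topology"
  assumes "n \<ge> 1"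
    and "\<forall>p\<in>set T. diff_op n p"
    and "\<forall>k<n. a k > 0"
    and "\<forall>p\<in>set T. \<forall>\<alpha>. p \<alpha> \<noteq> 0 \<longrightarrow> (\<Sum>k<n. real (\<alpha> k) / a k) \<le> 1"
    and "\<exists>i<length T. \<exists>j<length T. lin_indep2 (senior n a (T ! i)) (senior n a (T ! j))"
    and "compact_space K" and "Hausdorff_space K"
  shows "\<not> iso_complemented_CK (CT_bidual n T) (CT_bidual_norm n T) K"
proof
  assume iso: "iso_complemented_CK (CT_bidual n T) (CT_bidual_norm n T) K"
  have T: "T \<noteq> []" using assms(5) by auto
  have dop: "diff_op n p" if "p \<in> set T" for p using assms(2) that by simp
  obtain p1 p2 where p: "p1 \<in> set T" "p2 \<in> set T" and li: "lin_indep2 (senior n a p1) (senior n a p2)"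
    using assms(5) nth_mem by blast
  obtain k0 k1 where k: "k0 \<in> freqs n" "k1 \<in> freqs n"
    and minor: "symb n (senior n a p1) k0 * symb n (senior n a p2) k1 \<noteq> symb n (senior n a p2) k0 * symb n (senior n a p1) k1"
    using lin_indep2_minor[OF diff_op_senior[OF dop[OF p(1)]] diff_op_senior[OF dop[OF p(2)]] li] by blast
  \<comment> \<open>All multiindices of all operators are treated together, so that one
    \<open>w\<close> and one \<open>q\<close> serve the whole collection and the symbols share a
    common normalisation.\<close>
  define \<A> where "\<A> = (\<Union>p\<in>set T. {\<alpha>. p \<alpha> \<noteq> 0})"
  have finA: "finite \<A>" using assms(2) by (auto simp: \<A>_def diff_op_def)
  have "\<exists>w q. (\<forall>i<n. w i > (0::nat)) \<and> (\<forall>\<alpha>\<in>\<A>. (\<Sum>i<n. w i * \<alpha> i) \<le> q \<and>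
     ((\<Sum>i<n. w i * \<alpha> i) = q \<longleftrightarrow> (\<Sum>i<n. real (\<alpha> i) / a i) = 1))"
    by (rule integer_weights[OF _ finA]) (use assms(3,4) in \<open>auto simp: \<A>_def\<close>)
  then obtain w q where w: "\<forall>i<n. w i > (0::nat)"
    and q: "\<forall>\<alpha>\<in>\<A>. (\<Sum>i<n. w i * \<alpha> i) \<le> q \<and> ((\<Sum>i<n. w i * \<alpha> i) = q \<longleftrightarrow> (\<Sum>i<n. real (\<alpha> i) / a i) = 1)"
    by (elim exE conjE)
  have lim: "(\<lambda>N. symb n p (\<lambda>i. m i + int N ^ w i * k i) / of_nat N ^ q) \<longlonglongrightarrow> symb n (senior n a p) k"
    if "p \<in> set T" for p m k
  proof (rule symb_dilation_limit[OF dop[OF that]])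
    fix \<alpha> assume "p \<alpha> \<noteq> 0"
    then have "\<alpha> \<in> \<A>" using that by (auto simp: \<A>_def)
    then show "(\<Sum>i<n. w i * \<alpha> i) \<le> q" "(\<Sum>i<n. w i * \<alpha> i) = q \<longleftrightarrow> (\<Sum>i<n. real (\<alpha> i) / a i) = 1"
      using q by simp_all
  qed (use w in simp)
  show False
  proof (cases "topspace K = {}")
    case True
    \<comment> \<open>The symbol of \<open>p1\<close> vanishes everywhere, hence so does
      \<open>p1\<close> with its senior part, against the nonzero minor.\<close>
    have "p1 \<alpha> = 0" for \<alpha>
      by (rule symb_eq_0_imp[OF dop[OF p(1)]]) (rule iso_complemented_CK_empty[OF T True p(1) _ iso])
    then have "senior n a p1 = (\<lambda>_. 0)" by (auto simp: senior_def)
    then show False using minor by (simp add: symb_def)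
  next
    case False
    from multiplier_matrix_exists[OF T assms(6) False iso]
    obtain C where C: "C \<ge> 0"
      "\<forall>F \<eta>. finite F \<longrightarrow> F \<subseteq> freqs n \<longrightarrow> \<eta> > 0 \<longrightarrow> (\<exists>P. multiplier_matrix n (set T) C F \<eta> P)"
      by (elim exE conjE)
    show False
      by (rule no_uniform_multiplier_matrix[where S = "set T" and \<tau> = "\<lambda>p. symb n (senior n a p)"
            and w = w and q = q, OF _ p C(1) lim k minor])
         (use C(2) in simp_all)
  qed
qed

end
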